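(* Fix one type $\mathcal T\in\{K, WK, S, PL\}$; below, "$s$-Kähler" in quotation marks means generalized $s$-Kähler of type $\mathcal T$, and an "$s$-Kähler" form is a form $\Omega$ as in the definition of type $\mathcal T$. Let $X$ be an $m$-dimensional complex manifold which is "$s$-Kähler" for all $s$ with $p\le s<m$, and let $Y$ be an $n$-dimensional complex manifold which is "$s$-Kähler" for all $s$ with $q\le s<n$, where $1\le p\le m-1$ and $1\le q\le n-1$. Suppose that $X$ and $Y$ have "$s$-Kähler" forms, respectively $\{\Omega_p,\dots,\Omega_{m-1}\}$ ($\Omega_s$ of bidegree $(s,s)$ on $X$) and $\{\Phi_q,\dots,\Phi_{n-1}\}$ ($\Phi_s$ of bidegree $(s,s)$ on $Y$), all of which have non-negative eigenvalues, i.e. each of them is, at every point, both transverse and positive (it lies in $(WP^s)^{int}\cap P^s$). Suppose moreover: (i) if $m-p\le n-q$: for every index $a$ with $1\le a<m-p$, either $\partial\Omega_{p+a}=0$, or $\partial\Phi_r=0$ for every $r\in\{n-a,\dots,n-1\}$; (ii) if $m-p>n-q$: for every index $a$ with $1\le a<n-q$, either $\partial\Phi_{q+a}=0$, or $\partial\Omega_r=0$ for every $r\in\{m-a,\dots,m-1\}$. Then $X\times Y$ is "$s$-Kähler" for all $s$ with $m+n-\min(m-p,n-q)\le s<m+n$, with "$s$-Kähler" forms in $(WP^s)^{int}\cap P^s$.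
   Context: Positivity. Let $E$ be a complex vector space of dimension $n$, $\sigma_p:=i^{p^2}2^{-p}$, and let $\Lambda^{p,p}_{\mathbb R}(E^* )$ be the space of real $(p,p)$-forms. An $(n,n)$-form is positive (strictly positive) if it is $c\,dv$ with $c\ge 0$ ($c>0$), where $dv=\sigma_n\varphi_1\wedge\dots\wedge\varphi_n\wedge\overline{\varphi_1\wedge\dots\wedge\varphi_n}$ for a basis $\varphi_1,\dots,\varphi_n$ of $E^*$. Let $1\le p\le n-1$ and $k=n-p$. Every $\Omega\in\Lambda^{p,p}_{\mathbb R}(E^* )$ can be written $\Omega=\sigma_p\sum_{I,J}\Omega_{I\bar J}\,\varphi_I\wedge\overline{\varphi_J}$, summed over increasing multi-indices of length $p$, with $(\Omega_{I\bar J})$ a Hermitian matrix. $\Omega$ is positive ($\Omega\in P^p$) if this matrix has only non-negative eigenvalues; equivalently $\Omega=\sigma_p\sum_j\lambda_j\Psi_j\wedge\overline{\Psi_j}$ with $\lambda_j\ge0$ and $\Psi_j\in\Lambda^{p,0}(E^* )$. $\Omega$ is weakly positive ($\Omega\in WP^p$) if $\Omega\wedge\sigma_k\,\psi_1\wedge\dots\wedge\psi_k\wedge\overline{\psi_1\wedge\dots\wedge\psi_k}$ is a positive $(n,n)$-form for all $\psi_1,\dots,\psi_k\in E^*$. $\Omega$ is transverse ($\Omega\in(WP^p)^{int}$) if these $(n,n)$-forms are strictly positive whenever $\psi_1,\dots,\psi_k$ are linearly independent. A smooth real $(p,p)$-form on a complex manifold is positive, weakly positive or transverse if it is so at every point,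 with $E=T'_xX$ the holomorphic tangent space. Generalized $p$-Kähler manifolds. Let $X$ be a complex manifold of dimension $n$ and $1\le p\le n-1$. All forms are smooth. - Type K: $X$ has a transverse real $(p,p)$-form $\Omega$ with $d\Omega=0$. - Type WK: $X$ has a transverse real $(p,p)$-form $\Omega$ with $\partial\Omega=\partial\bar\partial\alpha$ for some form $\alpha$. - Type S: $X$ has a closed real $2p$-form $\Psi$ whose $(p,p)$-component $\Omega:=\Psi^{p,p}$ is transverse. - Type PL: $X$ has a transverse real $(p,p)$-form $\Omega$ with $\partial\bar\partial\Omega=0$. In each case $\Omega$ is called a "$p$-Kähler" form of that type. Complex manifolds need not be compact. *)

theory Defs
  imports "HOL-Analysis.Analysis"
begin

section \<open>Exterior algebra of a complex vector space\<close>

text \<open>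
  \<open>E\<close> is \<open>complex ^ 'm\<close>, of complex dimension \<open>n = CARD('m)\<close>. A complex-valued exterior form
  on \<open>E\<close> (an element of the exterior algebra of the complexified real dual) is a function on
  lists of vectors; a form of degree \<open>k\<close> vanishes on lists of length different from \<open>k\<close>.
\<close>

type_synonym 'm form = "(complex ^ 'm) list \<Rightarrow> complex"

definition alternating_form :: "nat \<Rightarrow> 'm::finite form \<Rightarrow> bool" where
  "alternating_form k \<omega> \<longleftrightarrow>
     (\<forall>vs. length vs \<noteq> k \<longrightarrow> \<omega> vs = 0) \<and>
     (\<forall>vs i. length vs = k \<longrightarrow> i < k \<longrightarrow> linear (\<lambda>v. \<omega> (vs[i := v]))) \<and>
     (\<forall>vs i j. length vs = k \<longrightarrow> i < j \<longrightarrow> j < k \<longrightarrow> vs ! i = vs ! j \<longrightarrow> \<omega> vs = 0)"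

definition real_form :: "'m::finite form \<Rightarrow> bool" where
  "real_form \<omega> \<longleftrightarrow> (\<forall>vs. \<omega> vs \<in> \<real>)"

definition conj_form :: "'m::finite form \<Rightarrow> 'm form" where
  "conj_form \<omega> = (\<lambda>vs. cnj (\<omega> vs))"

text \<open>
  The wedge product, summed over shuffles: \<open>S\<close> is the set of positions handed to the first
  factor, and the sign is that of the corresponding shuffle. There are no factorial factors, so
  \<open>\<phi> \<and> \<psi>\<close> sends \<open>[u, v]\<close> to \<open>\<phi> u * \<psi> v - \<phi> v * \<psi> u\<close> for covectors.
\<close>

definition wedge :: "'m::finite form \<Rightarrow> 'm form \<Rightarrow> 'm form" where
  "wedge \<alpha> \<beta> = (\<lambda>vs. \<Sum>S\<in>Pow {..<length vs}.
      (-1) ^ card {(i, j). i \<in> S \<and> j \<in> {..<length vs} - S \<and> j < i}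
        * \<alpha> (nths vs S) * \<beta> (nths vs (- S)))"

definition one_form :: "(complex ^ 'm::finite \<Rightarrow> complex) \<Rightarrow> 'm form" where
  "one_form f = (\<lambda>vs. if length vs = 1 then f (vs ! 0) else 0)"

definition unit_form :: "'m::finite form" where
  "unit_form = (\<lambda>vs. if vs = [] then 1 else 0)"

definition wedge_list :: "(complex ^ 'm::finite \<Rightarrow> complex) list \<Rightarrow> 'm form" where
  "wedge_list fs = foldr (\<lambda>f \<omega>. wedge (one_form f) \<omega>) fs unit_form"

text \<open>Elements of \<open>E\<^sup>*\<close>, and finite families \<open>\<psi> 0, \<dots>, \<psi> (k - 1)\<close> of them.\<close>

definition covector :: "(complex ^ 'm::finite \<Rightarrow> complex) \<Rightarrow> bool" where
  "covector f \<longleftrightarrow> Vector_Spaces.linear (*s) (*) f"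

definition lin_indep_family :: "nat \<Rightarrow> (nat \<Rightarrow> complex ^ 'm::finite \<Rightarrow> complex) \<Rightarrow> bool" where
  "lin_indep_family k \<psi> \<longleftrightarrow>
     (\<forall>a :: nat \<Rightarrow> complex. (\<forall>v. (\<Sum>i<k. a i * \<psi> i v) = 0) \<longrightarrow> (\<forall>i<k. a i = 0))"

definition dual_basis :: "(nat \<Rightarrow> complex ^ 'm::finite \<Rightarrow> complex) \<Rightarrow> bool" where
  "dual_basis \<phi> \<longleftrightarrow>
     (\<forall>i<CARD('m). covector (\<phi> i)) \<and>
     lin_indep_family CARD('m) \<phi> \<and>
     (\<forall>f. covector f \<longrightarrow> (\<exists>a :: nat \<Rightarrow> complex. \<forall>v. f v = (\<Sum>i<CARD('m). a i * \<phi> i v)))"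

text \<open>
  An increasing multi-index of length \<open>p\<close> in \<open>{0, \<dots>, n - 1}\<close> is identified with its underlying
  set.
\<close>

definition multi_indices :: "nat \<Rightarrow> nat \<Rightarrow> nat set set" where
  "multi_indices n p = {I. I \<subseteq> {..<n} \<and> card I = p}"

definition wedge_index ::
    "(nat \<Rightarrow> complex ^ 'm::finite \<Rightarrow> complex) \<Rightarrow> nat set \<Rightarrow> 'm form" where
  "wedge_index \<phi> I = wedge_list (map \<phi> (sorted_list_of_set I))"

text \<open>The form \<open>\<Sum> c\<^sub>I\<^sub>J \<phi>\<^sub>I \<and> conj \<phi>\<^sub>J\<close> with \<open>I\<close> of length \<open>p\<close> and \<open>J\<close> of length \<open>q\<close>.\<close>

definition pq_expansion ::
    "nat \<Rightarrow> nat \<Rightarrow> (nat \<Rightarrow> complex ^ 'm::finite \<Rightarrow> complex) \<Rightarrow>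
     (nat set \<Rightarrow> nat set \<Rightarrow> complex) \<Rightarrow> 'm form" where
  "pq_expansion p q \<phi> c = (\<lambda>vs.
     \<Sum>I\<in>multi_indices CARD('m) p. \<Sum>J\<in>multi_indices CARD('m) q.
       c I J * wedge (wedge_index \<phi> I) (conj_form (wedge_index \<phi> J)) vs)"

definition pq_form :: "nat \<Rightarrow> nat \<Rightarrow> 'm::finite form \<Rightarrow> bool" where
  "pq_form p q \<omega> \<longleftrightarrow> (\<exists>\<phi> c. dual_basis \<phi> \<and> \<omega> = pq_expansion p q \<phi> c)"

definition is_pq_component :: "nat \<Rightarrow> nat \<Rightarrow> 'm::finite form \<Rightarrow> 'm form \<Rightarrow> bool" where
  "is_pq_component p q \<Psi> \<Omega> \<longleftrightarrow>
     (\<exists>\<theta>. (\<forall>r\<le>p + q. pq_form r (p + q - r) (\<theta> r)) \<and>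
          \<Psi> = (\<lambda>vs. \<Sum>r\<le>p + q. \<theta> r vs) \<and> \<Omega> = \<theta> p)"


section \<open>Positivity\<close>

definition sigma :: "nat \<Rightarrow> complex" where
  "sigma p = \<i> ^ (p ^ 2) / 2 ^ p"

text \<open>
  Both notions below are independent of the basis \<open>\<phi>\<close> (a change of basis multiplies the volume
  form by a positive number, and replaces the coefficient matrix by a congruent one), so it makes
  no difference that it is quantified existentially.
\<close>

definition strictly_positive_top_form :: "'m::finite form \<Rightarrow> bool" where
  "strictly_positive_top_form \<omega> \<longleftrightarrow>
     (\<exists>\<phi> (c::real). dual_basis \<phi> \<and> c > 0 \<and>
        \<omega> = (\<lambda>vs. of_real c * (sigma CARD('m) *
                wedge (wedge_list (map \<phi> [0..<CARD('m)]))
                      (conj_form (wedge_list (map \<phi> [0..<CARD('m)]))) vs)))"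

definition hermitian_on :: "'i set \<Rightarrow> ('i \<Rightarrow> 'i \<Rightarrow> complex) \<Rightarrow> bool" where
  "hermitian_on Idx c \<longleftrightarrow> (\<forall>I\<in>Idx. \<forall>J\<in>Idx. c J I = cnj (c I J))"

definition eigenvalue_on :: "'i set \<Rightarrow> ('i \<Rightarrow> 'i \<Rightarrow> complex) \<Rightarrow> complex \<Rightarrow> bool" where
  "eigenvalue_on Idx c \<mu> \<longleftrightarrow>
     (\<exists>x. (\<exists>I\<in>Idx. x I \<noteq> 0) \<and> (\<forall>I\<in>Idx. (\<Sum>J\<in>Idx. c I J * x J) = \<mu> * x I))"

definition positive_form :: "nat \<Rightarrow> 'm::finite form \<Rightarrow> bool" where
  "positive_form p \<Omega> \<longleftrightarrow>
     (\<exists>\<phi> c. dual_basis \<phi> \<and>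
        \<Omega> = (\<lambda>vs. sigma p * pq_expansion p p \<phi> c vs) \<and>
        hermitian_on (multi_indices CARD('m) p) c \<and>
        (\<forall>\<mu>. eigenvalue_on (multi_indices CARD('m) p) c \<mu> \<longrightarrow> \<mu> \<in> \<real> \<and> 0 \<le> Re \<mu>))"

definition transverse_form :: "nat \<Rightarrow> 'm::finite form \<Rightarrow> bool" where
  "transverse_form p \<Omega> \<longleftrightarrow>
     real_form \<Omega> \<and> pq_form p p \<Omega> \<and>
     (\<forall>\<psi>. (\<forall>i<CARD('m) - p. covector (\<psi> i)) \<and> lin_indep_family (CARD('m) - p) \<psi> \<longrightarrow>
        strictly_positive_top_form
          (wedge \<Omega> (\<lambda>vs. sigma (CARD('m) - p) *
             wedge (wedge_list (map \<psi> [0..<CARD('m) - p]))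
                   (conj_form (wedge_list (map \<psi> [0..<CARD('m) - p]))) vs)))"


section \<open>Complex manifolds\<close>

text \<open>
  A manifold of dimension \<open>CARD('m)\<close> is given by a topological space with a holomorphic atlas,
  not required to be maximal.
\<close>

type_synonym ('a, 'm) chart = "'a set \<times> ('a \<Rightarrow> complex ^ 'm)"

record ('a, 'm) cmfd =
  cm_top :: "'a topology"
  cm_atlas :: "('a, 'm) chart set"

definition chart_image :: "('a, 'm) chart \<Rightarrow> (complex ^ 'm) set" where
  "chart_image c = snd c ` fst c"

definition transition :: "('a, 'm) chart \<Rightarrow> ('a, 'm) chart \<Rightarrow> complex ^ 'm \<Rightarrow> complex ^ 'm" where
  "transition c c' = snd c' \<circ> inv_into (fst c) (snd c)"

definition transition_dom :: "('a, 'm) chart \<Rightarrow> ('a, 'm) chart \<Rightarrow> (complex ^ 'm) set" where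
  "transition_dom c c' = snd c ` (fst c \<inter> fst c')"

definition holomorphic_map_on ::
    "(complex ^ 'm::finite \<Rightarrow> complex ^ 'n::finite) \<Rightarrow> (complex ^ 'm) set \<Rightarrow> bool" where
  "holomorphic_map_on f S \<longleftrightarrow>
     (\<forall>z\<in>S. \<exists>D. (f has_derivative D) (at z) \<and> Vector_Spaces.linear (*s) (*s) D)"

definition complex_manifold :: "('a, 'm::finite) cmfd \<Rightarrow> bool" where
  "complex_manifold X \<longleftrightarrow>
     Hausdorff_space (cm_top X) \<and> second_countable (cm_top X) \<and>
     (\<Union>c\<in>cm_atlas X. fst c) = topspace (cm_top X) \<and>
     (\<forall>c\<in>cm_atlas X. openin (cm_top X) (fst c) \<and> open (chart_image c) \<and>
        homeomorphic_map (subtopology (cm_top X) (fst c))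
          (top_of_set (chart_image c)) (snd c)) \<and>
     (\<forall>c\<in>cm_atlas X. \<forall>c'\<in>cm_atlas X.
        holomorphic_map_on (transition c c') (transition_dom c c'))"

definition join_vec :: "complex ^ 'm::finite \<Rightarrow> complex ^ 'n::finite \<Rightarrow> complex ^ ('m + 'n)" where
  "join_vec u v = (\<chi> i. case i of Inl a \<Rightarrow> u $ a | Inr b \<Rightarrow> v $ b)"

definition prod_chart ::
    "('a, 'm::finite) chart \<Rightarrow> ('b, 'n::finite) chart \<Rightarrow> ('a \<times> 'b, 'm + 'n) chart" where
  "prod_chart c c' = (fst c \<times> fst c', \<lambda>(x, y). join_vec (snd c x) (snd c' y))"

definition prod_cmfd ::
    "('a, 'm::finite) cmfd \<Rightarrow> ('b, 'n::finite) cmfd \<Rightarrow> ('a \<times> 'b, 'm + 'n) cmfd" where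
  "prod_cmfd X Y =
     \<lparr> cm_top = prod_topology (cm_top X) (cm_top Y),
       cm_atlas = {prod_chart c c' | c c'. c \<in> cm_atlas X \<and> c' \<in> cm_atlas Y} \<rparr>"


section \<open>Smooth forms on complex manifolds\<close>

primrec C_k_on :: "nat \<Rightarrow> ('v::real_normed_vector \<Rightarrow> complex) \<Rightarrow> 'v set \<Rightarrow> bool" where
  "C_k_on 0 f S \<longleftrightarrow> continuous_on S f"
| "C_k_on (Suc k) f S \<longleftrightarrow>
     (\<forall>x\<in>S. f differentiable (at x)) \<and>
     (\<forall>v. C_k_on k (\<lambda>x. frechet_derivative f (at x) v) S)"

definition C_infinity_on :: "('v::real_normed_vector \<Rightarrow> complex) \<Rightarrow> 'v set \<Rightarrow> bool" where
  "C_infinity_on f S \<longleftrightarrow> (\<forall>k. C_k_on k f S)"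

text \<open>
  A form on a manifold is the family of its expressions in the charts of the atlas; these agree
  on overlaps through pullback along the transition maps. The values outside the image of a chart
  are irrelevant.
\<close>

type_synonym ('a, 'm) mform = "('a, 'm) chart \<Rightarrow> complex ^ 'm \<Rightarrow> 'm form"

definition everywhere ::
    "('a, 'm::finite) cmfd \<Rightarrow> ('m form \<Rightarrow> bool) \<Rightarrow> ('a, 'm) mform \<Rightarrow> bool" where
  "everywhere X P \<omega> \<longleftrightarrow> (\<forall>c\<in>cm_atlas X. \<forall>z\<in>chart_image c. P (\<omega> c z))"

definition smooth_form :: "('a, 'm::finite) cmfd \<Rightarrow> nat \<Rightarrow> ('a, 'm) mform \<Rightarrow> bool" where
  "smooth_form X k \<omega> \<longleftrightarrow>
     everywhere X (alternating_form k) \<omega> \<and>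
     (\<forall>c\<in>cm_atlas X. \<forall>vs. C_infinity_on (\<lambda>z. \<omega> c z vs) (chart_image c)) \<and>
     (\<forall>c\<in>cm_atlas X. \<forall>c'\<in>cm_atlas X. \<forall>z\<in>transition_dom c c'. \<forall>vs.
        \<omega> c z vs = \<omega> c' (transition c c' z)
          (map (frechet_derivative (transition c c') (at z)) vs))"

text \<open>
  In a chart, \<open>(d\<omega>)(v\<^sub>0, \<dots>, v\<^sub>k)\<close> is the alternating sum of the derivatives in direction
  \<open>v\<^sub>i\<close> of \<open>\<omega>\<close> evaluated at the remaining vectors. Replacing the real differential of the
  coefficients by its complex-linear part \<open>\<Sum> (\<partial>f / \<partial>z\<^sub>j) dz\<^sub>j\<close>, respectively its
  conjugate-linear part, gives \<open>\<partial>\<close> and \<open>\<partial>bar\<close>: this is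
  \<open>\<partial>\<omega> = \<Sum> (\<partial>\<omega>\<^sub>I\<^sub>J / \<partial>z\<^sub>j) dz\<^sub>j \<and> dz\<^sub>I \<and> d(conj z)\<^sub>J\<close>, and similarly for \<open>\<partial>bar\<close>.
\<close>

definition omit :: "nat \<Rightarrow> 'v list \<Rightarrow> 'v list" where
  "omit i vs = take i vs @ drop (Suc i) vs"

definition D_full :: "(complex ^ 'm::finite \<Rightarrow> complex) \<Rightarrow> complex ^ 'm \<Rightarrow> complex ^ 'm \<Rightarrow> complex" where
  "D_full f z v = frechet_derivative f (at z) v"

definition D_hol :: "(complex ^ 'm::finite \<Rightarrow> complex) \<Rightarrow> complex ^ 'm \<Rightarrow> complex ^ 'm \<Rightarrow> complex" where
  "D_hol f z v = (D_full f z v - \<i> * D_full f z (\<i> *s v)) / 2"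

definition D_antihol :: "(complex ^ 'm::finite \<Rightarrow> complex) \<Rightarrow> complex ^ 'm \<Rightarrow> complex ^ 'm \<Rightarrow> complex" where
  "D_antihol f z v = (D_full f z v + \<i> * D_full f z (\<i> *s v)) / 2"

definition ext_derivative ::
    "((complex ^ 'm::finite \<Rightarrow> complex) \<Rightarrow> complex ^ 'm \<Rightarrow> complex ^ 'm \<Rightarrow> complex) \<Rightarrow>
     ('a, 'm) mform \<Rightarrow> ('a, 'm) mform" where
  "ext_derivative D \<omega> = (\<lambda>c z vs.
     \<Sum>i<length vs. (-1) ^ i * D (\<lambda>y. \<omega> c y (omit i vs)) z (vs ! i))"

definition ext_d :: "('a, 'm::finite) mform \<Rightarrow> ('a, 'm) mform" where
  "ext_d = ext_derivative D_full"

definition del :: "('a, 'm::finite) mform \<Rightarrow> ('a, 'm) mform" where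
  "del = ext_derivative D_hol"

definition delbar :: "('a, 'm::finite) mform \<Rightarrow> ('a, 'm) mform" where
  "delbar = ext_derivative D_antihol"

lemma ext_d_eq: "ext_d \<omega> c z vs = del \<omega> c z vs + delbar \<omega> c z vs"
  by (simp add: ext_d_def del_def delbar_def ext_derivative_def D_hol_def D_antihol_def
      sum.distrib [symmetric] distrib_left [symmetric] add_divide_distrib [symmetric])

definition form_eq :: "('a, 'm::finite) cmfd \<Rightarrow> ('a, 'm) mform \<Rightarrow> ('a, 'm) mform \<Rightarrow> bool" where
  "form_eq X \<omega> \<eta> \<longleftrightarrow> (\<forall>c\<in>cm_atlas X. \<forall>z\<in>chart_image c. \<omega> c z = \<eta> c z)"

definition zero_mform :: "('a, 'm::finite) mform" where
  "zero_mform = (\<lambda>c z vs. 0)"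


section \<open>Generalized p-Kaehler manifolds\<close>

datatype kahler_type = Type_K | Type_WK | Type_S | Type_PL

definition transverse_smooth_form ::
    "('a, 'm::finite) cmfd \<Rightarrow> nat \<Rightarrow> ('a, 'm) mform \<Rightarrow> bool" where
  "transverse_smooth_form X p \<Omega> \<longleftrightarrow>
     smooth_form X (2 * p) \<Omega> \<and> everywhere X (transverse_form p) \<Omega>"

text \<open>
  In type WK only the \<open>(p, p - 1)\<close> part of \<open>\<alpha>\<close> contributes to an identity with
  \<open>\<partial>\<Omega>\<close>, so \<open>\<alpha>\<close> is taken to be any complex form of degree \<open>2p - 1\<close>.
\<close>

fun kahler_condition ::
    "kahler_type \<Rightarrow> ('a, 'm::finite) cmfd \<Rightarrow> nat \<Rightarrow> ('a, 'm) mform \<Rightarrow> bool" where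
  "kahler_condition Type_K X p \<Omega> \<longleftrightarrow> form_eq X (ext_d \<Omega>) zero_mform"
| "kahler_condition Type_WK X p \<Omega> \<longleftrightarrow>
     (\<exists>\<alpha>. smooth_form X (2 * p - 1) \<alpha> \<and> form_eq X (del \<Omega>) (del (delbar \<alpha>)))"
| "kahler_condition Type_S X p \<Omega> \<longleftrightarrow>
     (\<exists>\<Psi>. smooth_form X (2 * p) \<Psi> \<and> everywhere X real_form \<Psi> \<and>
          form_eq X (ext_d \<Psi>) zero_mform \<and>
          (\<forall>c\<in>cm_atlas X. \<forall>z\<in>chart_image c. is_pq_component p p (\<Psi> c z) (\<Omega> c z)))"
| "kahler_condition Type_PL X p \<Omega> \<longleftrightarrow> form_eq X (del (delbar \<Omega>)) zero_mform"

definition kahler_form ::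
    "kahler_type \<Rightarrow> ('a, 'm::finite) cmfd \<Rightarrow> nat \<Rightarrow> ('a, 'm) mform \<Rightarrow> bool" where
  "kahler_form T X p \<Omega> \<longleftrightarrow> transverse_smooth_form X p \<Omega> \<and> kahler_condition T X p \<Omega>"

definition generalized_kahler :: "kahler_type \<Rightarrow> ('a, 'm::finite) cmfd \<Rightarrow> nat \<Rightarrow> bool" where
  "generalized_kahler T X p \<longleftrightarrow>
     complex_manifold X \<and> 1 \<le> p \<and> p \<le> CARD('m) - 1 \<and> (\<exists>\<Omega>. kahler_form T X p \<Omega>)"

end

theory Submission
  imports Defs
begin

text \<open>
  Put \<open>\<Omega>\<^sub>m\<close> and \<open>\<Phi>\<^sub>n\<close> for volume forms and, for \<open>s = m + n - l\<close>, take
  \<open>\<Theta> = \<Sum>\<^sub>b \<Omega>\<^bsub>m-b\<^esub> \<and> \<Phi>\<^bsub>n-l+b\<^esub>\<close>, the sum running over \<open>b = 0, \<dots>, l\<close>. Products and sums of positive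
  forms are positive, so all summands are non-negative on every complex \<open>s\<close>-plane \<open>V\<close>; the one
  for which \<open>n - l + b\<close> is the dimension of the vertical part of \<open>V\<close> is strictly positive there.
  In each summand one factor is closed: it is a volume form, or it is real and killed by \<open>\<partial>\<close>,
  hence also by the conjugate operator. Exterior multiplication by a closed form of even degree
  commutes with \<open>\<partial>\<close> and its conjugate, so the condition of type \<open>T\<close> passes from the other factor
  to the product.

  A volume form is obtained from \<open>\<Omega>\<^bsub>m-1\<^esub>\<close> alone: if \<open>H\<close> is the matrix of the Hermitian form
  on covectors that \<open>\<Omega>\<^bsub>m-1\<^esub>\<close> induces in a chart, then \<open>\<bar>det H\<bar>\<^bsup>1/(m-1)\<^esup> dv\<close> does not depend on
  the chart.
\<close>

section \<open>Exterior products by contraction\<close>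

text \<open>The definitions quantify over bases and sum over shuffles, whereas pullbacks and
  products are natural without either. Three basis-free descriptions carry the proof: bidegree as an
  eigenvalue of \<open>rot_deriv\<close>, positivity as a sum of squares (\<open>pos_sum\<close>),
  and transversality as a positive value on the real list v, \<i> v, ... (\<open>jlist\<close>) of
  some basis of each complex plane. Positivity of the given forms is what makes the products usable:
  exterior products of weakly positive forms need not be weakly positive, while a product of two
  squares is again a square, the constants \<open>sigma\<close> absorbing the sign. The volume forms
  cannot be left out of the sum. The end terms b = 0 and b = l are the strictly positive ones on
  planes that project onto the whole first factor, respectively contain the whole vertical space.
  They must be global forms; a density canonically attached to a form of codimension one needs no
  gluing, and it is closed because its degree is maximal.\<close>

definition ins :: "complex ^ 'm \<Rightarrow> 'm::finite form \<Rightarrow> 'm form" where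
  "ins v \<omega> = (\<lambda>vs. \<omega> (v # vs))"

definition twist :: "'m::finite form \<Rightarrow> 'm form" where
  "twist \<omega> = (\<lambda>vs. (-1) ^ length vs * \<omega> vs)"

lemma wedge_Nil [simp]: "wedge \<alpha> \<beta> [] = \<alpha> [] * \<beta> []"
  by (simp add: wedge_def)

text \<open>
  Contraction is an antiderivation. As \<open>twist\<close> carries the sign, no homogeneity is needed, and
  identities for \<open>wedge\<close> follow by induction on the list of vectors.
\<close>

lemma wedge_Cons:
  "wedge \<alpha> \<beta> (v # vs) = wedge (ins v \<alpha>) \<beta> vs + wedge (twist \<alpha>) (ins v \<beta>) vs"
proof -
  define n where "n = length vs"
  define inv where "inv n S = {(i, j). i \<in> S \<and> j \<in> {..<n} - S \<and> j < i}" for n :: nat and S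
  define F where "F S = (-1) ^ card (inv (Suc n) S) * \<alpha> (nths (v # vs) S) * \<beta> (nths (v # vs) (- S))" for S
  \<comment> \<open>A set of positions either contains 0, so that \<open>v\<close> goes to
    \<open>\<alpha>\<close>, or omits it, so that \<open>v\<close> goes to \<open>\<beta>\<close>.
    Both kinds are shifted copies of the subsets for \<open>vs\<close>.\<close>
  have split: "Pow {..<Suc n} = (\<lambda>S. insert 0 (Suc ` S)) ` Pow {..<n} \<union> image Suc ` Pow {..<n}" (is "?A = ?B")
  proof
    show "?B \<subseteq> ?A" by auto
    show "?A \<subseteq> ?B"
    proof
      fix S assume S: "S \<in> ?A"
      define S' where "S' = {i. Suc i \<in> S}"
      have S': "S' \<in> Pow {..<n}" using S by (auto simp: S'_def)
      show "S \<in> ?B"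
      proof (cases "0 \<in> S")
        case True
        have "S = insert 0 (Suc ` S')"
        proof (rule set_eqI)
          fix i show "i \<in> S \<longleftrightarrow> i \<in> insert 0 (Suc ` S')"
            using True by (cases i) (auto simp: S'_def)
        qed
        then show ?thesis using S' by blast
      next
        case False
        have "S = Suc ` S'"
        proof (rule set_eqI)
          fix i show "i \<in> S \<longleftrightarrow> i \<in> Suc ` S'"
            using False by (cases i) (auto simp: S'_def)
        qed
        then show ?thesis using S' by blast
      qed
    qed
  qed
  have inj1: "inj_on (\<lambda>S. insert 0 (Suc ` S)) (Pow {..<n})"
  proof (rule inj_onI)
    fix S T assume "insert 0 (Suc ` S) = insert 0 (Suc ` T)"
    then have "Suc ` S = Suc ` T" by (metis Diff_insert_absorb imageE nat.distinct(1))
    then show "S = T" by (simp add: inj_image_eq_iff)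
  qed
  have inj2: "inj_on (image Suc) (Pow {..<n})"
    by (rule inj_onI) (simp add: inj_image_eq_iff)
  have fin: "finite (inv n S)" if "S \<subseteq> {..<n}" for S
    by (rule finite_subset[of _ "{..<n} \<times> {..<n}"]) (use that in \<open>auto simp: inv_def\<close>)
  have c1: "F (insert 0 (Suc ` S)) =
      (-1) ^ card (inv n S) * ins v \<alpha> (nths vs S) * \<beta> (nths vs (- S))" if S: "S \<subseteq> {..<n}" for S
  proof -
    have "inv (Suc n) (insert 0 (Suc ` S)) = map_prod Suc Suc ` inv n S"
    proof (rule set_eqI)
      fix x :: "nat \<times> nat"
      obtain i j where [simp]: "x = (i, j)" by fastforce
      show "x \<in> inv (Suc n) (insert 0 (Suc ` S)) \<longleftrightarrow> x \<in> map_prod Suc Suc ` inv n S"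
        using S by (cases i; cases j) (auto simp: inv_def)
    qed
    then have "card (inv (Suc n) (insert 0 (Suc ` S))) = card (inv n S)"
      by (simp add: card_image inj_on_def map_prod_def split_beta prod_eq_iff)
    moreover have "{j. Suc j \<in> insert 0 (Suc ` S)} = S" "{j. Suc j \<in> - insert 0 (Suc ` S)} = - S"
      by auto
    ultimately show ?thesis
      unfolding F_def nths_Cons ins_def by simp
  qed
  \<comment> \<open>Handing \<open>v\<close> to the second factor creates one inversion with each
    position in \<open>S\<close>. The sign depends only on the number of arguments of
    \<open>\<alpha>\<close>, so \<open>twist\<close> absorbs it.\<close>
  have c2: "F (Suc ` S) =
      (-1) ^ card (inv n S) * twist \<alpha> (nths vs S) * ins v \<beta> (nths vs (- S))" if S: "S \<subseteq> {..<n}" for S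
  proof -
    have "inv (Suc n) (Suc ` S) = map_prod Suc Suc ` inv n S \<union> (\<lambda>i. (Suc i, 0)) ` S"
    proof (rule set_eqI)
      fix x :: "nat \<times> nat"
      obtain i j where [simp]: "x = (i, j)" by fastforce
      show "x \<in> inv (Suc n) (Suc ` S) \<longleftrightarrow> x \<in> map_prod Suc Suc ` inv n S \<union> (\<lambda>i. (Suc i, 0)) ` S"
        using S by (cases i; cases j) (auto simp: inv_def)
    qed
    moreover have "card (map_prod Suc Suc ` inv n S \<union> (\<lambda>i. (Suc i, 0)) ` S) =
       card (map_prod Suc Suc ` inv n S) + card ((\<lambda>i. (Suc i, 0::nat)) ` S)"
      by (rule card_Un_disjoint) (use fin[OF S] S finite_subset in auto)
    moreover have "card (map_prod Suc Suc ` inv n S) = card (inv n S)"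
      by (simp add: card_image inj_on_def map_prod_def split_beta prod_eq_iff)
    moreover have "card ((\<lambda>i. (Suc i, 0::nat)) ` S) = card S"
      by (simp add: card_image inj_on_def)
    moreover have "length (nths vs S) = card S"
    proof -
      have "{i. i < length vs \<and> i \<in> S} = S" using S by (auto simp: n_def)
      then show ?thesis by (simp add: length_nths)
    qed
    moreover have "{j. Suc j \<in> Suc ` S} = S" "{j. Suc j \<in> - (Suc ` S)} = - S"
      by auto
    ultimately show ?thesis
      unfolding F_def nths_Cons ins_def twist_def by (simp add: power_add)
  qed
  have "wedge \<alpha> \<beta> (v # vs) = (\<Sum>S\<in>Pow {..<Suc n}. F S)"
    by (simp add: wedge_def F_def n_def inv_def)
  also have "\<dots> = (\<Sum>S\<in>(\<lambda>S. insert 0 (Suc ` S)) ` Pow {..<n}. F S) + (\<Sum>S\<in>image Suc ` Pow {..<n}. F S)"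
    unfolding split by (rule sum.union_disjoint) auto
  also have "\<dots> = (\<Sum>S\<in>Pow {..<n}. F (insert 0 (Suc ` S))) + (\<Sum>S\<in>Pow {..<n}. F (Suc ` S))"
    by (simp add: sum.reindex inj1 inj2)
  also have "(\<Sum>S\<in>Pow {..<n}. F (insert 0 (Suc ` S))) = wedge (ins v \<alpha>) \<beta> vs"
    unfolding wedge_def n_def[symmetric] inv_def[symmetric] by (rule sum.cong) (auto simp: c1)
  also have "(\<Sum>S\<in>Pow {..<n}. F (Suc ` S)) = wedge (twist \<alpha>) (ins v \<beta>) vs"
    unfolding wedge_def n_def[symmetric] inv_def[symmetric] by (rule sum.cong) (auto simp: c2)
  finally show ?thesis .
qed

lemma ins_app: "ins v \<omega> vs = \<omega> (v # vs)"
  by (simp add: ins_def)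

lemma ins_wedge:
  "ins v (wedge \<alpha> \<beta>) = (\<lambda>vs. wedge (ins v \<alpha>) \<beta> vs + wedge (twist \<alpha>) (ins v \<beta>) vs)"
  by (rule ext) (simp add: ins_def[of v "wedge \<alpha> \<beta>"] wedge_Cons)

lemma wedge_add_left: "wedge (\<lambda>vs. a vs + b vs) \<beta> vs = wedge a \<beta> vs + wedge b \<beta> vs"
  by (simp add: wedge_def algebra_simps sum.distrib)

lemma wedge_add_right: "wedge \<alpha> (\<lambda>vs. a vs + b vs) vs = wedge \<alpha> a vs + wedge \<alpha> b vs"
  by (simp add: wedge_def algebra_simps sum.distrib)

lemma wedge_scale_left: "wedge (\<lambda>vs. c * a vs) \<beta> vs = c * wedge a \<beta> vs"
  by (simp add: wedge_def algebra_simps sum_distrib_left)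

lemma wedge_scale_right: "wedge \<alpha> (\<lambda>vs. c * b vs) vs = c * wedge \<alpha> b vs"
  by (simp add: wedge_def algebra_simps sum_distrib_left)

lemma wedge_minus_left: "wedge (\<lambda>vs. - a vs) \<beta> vs = - wedge a \<beta> vs"
  by (simp add: wedge_def sum_negf)

lemma wedge_minus_right: "wedge \<alpha> (\<lambda>vs. - b vs) vs = - wedge \<alpha> b vs"
  by (simp add: wedge_def sum_negf)

lemma wedge_zero_left [simp]: "wedge (\<lambda>vs. 0) \<beta> = (\<lambda>vs. 0)"
  by (rule ext) (simp add: wedge_def)

lemma wedge_zero_right [simp]: "wedge \<alpha> (\<lambda>vs. 0) = (\<lambda>vs. 0)"
  by (rule ext) (simp add: wedge_def)

lemma wedge_sum_left: "wedge (\<lambda>vs. \<Sum>i\<in>A. f i vs) \<beta> vs = (\<Sum>i\<in>A. wedge (f i) \<beta> vs)"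
  by (induction A rule: infinite_finite_induct) (simp_all add: wedge_add_left)

lemma wedge_sum_right: "wedge \<alpha> (\<lambda>vs. \<Sum>i\<in>A. f i vs) vs = (\<Sum>i\<in>A. wedge \<alpha> (f i) vs)"
  by (induction A rule: infinite_finite_induct) (simp_all add: wedge_add_right)

lemma twist_twist [simp]: "twist (twist \<omega>) = \<omega>"
  by (rule ext) (simp add: twist_def flip: mult.assoc power_add)

lemma ins_twist: "ins v (twist \<omega>) = (\<lambda>vs. - twist (ins v \<omega>) vs)"
  by (rule ext) (simp add: twist_def ins_def)

lemma twist_zero [simp]: "twist (\<lambda>vs. 0) = (\<lambda>vs. 0)"
  by (simp add: twist_def)

lemma twist_wedge_app: "twist (wedge \<alpha> \<beta>) vs = wedge (twist \<alpha>) (twist \<beta>) vs"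
proof (induction vs arbitrary: \<alpha> \<beta>)
  case Nil
  then show ?case by (simp add: twist_def)
next
  case (Cons v vs)
  have "twist (wedge \<alpha> \<beta>) (v # vs) =
      - (twist (wedge (ins v \<alpha>) \<beta>) vs + twist (wedge (twist \<alpha>) (ins v \<beta>)) vs)"
    by (simp add: twist_def[of "wedge _ _"] wedge_Cons algebra_simps)
  also have "\<dots> = wedge (twist \<alpha>) (twist \<beta>) (v # vs)"
    by (simp add: Cons.IH wedge_Cons ins_twist wedge_minus_left wedge_minus_right)
  finally show ?case .
qed

lemma twist_wedge: "twist (wedge \<alpha> \<beta>) = wedge (twist \<alpha>) (twist \<beta>)"
  by (rule ext) (rule twist_wedge_app)

text \<open>Contracting either side gives the same three terms, one per factor, because
  \<open>twist\<close> is multiplicative; no degrees enter.\<close>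

lemma wedge_assoc_app: "wedge (wedge \<alpha> \<beta>) \<gamma> vs = wedge \<alpha> (wedge \<beta> \<gamma>) vs"
proof (induction vs arbitrary: \<alpha> \<beta> \<gamma>)
  case Nil
  then show ?case by simp
next
  case (Cons v vs)
  then show ?case
    by (simp add: wedge_Cons ins_wedge twist_wedge wedge_add_left wedge_add_right)
qed

lemma wedge_assoc: "wedge (wedge \<alpha> \<beta>) \<gamma> = wedge \<alpha> (wedge \<beta> \<gamma>)"
  by (rule ext) (rule wedge_assoc_app)

definition homog :: "nat \<Rightarrow> 'm::finite form \<Rightarrow> bool" where
  "homog k \<omega> \<longleftrightarrow> (\<forall>vs. length vs \<noteq> k \<longrightarrow> \<omega> vs = 0)"

lemma homog_ins: "homog k \<omega> \<Longrightarrow> homog (k - 1) (ins v \<omega>)"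
  by (auto simp: homog_def ins_def)

lemma homog_0_ins: "homog 0 \<omega> \<Longrightarrow> ins v \<omega> = (\<lambda>vs. 0)"
  by (auto simp: homog_def ins_def)

lemma homog_twist: "homog k \<omega> \<Longrightarrow> twist \<omega> = (\<lambda>vs. (-1) ^ k * \<omega> vs)"
  by (rule ext) (auto simp: homog_def twist_def)

lemma wedge_commute:
  assumes "homog k \<alpha>" "homog l \<beta>"
  shows "wedge \<alpha> \<beta> vs = (-1) ^ (k * l) * wedge \<beta> \<alpha> vs"
  using assms
proof (induction vs arbitrary: k l \<alpha> \<beta>)
  case Nil
  then show ?case by (cases "k = 0"; cases "l = 0") (auto simp: homog_def)
next
  case (Cons v vs)
  have tw: "twist \<alpha> = (\<lambda>vs. (-1) ^ k * \<alpha> vs)" "twist \<beta> = (\<lambda>vs. (-1) ^ l * \<beta> vs)"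
    using Cons.prems by (auto intro: homog_twist)
  have 1: "wedge (ins v \<alpha>) \<beta> vs = (-1) ^ (k * l) * ((-1) ^ l * wedge \<beta> (ins v \<alpha>) vs)"
  \<comment> \<open>A form of degree 0 has zero contraction, while \<open>k - 1\<close> would stay
    at 0; hence the separate case.\<close>
  proof (cases k)
    case 0
    then show ?thesis using Cons.prems by (simp add: homog_0_ins)
  next
    case (Suc k')
    have "wedge (ins v \<alpha>) \<beta> vs = (-1) ^ ((k - 1) * l) * wedge \<beta> (ins v \<alpha>) vs"
      by (intro Cons.IH homog_ins Cons.prems)
    then show ?thesis by (simp add: Suc power_add)
  qed
  have 2: "(-1) ^ k * wedge \<alpha> (ins v \<beta>) vs = (-1) ^ (k * l) * wedge (ins v \<beta>) \<alpha> vs"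
  proof (cases l)
    case 0
    then show ?thesis using Cons.prems by (simp add: homog_0_ins)
  next
    case (Suc l')
    have "wedge \<alpha> (ins v \<beta>) vs = (-1) ^ (k * (l - 1)) * wedge (ins v \<beta>) \<alpha> vs"
      by (intro Cons.IH homog_ins Cons.prems)
    then show ?thesis by (simp add: Suc power_add)
  qed
  show ?case
    by (simp only: wedge_Cons tw wedge_scale_left 1 2 distrib_left mult.assoc) simp
qed

section \<open>Covectors and the unit in the exterior algebra\<close>

lemma ins_one_form: "ins v (one_form f) = (\<lambda>vs. f v * unit_form vs)"
  by (rule ext) (auto simp: ins_def one_form_def unit_form_def)

lemma ins_unit_form [simp]: "ins v unit_form = (\<lambda>vs. 0)"
  by (rule ext) (auto simp: ins_def unit_form_def)

lemma unit_form_Nil: "unit_form [] = 1"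
  by (simp add: unit_form_def)

lemma homog_one_form: "homog 1 (one_form f)"
  by (auto simp: homog_def one_form_def)

lemma homog_unit_form: "homog 0 unit_form"
  by (auto simp: homog_def unit_form_def)

lemma wedge_unit_left [simp]: "wedge unit_form \<alpha> = \<alpha>"
proof
  fix vs show "wedge unit_form \<alpha> vs = \<alpha> vs"
    by (induction vs arbitrary: \<alpha>)
      (auto simp: wedge_Cons homog_twist[OF homog_unit_form] ins_app unit_form_Nil)
qed

lemma wedge_unit_right [simp]: "wedge \<alpha> unit_form = \<alpha>"
proof
  fix vs show "wedge \<alpha> unit_form vs = \<alpha> vs"
    by (induction vs arbitrary: \<alpha>) (auto simp: wedge_Cons ins_app unit_form_Nil)
qed

lemma wedge_one_form_Cons:
  "wedge (one_form f) \<omega> (v # vs) = f v * \<omega> vs - wedge (one_form f) (ins v \<omega>) vs"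
  by (simp add: wedge_Cons ins_one_form wedge_scale_left homog_twist[OF homog_one_form] wedge_minus_left)

lemma conj_form_wedge: "conj_form (wedge \<alpha> \<beta>) = wedge (conj_form \<alpha>) (conj_form \<beta>)"
  by (rule ext) (simp add: conj_form_def wedge_def)

lemma wedge_map: "wedge \<alpha> \<beta> (map L vs) = wedge (\<lambda>ws. \<alpha> (map L ws)) (\<lambda>ws. \<beta> (map L ws)) vs"
  by (simp add: wedge_def nths_map)

lemma homog_wedge:
  assumes "homog k \<alpha>" "homog l \<beta>" shows "homog (k + l) (wedge \<alpha> \<beta>)"
proof -
  have "length vs \<noteq> k + l \<Longrightarrow> wedge \<alpha> \<beta> vs = 0" for vs
    using assms
  proof (induction vs arbitrary: k l \<alpha> \<beta>)
    case Nil
    then show ?case by (cases "k = 0"; cases "l = 0") (auto simp: homog_def)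
  next
    case (Cons v vs)
    have "wedge (ins v \<alpha>) \<beta> vs = 0"
    proof (cases k)
      case 0
      then show ?thesis using Cons.prems by (simp add: homog_0_ins)
    next
      case (Suc k')
      show ?thesis
        by (rule Cons.IH[of "k - 1" l]) (use Cons.prems Suc homog_ins[of k \<alpha> v] in auto)
    qed
    moreover have "wedge \<alpha> (ins v \<beta>) vs = 0"
    proof (cases l)
      case 0
      then show ?thesis using Cons.prems by (simp add: homog_0_ins)
    next
      case (Suc k')
      show ?thesis
        by (rule Cons.IH[of k "l - 1"]) (use Cons.prems Suc homog_ins[of l \<beta> v] in auto)
    qed
    ultimately show ?case
      using Cons.prems by (simp add: wedge_Cons homog_twist wedge_scale_left)
  qed
  then show ?thesis by (simp add: homog_def)
qed


section \<open>Alternating forms and bidegree\<close>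

text \<open>\<open>alternating_form\<close> rewritten by recursion on the first vector, so that
  inductions run in step with \<open>wedge_Cons\<close>. Only a repetition in the first two places
  is forbidden; \<open>alternating_iff\<close> shows that nothing is lost.\<close>

primrec alt :: "nat \<Rightarrow> 'm::finite form \<Rightarrow> bool" where
  "alt 0 \<omega> \<longleftrightarrow> (\<forall>v vs. \<omega> (v # vs) = 0)"
| "alt (Suc k) \<omega> \<longleftrightarrow> \<omega> [] = 0 \<and> (\<forall>v. alt k (ins v \<omega>)) \<and>
     (\<forall>vs. linear (\<lambda>v. \<omega> (v # vs))) \<and> (\<forall>v vs. \<omega> (v # v # vs) = 0)"

lemma alt_homog: "alt k \<omega> \<Longrightarrow> homog k \<omega>"
proof (induction k arbitrary: \<omega>)
  case 0
  then show ?case by (auto simp: homog_def neq_Nil_conv)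
next
  case (Suc k)
  have "\<omega> vs = 0" if "length vs \<noteq> Suc k" for vs
  proof (cases vs)
    case Nil
    then show ?thesis using Suc.prems by simp
  next
    case (Cons v ws)
    have "homog k (ins v \<omega>)" using Suc by simp
    then show ?thesis using that Cons by (auto simp: homog_def ins_def)
  qed
  then show ?case by (simp add: homog_def)
qed

lemma alt_zero [simp]: "alt k (\<lambda>vs. 0)"
  by (induction k) (simp_all add: ins_def linear_zero)

lemma alt_add:
  assumes "alt k \<alpha>" "alt k \<beta>" shows "alt k (\<lambda>vs. \<alpha> vs + \<beta> vs)"
  using assms
  by (induction k arbitrary: \<alpha> \<beta>) (simp_all add: ins_def linear_compose_add)

lemma linear_cmult: "linear (f :: 'a::real_vector \<Rightarrow> complex) \<Longrightarrow> linear (\<lambda>v. c * f v)"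
  by (simp add: linear_iff algebra_simps)

lemma alt_scale:
  assumes "alt k \<alpha>" shows "alt k (\<lambda>vs. c * \<alpha> vs)"
  using assms
  by (induction k arbitrary: \<alpha>) (simp_all add: ins_def linear_cmult)

lemma alt_sum:
  "(\<And>i. i \<in> A \<Longrightarrow> alt k (f i)) \<Longrightarrow> alt k (\<lambda>vs. \<Sum>i\<in>A. f i vs)"
  by (induction A rule: infinite_finite_induct) (simp_all add: alt_add)

lemma alt_linear_head: "alt k \<omega> \<Longrightarrow> linear (\<lambda>v. \<omega> (v # vs))"
  by (cases k) (simp_all add: linear_zero)

lemma alt_ins: "alt k \<omega> \<Longrightarrow> alt (k - 1) (ins v \<omega>)"
  by (cases k) (simp_all add: ins_def)

lemma alt_0_ins: "alt 0 \<omega> \<Longrightarrow> ins v \<omega> = (\<lambda>vs. 0)"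
  by (simp add: ins_def)

lemma alt_repeat: "alt k \<omega> \<Longrightarrow> \<omega> (v # v # vs) = 0"
  by (cases k) simp_all

lemma alt_swap:
  assumes "alt k \<omega>" shows "\<omega> (a # b # vs) = - \<omega> (b # a # vs)"
proof -
  have l2: "linear (\<lambda>v. \<omega> (x # v # vs))" for x
    using alt_linear_head[OF alt_ins[OF assms], of x vs] by (simp add: ins_def)
  have l1: "linear (\<lambda>v. \<omega> (v # x # vs))" for x
    using alt_linear_head[OF assms] .
  have "0 = \<omega> ((a + b) # (a + b) # vs)" using alt_repeat[OF assms] by simp
  also have "\<dots> = \<omega> (a # (a + b) # vs) + \<omega> (b # (a + b) # vs)"
    using linear_add[OF l1] by simp
  also have "\<dots> = \<omega> (a # b # vs) + \<omega> (b # a # vs)"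
    using linear_add[OF l2] alt_repeat[OF assms] by simp
  finally show ?thesis by (simp add: eq_neg_iff_add_eq_0)
qed

lemma alt_imp_alternating: "alt k \<omega> \<Longrightarrow> alternating_form k \<omega>"
proof (induction k arbitrary: \<omega>)
  case 0
  then show ?case
    using alt_homog[of 0 \<omega>] by (auto simp: alternating_form_def homog_def)
next
  case (Suc k)
  have IH: "alternating_form k (ins v \<omega>)" for v using Suc by simp
  show ?case
    unfolding alternating_form_def
  proof (intro conjI allI impI)
    fix vs :: "(complex ^ 'a) list" assume "length vs \<noteq> Suc k"
    then show "\<omega> vs = 0" using alt_homog[OF Suc.prems] by (simp add: homog_def)
  next
    fix vs :: "(complex ^ 'a) list" and i assume "length vs = Suc k" "i < Suc k"
    then obtain v ws where vs: "vs = v # ws" "length ws = k" by (auto simp: length_Suc_conv)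
    show "linear (\<lambda>v. \<omega> (vs[i := v]))"
    proof (cases i)
      case 0
      then show ?thesis using vs alt_linear_head[OF Suc.prems] by simp
    next
      case (Suc j)
      then show ?thesis using IH[of v] vs \<open>i < Suc k\<close> by (auto simp: alternating_form_def ins_def)
    qed
  next
    fix vs :: "(complex ^ 'a) list" and i j
    assume a: "length vs = Suc k" "i < j" "j < Suc k" "vs ! i = vs ! j"
    then obtain v ws where vs: "vs = v # ws" "length ws = k" by (auto simp: length_Suc_conv)
    show "\<omega> vs = 0"
    proof (cases i)
      case (Suc i')
      then obtain j' where "j = Suc j'" using a by (cases j) auto
      then have "ins v \<omega> ws = 0"
        using IH[of v] a vs Suc unfolding alternating_form_def by auto
      then show ?thesis by (simp add: vs ins_def)
    next
      case 0
      then obtain j' where j: "j = Suc j'" using a by (cases j) auto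
      then have "ws \<noteq> []" using a vs by auto
      then obtain b us where ws: "ws = b # us" by (cases ws) auto
      show ?thesis
      proof (cases j')
        case 0
        then show ?thesis using a vs ws j \<open>i = 0\<close> alt_repeat[OF Suc.prems] by simp
      next
        case (Suc j'')
        \<comment> \<open>The repeated vector is not adjacent to the first one. Swapping the first
          two vectors changes the sign only and moves the repetition inside a contraction, where the
          induction hypothesis applies.\<close>
        have "length (v # us) = k \<longrightarrow> 0 < j' \<longrightarrow> j' < k \<longrightarrow> (v # us) ! 0 = (v # us) ! j' \<longrightarrow> ins b \<omega> (v # us) = 0"
          using IH[of b] unfolding alternating_form_def by blast
        then have "ins b \<omega> (v # us) = 0" using a vs ws j \<open>i = 0\<close> Suc by simp
        then show ?thesis using alt_swap[OF Suc.prems, of v b us] by (simp add: vs ws ins_def)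
      qed
    qed
  qed
qed

lemma alternating_imp_alt: "alternating_form k \<omega> \<Longrightarrow> alt k \<omega>"
proof (induction k arbitrary: \<omega>)
  case 0
  then show ?case by (simp add: alternating_form_def)
next
  case (Suc k)
  note d = Suc.prems[unfolded alternating_form_def]
  have len: "\<omega> vs = 0" if "length vs \<noteq> Suc k" for vs using d that by blast
  have lin: "linear (\<lambda>v. \<omega> (vs[i := v]))" if "length vs = Suc k" "i < Suc k" for vs i using d that by blast
  have rep: "\<omega> vs = 0" if "length vs = Suc k" "i < j" "j < Suc k" "vs ! i = vs ! j" for vs i j using d that by blast
  have "alternating_form k (ins v \<omega>)" for v
    unfolding alternating_form_def
  proof (intro conjI allI impI)
    fix vs :: "(complex ^ 'a) list" assume "length vs \<noteq> k"
    then show "ins v \<omega> vs = 0" by (simp add: ins_def len)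
  next
    fix vs :: "(complex ^ 'a) list" and i assume "length vs = k" "i < k"
    then show "linear (\<lambda>x. ins v \<omega> (vs[i := x]))"
      using lin[of "v # vs" "Suc i"] by (simp add: ins_def)
  next
    fix vs :: "(complex ^ 'a) list" and i j assume "length vs = k" "i < j" "j < k" "vs ! i = vs ! j"
    then show "ins v \<omega> vs = 0"
      using rep[of "v # vs" "Suc i" "Suc j"] by (simp add: ins_def)
  qed
  moreover have "linear (\<lambda>v. \<omega> (v # vs))" for vs
  proof (cases "length vs = k")
    case True
    then show ?thesis using lin[of "0 # vs" 0] by simp
  next
    case False
    then have "(\<lambda>v. \<omega> (v # vs)) = (\<lambda>v. 0)" by (simp add: len)
    then show ?thesis by (simp add: linear_zero)
  qed
  moreover have "\<omega> (v # v # vs) = 0" for v vs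
  proof (cases "Suc (length vs) = k")
    case True
    then show ?thesis using rep[of "v # v # vs" 0 1] by simp
  next
    case False
    then show ?thesis by (simp add: len)
  qed
  ultimately show ?case using Suc.IH by (simp add: len)
qed

lemma alternating_iff: "alternating_form k \<omega> \<longleftrightarrow> alt k \<omega>"
  using alt_imp_alternating alternating_imp_alt by blast

lemma linear_wedge_left:
  "(\<And>ws. linear (\<lambda>v. A v ws)) \<Longrightarrow> linear (\<lambda>v. wedge (A v) \<beta> vs)"
  unfolding linear_iff by (simp add: wedge_def algebra_simps sum.distrib scaleR_sum_right)

lemma linear_wedge_right:
  "(\<And>ws. linear (\<lambda>v. B v ws)) \<Longrightarrow> linear (\<lambda>v. wedge \<alpha> (B v) vs)"
  unfolding linear_iff by (simp add: wedge_def algebra_simps sum.distrib scaleR_sum_right)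

lemma alt_twist: "alt k \<alpha> \<Longrightarrow> alt k (twist \<alpha>)"
  by (simp add: homog_twist[OF alt_homog] alt_scale)

text \<open>The two mixed terms of the double contraction cancel, since contraction anticommutes
  with \<open>twist\<close>; the pure terms contain a repeated vector.\<close>

lemma ins_wedge_ins:
  assumes "alt k \<alpha>" "alt l \<beta>"
  shows "wedge \<alpha> \<beta> (v # v # vs) = 0"
proof -
  have a: "ins v (ins v \<alpha>) = (\<lambda>vs. 0)" using alt_repeat[OF assms(1)] by (simp add: ins_def)
  have b: "ins v (ins v \<beta>) = (\<lambda>vs. 0)" using alt_repeat[OF assms(2)] by (simp add: ins_def)
  show ?thesis
    by (simp add: wedge_Cons ins_wedge ins_twist a b wedge_minus_left)
qed

lemma alt_wedge:
  assumes "alt k \<alpha>" "alt l \<beta>"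
  shows "alt (k + l) (wedge \<alpha> \<beta>)"
  using assms
proof (induction "k + l" arbitrary: k l \<alpha> \<beta>)
  case 0
  then show ?case
    using homog_wedge[OF alt_homog alt_homog, OF 0(2,3)] by (auto simp: homog_def)
next
  case (Suc N)
  have "alt N (wedge (ins v \<alpha>) \<beta>)" for v
  proof (cases k)
    case 0
    then show ?thesis using Suc.prems by (simp add: alt_0_ins)
  next
    case (Suc k')
    then show ?thesis
      using Suc.hyps(1)[of k' l "ins v \<alpha>" \<beta>] Suc.hyps(2) Suc.prems by simp
  qed
  moreover have "alt N (wedge (twist \<alpha>) (ins v \<beta>))" for v
  proof (cases l)
    case 0
    then show ?thesis using Suc.prems by (simp add: alt_0_ins)
  next
    case (Suc l')
    then show ?thesis
      using Suc.hyps(1)[of k l' "twist \<alpha>" "ins v \<beta>"] Suc.hyps(2) Suc.prems alt_twist[OF Suc.prems(1)] by simp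
  qed
  ultimately have "alt N (ins v (wedge \<alpha> \<beta>))" for v
    unfolding ins_wedge by (intro alt_add) auto
  moreover have "linear (\<lambda>v. wedge \<alpha> \<beta> (v # vs))" for vs
    unfolding wedge_Cons
    by (intro linear_compose_add linear_wedge_left linear_wedge_right)
      (simp_all add: ins_def alt_linear_head[OF Suc.prems(1)] alt_linear_head[OF Suc.prems(2)])
  moreover have "wedge \<alpha> \<beta> [] = 0"
    using homog_wedge[OF alt_homog alt_homog, OF Suc.prems] Suc.hyps(2)
    unfolding homog_def by (metis list.size(3) nat.distinct(1))
  moreover have "wedge \<alpha> \<beta> (v # v # vs) = 0" for v vs
    using ins_wedge_ins[OF Suc.prems] .
  ultimately show ?case unfolding Suc.hyps(2)[symmetric] by simp
qed

lemma alt_conj: "alt k \<omega> \<Longrightarrow> alt k (conj_form \<omega>)"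
proof (induction k arbitrary: \<omega>)
  case 0
  then show ?case by (simp add: conj_form_def)
next
  case (Suc k)
  have "ins v (conj_form \<omega>) = conj_form (ins v \<omega>)" for v
    by (simp add: ins_def conj_form_def)
  moreover have "linear (\<lambda>v. conj_form \<omega> (v # vs))" for vs
    using alt_linear_head[OF Suc.prems, of vs] by (simp add: linear_iff conj_form_def)
  ultimately show ?case using Suc by (simp add: conj_form_def)
qed

lemma alt_pullback:
  assumes "linear L" "alt k \<omega>"
  shows "alt k (\<lambda>vs. \<omega> (map L vs))"
  using assms(2)
proof (induction k arbitrary: \<omega>)
  case 0
  then show ?case by simp
next
  case (Suc k)
  have "linear (\<lambda>v. \<omega> (L v # map L vs))" for vs
    using linear_compose[OF assms(1) alt_linear_head[OF Suc.prems, of "map L vs"]] by (simp add: o_def)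
  moreover have "ins v (\<lambda>vs. \<omega> (map L vs)) = (\<lambda>vs. ins (L v) \<omega> (map L vs))" for v
    by (simp add: ins_def)
  ultimately show ?case using Suc by simp
qed

lemma covector_linear: "covector f \<Longrightarrow> linear f"
proof -
  assume "covector f"
  then interpret Vector_Spaces.linear "(*s)" "(*)" f by (simp add: covector_def)
  have "r *\<^sub>R x = of_real r *s x" for r and x :: "complex^'a"
    by (simp add: vec_eq_iff) (simp add: scaleR_conv_of_real)
  then show ?thesis by (intro linearI) (simp_all add: add scale scaleR_conv_of_real)
qed

lemma alt_one_form: "linear f \<Longrightarrow> alt 1 (one_form f)"
proof -
  assume "linear f"
  then have "linear (\<lambda>v. one_form f (v # vs))" for vs
    by (cases vs) (simp_all add: one_form_def linear_zero)
  then show ?thesis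
    by (simp add: ins_one_form) (simp add: one_form_def unit_form_def)
qed

lemma alt_unit_form: "alt 0 unit_form"
  by (simp add: unit_form_def)


text \<open>
  The derivation induced by multiplication of the vectors by \<open>\<i>\<close>. The \<open>(p, q)\<close>-forms are its
  eigenforms for \<open>\<i> (p - q)\<close>, which describes the bidegree without reference to a basis.
\<close>

primrec rot_deriv :: "(complex ^ 'm) list \<Rightarrow> 'm::finite form \<Rightarrow> complex" where
  "rot_deriv [] \<omega> = 0"
| "rot_deriv (v # vs) \<omega> = \<omega> ((\<i> *s v) # vs) + rot_deriv vs (ins v \<omega>)"

lemma ins_rot_deriv: "ins v (\<lambda>vs. rot_deriv vs \<omega>) = (\<lambda>vs. ins (\<i> *s v) \<omega> vs + rot_deriv vs (ins v \<omega>))"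
  by (simp add: ins_def)

lemma rot_deriv_add: "rot_deriv vs (\<lambda>vs. \<alpha> vs + \<beta> vs) = rot_deriv vs \<alpha> + rot_deriv vs \<beta>"
  by (induction vs arbitrary: \<alpha> \<beta>) (simp_all add: ins_def)

lemma rot_deriv_scale: "rot_deriv vs (\<lambda>vs. c * \<alpha> vs) = c * rot_deriv vs \<alpha>"
  by (induction vs arbitrary: \<alpha>) (simp_all add: ins_def algebra_simps)

lemma rot_deriv_zero [simp]: "rot_deriv vs (\<lambda>vs. 0) = 0"
  by (induction vs) (simp_all add: ins_def)

lemma rot_deriv_sum: "rot_deriv vs (\<lambda>vs. \<Sum>i\<in>A. f i vs) = (\<Sum>i\<in>A. rot_deriv vs (f i))"
  by (induction A rule: infinite_finite_induct) (simp_all add: rot_deriv_add)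

lemma rot_deriv_twist: "rot_deriv vs (twist \<alpha>) = twist (\<lambda>vs. rot_deriv vs \<alpha>) vs"
proof (induction vs arbitrary: \<alpha>)
  case (Cons v vs)
  have "rot_deriv vs (\<lambda>ws. - twist (ins v \<alpha>) ws) = - rot_deriv vs (twist (ins v \<alpha>))"
    using rot_deriv_scale[of vs "-1" "twist (ins v \<alpha>)"] by simp
  then show ?case by (simp add: ins_twist Cons) (simp add: twist_def algebra_simps)
qed (simp add: twist_def)

text \<open>Replacing a vector in its place reorders nothing, so this is a derivation without signs.
  Eigenvalues, and with them bidegrees, therefore add under \<open>wedge\<close>.\<close>

lemma rot_deriv_wedge:
  "rot_deriv vs (wedge \<alpha> \<beta>) = wedge (\<lambda>ws. rot_deriv ws \<alpha>) \<beta> vs + wedge \<alpha> (\<lambda>ws. rot_deriv ws \<beta>) vs"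
proof (induction vs arbitrary: \<alpha> \<beta>)
  case Nil
  then show ?case by simp
next
  case (Cons v vs)
  have t: "twist (\<lambda>ws. rot_deriv ws \<alpha>) = (\<lambda>ws. rot_deriv ws (twist \<alpha>))" by (simp add: rot_deriv_twist)
  show ?case
    by (simp add: wedge_Cons ins_wedge rot_deriv_add Cons.IH ins_rot_deriv wedge_add_left wedge_add_right t)
qed

text \<open>Bidegree (p, q) is degree p + q with \<mu> = p - q (\<open>pq_form_iff\<close>); the
  case (s, s) is \<open>htype (2 * s) 0\<close>. An unrestricted integer \<mu> is deliberate:
  contractions may push it out of range, and then the form is forced to vanish.\<close>

definition htype :: "nat \<Rightarrow> int \<Rightarrow> 'm::finite form \<Rightarrow> bool" where
  "htype k \<mu> \<omega> \<longleftrightarrow> alt k \<omega> \<and> (\<forall>vs. rot_deriv vs \<omega> = \<i> * of_int \<mu> * \<omega> vs)"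

lemma htype_alt: "htype k \<mu> \<omega> \<Longrightarrow> alt k \<omega>"
  by (simp add: htype_def)

lemma htype_zero: "htype k \<mu> (\<lambda>vs. 0)"
  by (simp add: htype_def)

lemma htype_scale: "htype k \<mu> \<alpha> \<Longrightarrow> htype k \<mu> (\<lambda>vs. c * \<alpha> vs)"
  by (simp add: htype_def alt_scale rot_deriv_scale)

lemma htype_sum: "(\<And>i. i \<in> A \<Longrightarrow> htype k \<mu> (f i)) \<Longrightarrow> htype k \<mu> (\<lambda>vs. \<Sum>i\<in>A. f i vs)"
  by (simp add: htype_def alt_sum rot_deriv_sum sum_distrib_left)

lemma htype_wedge:
  assumes "htype k \<mu> \<alpha>" "htype l \<nu> \<beta>" shows "htype (k + l) (\<mu> + \<nu>) (wedge \<alpha> \<beta>)"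
proof -
  have "(\<lambda>ws. rot_deriv ws \<alpha>) = (\<lambda>vs. (\<i> * of_int \<mu>) * \<alpha> vs)" "(\<lambda>ws. rot_deriv ws \<beta>) = (\<lambda>vs. (\<i> * of_int \<nu>) * \<beta> vs)"
    using assms by (auto simp: htype_def)
  then show ?thesis
    using assms by (simp add: htype_def alt_wedge rot_deriv_wedge wedge_scale_left wedge_scale_right algebra_simps)
qed

lemma rot_deriv_conj: "rot_deriv vs (conj_form \<omega>) = cnj (rot_deriv vs \<omega>)"
proof (induction vs arbitrary: \<omega>)
  case (Cons v vs)
  have "ins v (conj_form \<omega>) = conj_form (ins v \<omega>)"
    by (simp add: ins_def conj_form_def)
  then show ?case using Cons by simp (simp add: conj_form_def)
qed simp

lemma htype_conj: "htype k \<mu> \<omega> \<Longrightarrow> htype k (- \<mu>) (conj_form \<omega>)"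
  by (simp add: htype_def alt_conj rot_deriv_conj) (simp add: conj_form_def)

lemma rot_deriv_map:
  assumes "\<And>v. L (\<i> *s v) = \<i> *s L v"
  shows "rot_deriv vs (\<lambda>vs. \<omega> (map L vs)) = rot_deriv (map L vs) \<omega>"
  by (induction vs arbitrary: \<omega>) (simp_all add: ins_def assms)

lemma htype_pullback:
  assumes "linear L" "\<And>v. L (\<i> *s v) = \<i> *s L v" "htype k \<mu> \<omega>"
  shows "htype k \<mu> (\<lambda>vs. \<omega> (map L vs))"
  using assms by (simp add: htype_def alt_pullback rot_deriv_map)

lemma covector_scale: "covector f \<Longrightarrow> f (c *s v) = c * f v"
proof -
  assume "covector f"
  then interpret Vector_Spaces.linear "(*s)" "(*)" f by (simp add: covector_def)
  show ?thesis by (rule scale)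
qed

lemma covector_add: "covector f \<Longrightarrow> f (u + v) = f u + f v"
proof -
  assume "covector f"
  then interpret Vector_Spaces.linear "(*s)" "(*)" f by (simp add: covector_def)
  show ?thesis by (rule add)
qed

lemma htype_one_form: "covector f \<Longrightarrow> htype 1 1 (one_form f)"
proof -
  assume f: "covector f"
  have "rot_deriv vs (one_form f) = \<i> * one_form f vs" for vs
  proof (cases vs)
    case (Cons v ws)
    then show ?thesis
      by (cases ws) (auto simp: ins_one_form covector_scale[OF f] rot_deriv_scale unit_form_def one_form_def ins_def)
  qed (simp add: one_form_def)
  then show ?thesis
    using f by (simp add: htype_def alt_one_form[unfolded One_nat_def] covector_linear del: alt.simps)
qed

lemma htype_unit_form: "htype 0 0 unit_form"
proof -
  have "rot_deriv vs unit_form = 0" for vs :: "(complex^'a) list"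
    by (induction vs) (simp_all, simp add: unit_form_def)
  then show ?thesis by (simp add: htype_def alt_unit_form del: alt.simps)
qed

lemma wedge_list_Nil [simp]: "wedge_list [] = unit_form"
  by (simp add: wedge_list_def)

lemma wedge_list_Cons [simp]: "wedge_list (f # fs) = wedge (one_form f) (wedge_list fs)"
  by (simp add: wedge_list_def)

lemma htype_wedge_list: "(\<And>f. f \<in> set fs \<Longrightarrow> covector f) \<Longrightarrow> htype (length fs) (int (length fs)) (wedge_list fs)"
proof (induction fs)
  case Nil
  then show ?case by (simp add: htype_unit_form)
next
  case (Cons f fs)
  have "htype (1 + length fs) (1 + int (length fs)) (wedge (one_form f) (wedge_list fs))"
    using Cons by (intro htype_wedge htype_one_form) auto
  then show ?case by simp
qed


section \<open>Frames\<close>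

lemma covector_iff:
  "covector f \<longleftrightarrow> (\<forall>u v. f (u + v) = f u + f v) \<and> (\<forall>c v. f (c *s v) = c * f v)"
  unfolding covector_def Vector_Spaces.linear_iff
  using vec.vector_space_axioms vector_space_over_itself.vector_space_axioms by blast

lemma covector_zero: "covector f \<Longrightarrow> f 0 = 0"
  using covector_scale[of f 0 0] by simp

lemma covector_sum: "covector f \<Longrightarrow> f (\<Sum>i\<in>A. g i) = (\<Sum>i\<in>A. f (g i))"
  by (induction A rule: infinite_finite_induct) (simp_all add: covector_zero covector_add)

lemma covector_diff: "covector f \<Longrightarrow> f (u - v) = f u - f v"
  using covector_add[of f "u - v" v] by (simp add: algebra_simps)

text \<open>A basis of covectors together with its dual basis of vectors: the former serve for
  expansions, the latter for contractions and evaluations.\<close>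

definition frame :: "(nat \<Rightarrow> complex ^ 'm::finite \<Rightarrow> complex) \<Rightarrow> (nat \<Rightarrow> complex ^ 'm) \<Rightarrow> bool" where
  "frame \<phi> e \<longleftrightarrow> (\<forall>i<CARD('m). covector (\<phi> i)) \<and>
     (\<forall>i<CARD('m). \<forall>j<CARD('m). \<phi> i (e j) = (if i = j then 1 else 0)) \<and>
     (\<forall>v. v = (\<Sum>i<CARD('m). \<phi> i v *s e i))"

lemma frame_covector: "frame \<phi> (e :: nat \<Rightarrow> complex^'m::finite) \<Longrightarrow> i < CARD('m) \<Longrightarrow> covector (\<phi> i)"
  by (simp add: frame_def)

lemma frame_apply:
  "frame \<phi> (e :: nat \<Rightarrow> complex^'m::finite) \<Longrightarrow> i < CARD('m) \<Longrightarrow> j < CARD('m) \<Longrightarrow> \<phi> i (e j) = (if i = j then 1 else 0)"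
  by (simp add: frame_def)

lemma frame_expand: "frame \<phi> (e :: nat \<Rightarrow> complex^'m::finite) \<Longrightarrow> (\<Sum>i<CARD('m). \<phi> i v *s e i) = v"
  by (simp add: frame_def)

lemma frame_imp_dual_basis:
  fixes e :: "nat \<Rightarrow> complex^'m::finite"
  assumes "frame \<phi> e" shows "dual_basis \<phi>"
proof -
  have "lin_indep_family CARD('m) \<phi>"
    unfolding lin_indep_family_def
  proof (intro allI impI)
    fix a :: "nat \<Rightarrow> complex" and j
    assume a: "\<forall>v. (\<Sum>i<CARD('m). a i * \<phi> i v) = 0" and j: "j < CARD('m)"
    have "0 = (\<Sum>i<CARD('m). a i * \<phi> i (e j))" using a by simp
    also have "\<dots> = (\<Sum>i<CARD('m). if i = j then a i else 0)"
      by (rule sum.cong) (auto simp: frame_apply[OF assms] j)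
    finally show "a j = 0" using j by simp
  qed
  moreover have "\<exists>a. \<forall>v. f v = (\<Sum>i<CARD('m). a i * \<phi> i v)" if f: "covector f" for f
  proof -
    have "f v = (\<Sum>i<CARD('m). f (e i) * \<phi> i v)" for v
    proof -
      have "f v = f (\<Sum>i<CARD('m). \<phi> i v *s e i)" by (simp add: frame_expand[OF assms])
      then show ?thesis by (simp add: covector_sum[OF f] covector_scale[OF f] mult.commute)
    qed
    then show ?thesis by (intro exI[of _ "\<lambda>i. f (e i)"] allI)
  qed
  ultimately show ?thesis using frame_covector[OF assms] by (simp add: dual_basis_def)
qed

lemma frameI_inj:
  fixes e :: "nat \<Rightarrow> complex^'m::finite"
  assumes "\<And>i. i < CARD('m) \<Longrightarrow> covector (\<phi> i)"
    and "\<And>i j. i < CARD('m) \<Longrightarrow> j < CARD('m) \<Longrightarrow> \<phi> i (e j) = (if i = j then 1 else 0)"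
    and inj: "\<And>v. (\<And>i. i < CARD('m) \<Longrightarrow> \<phi> i v = 0) \<Longrightarrow> v = 0"
  shows "frame \<phi> e"
proof -
  have "v = (\<Sum>i<CARD('m). \<phi> i v *s e i)" for v
  proof -
    have "\<phi> j (v - (\<Sum>i<CARD('m). \<phi> i v *s e i)) = 0" if j: "j < CARD('m)" for j
    proof -
      have "(\<Sum>i<CARD('m). \<phi> i v * \<phi> j (e i)) = (\<Sum>i<CARD('m). if i = j then \<phi> i v else 0)"
        by (rule sum.cong) (auto simp: assms j)
      then show ?thesis
        using j by (simp add: covector_diff covector_sum covector_scale assms(1))
    qed
    then show ?thesis using inj by fastforce
  qed
  then show ?thesis using assms by (simp add: frame_def)
qed

lemma covector_component: "covector (\<lambda>v :: complex^'m::finite. v $ k)"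
  by (simp add: covector_iff)

text \<open>As the \<phi> i span all covectors, including the coordinates, they define an injective
  linear endomorphism of the vector space. It is therefore surjective, and the preimages of the axis
  vectors are the dual vectors.\<close>

lemma dual_basis_imp_frame:
  fixes \<phi> :: "nat \<Rightarrow> complex^'m::finite \<Rightarrow> complex"
  assumes "dual_basis \<phi>" obtains e where "frame \<phi> e"
proof -
  have cov: "covector (\<phi> i)" if "i < CARD('m)" for i using assms that by (simp add: dual_basis_def)
  have inj0: "v = 0" if v: "\<And>i. i < CARD('m) \<Longrightarrow> \<phi> i v = 0" for v
  proof -
    have "v $ k = 0" for k
    proof -
      obtain a where "\<And>v. v $ k = (\<Sum>i<CARD('m). a i * \<phi> i v)"
        using assms covector_component[of k] unfolding dual_basis_def by blast
      then show ?thesis using v by simp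
    qed
    then show ?thesis by (simp add: vec_eq_iff)
  qed
  obtain h where h: "bij_betw h {..<CARD('m)} (UNIV :: 'm set)"
    using ex_bij_betw_nat_finite[of "UNIV :: 'm set"] by (auto simp: atLeast0LessThan)
  define g where "g = the_inv_into {..<CARD('m)} h"
  have g: "g k < CARD('m)" "h (g k) = k" for k
    using h unfolding g_def bij_betw_def
    by (auto simp: f_the_inv_into_f the_inv_into_into[where B = "{..<CARD('m)}", simplified])
  have gh: "g (h i) = i" if "i < CARD('m)" for i
    using h that unfolding g_def bij_betw_def by (simp add: the_inv_into_f_f)
  define F where "F v = (\<chi> k. \<phi> (g k) v)" for v
  have lin: "Vector_Spaces.linear (*s) (*s) F"
    unfolding Vector_Spaces.linear_iff using vec.vector_space_axioms
    by (auto simp: F_def vec_eq_iff covector_add[OF cov] covector_scale[OF cov] g)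
  have "inj F"
  proof (rule injI)
    fix u v assume uv: "F u = F v"
    have "\<phi> i (u - v) = 0" if "i < CARD('m)" for i
    proof -
      have "F u $ h i = F v $ h i" using uv by simp
      then show ?thesis using that by (simp add: F_def gh covector_diff cov)
    qed
    then show "u = v" using inj0[of "u - v"] by simp
  qed
  then have "surj F" using vec.linear_inj_imp_surj[OF lin] by simp
  then have ex: "\<exists>w. F w = axis (h j) 1" for j by (metis surjD)
  define e where "e j = (SOME w. F w = axis (h j) 1)" for j
  have e: "F (e j) = axis (h j) 1" for j unfolding e_def using ex by (rule someI_ex)
  have "\<phi> i (e j) = (if i = j then 1 else 0)" if ij: "i < CARD('m)" "j < CARD('m)" for i j
  proof -
    have "\<phi> i (e j) = F (e j) $ h i" using ij by (simp add: F_def gh)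
    moreover have "h i = h j \<longleftrightarrow> i = j" using h ij by (auto simp: bij_betw_def inj_on_def)
    ultimately show ?thesis by (simp add: e axis_def)
  qed
  then have "frame \<phi> e" using cov inj0 by (intro frameI_inj) auto
  then show ?thesis using that by blast
qed

lemma frame_of_spanning_list:
  fixes ws :: "(complex^'m::finite) list"
  assumes len: "length ws = CARD('m)" and span: "vec.span (set ws) = UNIV"
  obtains \<phi> where "frame \<phi> (\<lambda>i. ws ! i)"
proof -
  have card: "card (set ws) \<le> CARD('m)" using len card_length[of ws] by simp
  have "vec.dim (UNIV :: (complex^'m) set) \<le> card (set ws)"
    by (rule vec.span_card_ge_dim) (use span in auto)
  then have card2: "card (set ws) = CARD('m)" using card unfolding vec_dim_card by simp
  then have dist: "distinct ws" using len by (simp add: card_distinct)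
  have ind: "vec.independent (set ws)"
    by (rule vec.card_le_dim_spanning[of _ UNIV]) (use span card2 vec_dim_card[where 'a=complex and 'n='m] in \<open>auto simp del: vec.dim_UNIV\<close>)
  define \<phi> where "\<phi> i v = vec.representation (set ws) v (ws ! i)" for i v
  have "covector (\<phi> i)" for i
    unfolding covector_iff \<phi>_def
    using vec.representation_add[OF ind] vec.representation_scale[OF ind] span by simp
  moreover have "\<phi> i (ws ! j) = (if i = j then 1 else 0)" if "i < CARD('m)" "j < CARD('m)" for i j
    unfolding \<phi>_def using vec.representation_basis[OF ind, of "ws ! j"] that len dist
    by (auto simp: nth_eq_iff_index_eq)
  moreover have "v = 0" if v: "\<And>i. i < CARD('m) \<Longrightarrow> \<phi> i v = 0" for v
  proof -
    have "v = (\<Sum>b\<in>set ws. vec.representation (set ws) v b *s b)"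
      using vec.sum_representation_eq[OF ind, of v "set ws"] span by simp
    also have "\<dots> = 0"
      using v len by (intro sum.neutral ballI) (auto simp: \<phi>_def in_set_conv_nth)
    finally show ?thesis .
  qed
  ultimately have "frame \<phi> (\<lambda>i. ws ! i)" by (intro frameI_inj) auto
  then show ?thesis using that by blast
qed

lemma indep_list_extend:
  fixes ws :: "(complex^'m::finite) list"
  assumes "distinct ws" "vec.independent (set ws)" "set ws \<subseteq> V"
  obtains us where "set us \<subseteq> V" "V \<subseteq> vec.span (set (ws @ us))" "distinct (ws @ us)"
    "vec.independent (set (ws @ us))"
proof -
  obtain B where B: "set ws \<subseteq> B" "B \<subseteq> V" "vec.independent B" "V \<subseteq> vec.span B"
    using vec.maximal_independent_subset_extend[OF assms(3,2)] by blast
  have "finite (B - set ws)" using vec.finiteI_independent[OF B(3)] by simp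
  then obtain us where us: "set us = B - set ws" "distinct us" using finite_distinct_list by blast
  then have eq: "set (ws @ us) = B" using B(1) by auto
  have d: "distinct (ws @ us)" using us assms by auto
  show ?thesis by (rule that[of us]) (use us B eq d in auto)
qed

lemma indep_list_frame:
  fixes ws :: "(complex^'m::finite) list"
  assumes "distinct ws" "vec.independent (set ws)"
  obtains \<phi> e where "frame \<phi> e" "\<And>i. i < length ws \<Longrightarrow> e i = ws ! i" "length ws \<le> CARD('m)"
proof -
  obtain us where us: "UNIV \<subseteq> vec.span (set (ws @ us))" "distinct (ws @ us)" "vec.independent (set (ws @ us))"
    using indep_list_extend[OF assms, of UNIV] by auto
  have "card (set (ws @ us)) = CARD('m)"
    using vec.basis_card_eq_dim[OF subset_UNIV us(1,3)] unfolding vec_dim_card .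
  then have len: "length (ws @ us) = CARD('m)" using distinct_card[OF us(2)] by simp
  obtain \<phi> where "frame \<phi> (\<lambda>i. (ws @ us) ! i)"
    using frame_of_spanning_list[OF len] us(1) by blast
  then show ?thesis
    by (rule that) (use len in \<open>auto simp: nth_append\<close>)
qed

text \<open>The bilinear, not Hermitian, pairing: it identifies vectors with covectors complex
  linearly, so that basis extension for vectors can be used for covectors.\<close>

definition cov_of :: "complex^'m::finite \<Rightarrow> complex^'m \<Rightarrow> complex" where
  "cov_of a v = (\<Sum>j\<in>UNIV. a $ j * v $ j)"

lemma covector_cov_of: "covector (cov_of a)"
  by (simp add: covector_iff cov_of_def algebra_simps sum.distrib sum_distrib_left)

lemma covector_cov_of': "covector (\<lambda>a. cov_of a v)"
  by (simp add: covector_iff cov_of_def algebra_simps sum.distrib sum_distrib_left)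

lemma covector_eq_cov_of:
  assumes "covector f" shows "f = cov_of (\<chi> j. f (axis j 1))"
proof
  fix v
  have "f v = f (\<Sum>j\<in>UNIV. v $ j *s axis j 1)" by (simp add: basis_expansion)
  then show "f v = cov_of (\<chi> j. f (axis j 1)) v"
    by (simp add: covector_sum[OF assms] covector_scale[OF assms] cov_of_def mult.commute)
qed

lemma cov_of_eq_0: "(\<And>v. cov_of a v = 0) \<Longrightarrow> a = 0"
proof -
  assume a: "\<And>v. cov_of a v = 0"
  have "a $ j = cov_of a (axis j 1)" for j
    by (simp add: cov_of_def axis_def if_distrib cong: if_cong)
  then show ?thesis using a by (simp add: vec_eq_iff)
qed

text \<open>The covectors are written as \<open>cov_of\<close> of independent vectors, which are
  completed to a basis and turned back into covectors.\<close>

lemma indep_covectors_frame: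
  fixes \<psi> :: "nat \<Rightarrow> complex^'m::finite \<Rightarrow> complex"
  assumes cov: "\<And>i. i < k \<Longrightarrow> covector (\<psi> i)" and ind: "lin_indep_family k \<psi>"
  obtains \<phi> e where "frame \<phi> e" "\<And>i. i < k \<Longrightarrow> \<phi> i = \<psi> i" "k \<le> CARD('m)"
proof -
  define a where "a i = (\<chi> j. \<psi> i (axis j 1))" for i
  have psi: "\<psi> i = cov_of (a i)" if "i < k" for i
    unfolding a_def using covector_eq_cov_of[OF cov[OF that]] .
  have zero: "\<forall>i<k. c i = 0" if "(\<Sum>i<k. c i *s a i) = 0" for c
  proof -
    have "(\<Sum>i<k. c i * \<psi> i v) = cov_of (\<Sum>i<k. c i *s a i) v" for v
      by (simp add: covector_sum[OF covector_cov_of'] covector_scale[OF covector_cov_of'] psi)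
    then have "\<forall>v. (\<Sum>i<k. c i * \<psi> i v) = 0"
      using that by (simp add: covector_zero[OF covector_cov_of'])
    then show ?thesis using ind unfolding lin_indep_family_def by blast
  qed
  have inj: "inj_on a {..<k}"
  proof (rule inj_onI, rule ccontr)
    fix i j assume ij: "i \<in> {..<k}" "j \<in> {..<k}" "a i = a j" "i \<noteq> j"
    define c where "c l = (if l = i then 1 else 0) - (if l = j then 1 else 0 :: complex)" for l
    have "(\<Sum>l<k. c l *s a l) = (\<Sum>l<k. (if l = i then a l else 0)) - (\<Sum>l<k. (if l = j then a l else 0))"
      unfolding sum_subtractf[symmetric] by (rule sum.cong) (auto simp: c_def)
    also have "\<dots> = 0" using ij by (simp add: sum.delta)
    finally show False using zero[of c] ij by (auto simp: c_def)
  qed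
  define as where "as = map a [0..<k]"
  have dist: "distinct as" using inj by (simp add: as_def distinct_map atLeast0LessThan)
  have set_as: "set as = a ` {..<k}" by (simp add: as_def atLeast0LessThan)
  have "vec.independent (set as)"
    unfolding vec.independent_explicit
  proof (intro conjI allI impI ballI)
    fix c v assume c: "(\<Sum>v\<in>set as. c v *s v) = 0" and v: "v \<in> set as"
    have "(\<Sum>i<k. c (a i) *s a i) = 0"
      using c by (simp add: set_as sum.reindex[OF inj])
    then show "c v = 0" using zero[of "\<lambda>i. c (a i)"] v by (auto simp: set_as)
  qed simp
  then obtain \<eta> e where fr: "frame \<eta> e" and e: "\<And>i. i < length as \<Longrightarrow> e i = as ! i" and le: "length as \<le> CARD('m)"
    using indep_list_frame[OF dist] by blast
  define \<phi> where "\<phi> i = cov_of (e i)" for i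
  have phi: "\<phi> i = \<psi> i" if "i < k" for i
    using that by (simp add: \<phi>_def psi e as_def)
  have "dual_basis \<phi>"
    unfolding dual_basis_def
  proof (intro conjI allI impI)
    show "covector (\<phi> i)" for i by (simp add: \<phi>_def covector_cov_of)
    show "lin_indep_family CARD('m) \<phi>"
      unfolding lin_indep_family_def
    proof (intro allI impI)
      fix c :: "nat \<Rightarrow> complex" and j assume c: "\<forall>v. (\<Sum>i<CARD('m). c i * \<phi> i v) = 0" and j: "j < CARD('m)"
      have "cov_of (\<Sum>i<CARD('m). c i *s e i) v = 0" for v
        using c by (simp add: covector_sum[OF covector_cov_of'] covector_scale[OF covector_cov_of'] \<phi>_def)
      then have "(\<Sum>i<CARD('m). c i *s e i) = 0" by (rule cov_of_eq_0)
      then have "\<eta> j (\<Sum>i<CARD('m). c i *s e i) = 0"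
        using frame_covector[OF fr j] by (simp add: covector_zero)
      moreover have "\<eta> j (\<Sum>i<CARD('m). c i *s e i) = (\<Sum>i<CARD('m). if i = j then c i else 0)"
        unfolding covector_sum[OF frame_covector[OF fr j]]
        by (rule sum.cong) (auto simp: covector_scale[OF frame_covector[OF fr j]] frame_apply[OF fr] j)
      ultimately show "c j = 0" using j by simp
    qed
    fix f :: "complex^'m \<Rightarrow> complex" assume f: "covector f"
    define b where "b = (\<chi> j. f (axis j 1))"
    have "f v = (\<Sum>i<CARD('m). \<eta> i b * \<phi> i v)" for v
    proof -
      have "f v = cov_of (\<Sum>i<CARD('m). \<eta> i b *s e i) v"
        using covector_eq_cov_of[OF f] by (simp add: frame_expand[OF fr] b_def[symmetric])
      then show ?thesis
        by (simp add: covector_sum[OF covector_cov_of'] covector_scale[OF covector_cov_of'] \<phi>_def)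
    qed
    then show "\<exists>c. \<forall>v. f v = (\<Sum>i<CARD('m). c i * \<phi> i v)"
      by (intro exI[of _ "\<lambda>i. \<eta> i b"] allI)
  qed
  then obtain e' where "frame \<phi> e'" by (rule dual_basis_imp_frame)
  then show ?thesis by (rule that) (use phi le in \<open>auto simp: as_def\<close>)
qed

lemma frame_exists: obtains \<phi> e where "frame \<phi> (e :: nat \<Rightarrow> complex^'m::finite)"
  using indep_covectors_frame[of 0 "undefined :: nat \<Rightarrow> complex^'m \<Rightarrow> complex"]
  by (auto simp: lin_indep_family_def)

text \<open>Contraction with (v - \<i> J v) / 2, the (1,0) part of v, where J is multiplication by
  \<i>; \<open>anti_ins\<close> uses the (0,1) part. They lower p, respectively q, by one, because
  the commutator of \<open>rot_deriv\<close> with contraction by v is a contraction by \<i>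
  v.\<close>

definition hol_ins :: "complex ^ 'm \<Rightarrow> 'm::finite form \<Rightarrow> 'm form" where
  "hol_ins v \<omega> = (\<lambda>vs. (1/2) * (ins v \<omega> vs + (- \<i>) * ins (\<i> *s v) \<omega> vs))"

definition anti_ins :: "complex ^ 'm \<Rightarrow> 'm::finite form \<Rightarrow> 'm form" where
  "anti_ins v \<omega> = (\<lambda>vs. (1/2) * (ins v \<omega> vs + \<i> * ins (\<i> *s v) \<omega> vs))"

lemma rot_deriv_ins:
  assumes "htype (Suc k) \<mu> \<omega>"
  shows "rot_deriv vs (ins v \<omega>) = \<i> * of_int \<mu> * ins v \<omega> vs - ins (\<i> *s v) \<omega> vs"
proof -
  have "rot_deriv (v # vs) \<omega> = \<i> * of_int \<mu> * \<omega> (v # vs)" using assms by (simp add: htype_def del: rot_deriv.simps)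
  then show ?thesis by (simp add: ins_def algebra_simps)
qed

lemma i_i_smult: "\<i> *s (\<i> *s v) = - v"
  by (simp add: vec_eq_iff)

lemma linear_ins_minus: "alt k \<omega> \<Longrightarrow> ins (- v) \<omega> vs = - ins v \<omega> vs"
  using linear_neg[OF alt_linear_head[of k \<omega> vs]] by (simp add: ins_def)

lemma htype_hol_ins: "htype (Suc k) \<mu> \<omega> \<Longrightarrow> htype k (\<mu> - 1) (hol_ins v \<omega>)"
proof -
  assume h: "htype (Suc k) \<mu> \<omega>"
  have a: "alt k (ins v \<omega>)" for v using h by (simp add: htype_def)
  have "rot_deriv vs (hol_ins v \<omega>) = \<i> * of_int (\<mu> - 1) * hol_ins v \<omega> vs" for vs
    unfolding hol_ins_def rot_deriv_scale rot_deriv_add rot_deriv_ins[OF h] i_i_smult linear_ins_minus[OF htype_alt[OF h]]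
    by (simp add: field_simps)
  then show ?thesis unfolding htype_def hol_ins_def by (intro conjI alt_scale alt_add a) auto
qed

lemma htype_anti_ins: "htype (Suc k) \<mu> \<omega> \<Longrightarrow> htype k (\<mu> + 1) (anti_ins v \<omega>)"
proof -
  assume h: "htype (Suc k) \<mu> \<omega>"
  have a: "alt k (ins v \<omega>)" for v using h by (simp add: htype_def)
  have "rot_deriv vs (anti_ins v \<omega>) = \<i> * of_int (\<mu> + 1) * anti_ins v \<omega> vs" for vs
    unfolding anti_ins_def rot_deriv_scale rot_deriv_add rot_deriv_ins[OF h] i_i_smult linear_ins_minus[OF htype_alt[OF h]]
    by (simp add: field_simps)
  then show ?thesis unfolding htype_def anti_ins_def by (intro conjI alt_scale alt_add a) auto
qed

lemma ins_hol_ins: "alt k \<omega> \<Longrightarrow> ins v (hol_ins u \<omega>) = (\<lambda>vs. - hol_ins u (ins v \<omega>) vs)"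
  by (rule ext) (simp add: hol_ins_def ins_def alt_swap[of k \<omega> v] algebra_simps)

lemma ins_anti_ins: "alt k \<omega> \<Longrightarrow> ins v (anti_ins u \<omega>) = (\<lambda>vs. - anti_ins u (ins v \<omega>) vs)"
  by (rule ext) (simp add: anti_ins_def ins_def alt_swap[of k \<omega> v] algebra_simps)

lemma conj_form_one_form: "conj_form (one_form f) = one_form (\<lambda>v. cnj (f v))"
  by (rule ext) (simp add: conj_form_def one_form_def)

lemma frame_ins_expand:
  fixes e :: "nat \<Rightarrow> complex^'m::finite"
  assumes fr: "frame \<phi> e" and alt: "alt k \<omega>"
  shows "(\<Sum>i<CARD('m). \<phi> i v * hol_ins (e i) \<omega> vs + cnj (\<phi> i v) * anti_ins (e i) \<omega> vs) = \<omega> (v # vs)"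
proof -
  note lin = alt_linear_head[OF alt, of vs]
  have smult: "c *s u = Re c *\<^sub>R u + Im c *\<^sub>R (\<i> *s u)" for c and u :: "complex^'m"
    by (simp add: vec_eq_iff complex_eq_iff)
  have "\<omega> (v # vs) = \<omega> ((\<Sum>i<CARD('m). \<phi> i v *s e i) # vs)" by (simp add: frame_expand[OF fr])
  also have "\<dots> = (\<Sum>i<CARD('m). Re (\<phi> i v) *\<^sub>R \<omega> (e i # vs) + Im (\<phi> i v) *\<^sub>R \<omega> ((\<i> *s e i) # vs))"
    by (subst smult) (simp add: linear_sum[OF lin] linear_add[OF lin] linear_scale[OF lin])
  also have "\<dots> = (\<Sum>i<CARD('m). \<phi> i v * hol_ins (e i) \<omega> vs + cnj (\<phi> i v) * anti_ins (e i) \<omega> vs)"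
  proof (rule sum.cong[OF refl])
    fix i
    show "Re (\<phi> i v) *\<^sub>R \<omega> (e i # vs) + Im (\<phi> i v) *\<^sub>R \<omega> ((\<i> *s e i) # vs) =
      \<phi> i v * hol_ins (e i) \<omega> vs + cnj (\<phi> i v) * anti_ins (e i) \<omega> vs"
      by (simp add: hol_ins_def anti_ins_def ins_def complex_eq_iff algebra_simps) (simp add: field_simps)
  qed
  finally show ?thesis by simp
qed

text \<open>The exterior counterpart of Euler's identity: contracting and multiplying back, summed
  over a frame, counts the degree. It rebuilds a form from its contractions and so allows induction
  on the degree.\<close>

lemma euler_formula:
  fixes e :: "nat \<Rightarrow> complex^'m::finite"
  assumes fr: "frame \<phi> e" and "alt k \<omega>"
  shows "(\<Sum>i<CARD('m). wedge (one_form (\<phi> i)) (hol_ins (e i) \<omega>) vs +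
            wedge (conj_form (one_form (\<phi> i))) (anti_ins (e i) \<omega>) vs) = of_nat k * \<omega> vs"
  using assms(2)
proof (induction vs arbitrary: k \<omega>)
  case Nil
  then show ?case by (cases k) (simp_all add: one_form_def conj_form_def)
next
  case (Cons v vs)
  have "(\<Sum>i<CARD('m). wedge (one_form (\<phi> i)) (hol_ins (e i) \<omega>) (v # vs) +
            wedge (conj_form (one_form (\<phi> i))) (anti_ins (e i) \<omega>) (v # vs)) =
     (\<Sum>i<CARD('m). \<phi> i v * hol_ins (e i) \<omega> vs + cnj (\<phi> i v) * anti_ins (e i) \<omega> vs) +
     (\<Sum>i<CARD('m). wedge (one_form (\<phi> i)) (hol_ins (e i) (ins v \<omega>)) vs +
            wedge (conj_form (one_form (\<phi> i))) (anti_ins (e i) (ins v \<omega>)) vs)"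
    unfolding sum.distrib[symmetric]
    by (rule sum.cong) (simp_all add: conj_form_one_form wedge_one_form_Cons
        ins_hol_ins[OF Cons.prems] ins_anti_ins[OF Cons.prems] wedge_minus_right)
  also have "\<dots> = \<omega> (v # vs) + of_nat (k - 1) * ins v \<omega> vs"
    unfolding frame_ins_expand[OF fr Cons.prems] Cons.IH[OF alt_ins[OF Cons.prems]] ..
  also have "\<dots> = of_nat k * \<omega> (v # vs)"
  proof (cases k)
    case 0
    then show ?thesis using Cons.prems by (simp add: ins_def)
  next
    case (Suc k')
    then show ?thesis by (simp add: ins_def algebra_simps)
  qed
  finally show ?case .
qed


section \<open>Expansion in a frame\<close>

definition pq_span :: "(nat \<Rightarrow> complex ^ 'm::finite \<Rightarrow> complex) \<Rightarrow> nat \<Rightarrow> nat \<Rightarrow> 'm form \<Rightarrow> bool" where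
  "pq_span \<phi> p q \<omega> \<longleftrightarrow> (\<exists>c. \<omega> = pq_expansion p q \<phi> c)"

lemma finite_multi_indices [simp]: "finite (multi_indices n p)"
  unfolding multi_indices_def by (rule finite_subset[of _ "Pow {..<n}"]) auto

lemma multi_indices_0 [simp]: "multi_indices n 0 = {{}}"
  by (auto simp: multi_indices_def finite_subset[OF _ finite_lessThan])

lemma multi_indices_full: "multi_indices n n = {{..<n}}"
proof -
  have "I = {..<n}" if "I \<subseteq> {..<n}" "card I = n" for I
    using card_subset_eq[OF finite_lessThan that(1)] that(2) by simp
  then show ?thesis unfolding multi_indices_def by (intro set_eqI iffI) (blast, simp)
qed

lemma pq_span_zero: "pq_span \<phi> p q (\<lambda>vs. 0)"
  unfolding pq_span_def pq_expansion_def by (rule exI[of _ "\<lambda>I J. 0"]) simp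

lemma pq_span_add: "pq_span \<phi> p q \<alpha> \<Longrightarrow> pq_span \<phi> p q \<beta> \<Longrightarrow> pq_span \<phi> p q (\<lambda>vs. \<alpha> vs + \<beta> vs)"
  unfolding pq_span_def pq_expansion_def
proof (elim exE)
  fix c d
  assume "\<alpha> = (\<lambda>vs. \<Sum>I\<in>multi_indices CARD('a) p. \<Sum>J\<in>multi_indices CARD('a) q.
                c I J * wedge (wedge_index \<phi> I) (conj_form (wedge_index \<phi> J)) vs)"
    "\<beta> = (\<lambda>vs. \<Sum>I\<in>multi_indices CARD('a) p. \<Sum>J\<in>multi_indices CARD('a) q.
                d I J * wedge (wedge_index \<phi> I) (conj_form (wedge_index \<phi> J)) vs)"
  then show "\<exists>c. (\<lambda>vs. \<alpha> vs + \<beta> vs) = (\<lambda>vs. \<Sum>I\<in>multi_indices CARD('a) p. \<Sum>J\<in>multi_indices CARD('a) q.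
                c I J * wedge (wedge_index \<phi> I) (conj_form (wedge_index \<phi> J)) vs)"
    by (intro exI[of _ "\<lambda>I J. c I J + d I J"]) (simp add: sum.distrib distrib_right)
qed

lemma pq_span_scale: "pq_span \<phi> p q \<alpha> \<Longrightarrow> pq_span \<phi> p q (\<lambda>vs. s * \<alpha> vs)"
  unfolding pq_span_def pq_expansion_def
proof (elim exE)
  fix c
  assume "\<alpha> = (\<lambda>vs. \<Sum>I\<in>multi_indices CARD('a) p. \<Sum>J\<in>multi_indices CARD('a) q.
                c I J * wedge (wedge_index \<phi> I) (conj_form (wedge_index \<phi> J)) vs)"
  then show "\<exists>c. (\<lambda>vs. s * \<alpha> vs) = (\<lambda>vs. \<Sum>I\<in>multi_indices CARD('a) p. \<Sum>J\<in>multi_indices CARD('a) q.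
                c I J * wedge (wedge_index \<phi> I) (conj_form (wedge_index \<phi> J)) vs)"
    by (intro exI[of _ "\<lambda>I J. s * c I J"]) (simp add: sum_distrib_left mult.assoc)
qed

lemma pq_span_sum: "(\<And>i. i \<in> A \<Longrightarrow> pq_span \<phi> p q (f i)) \<Longrightarrow> pq_span \<phi> p q (\<lambda>vs. \<Sum>i\<in>A. f i vs)"
  by (induction A rule: infinite_finite_induct) (simp_all add: pq_span_zero pq_span_add)

lemma pq_span_elem:
  fixes \<phi> :: "nat \<Rightarrow> complex ^ 'm::finite \<Rightarrow> complex"
  assumes "I \<in> multi_indices CARD('m) p" "J \<in> multi_indices CARD('m) q"
  shows "pq_span \<phi> p q (wedge (wedge_index \<phi> I) (conj_form (wedge_index \<phi> J)))"
proof -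
  have "(\<Sum>I'\<in>multi_indices CARD('m) p. \<Sum>J'\<in>multi_indices CARD('m) q.
      (if I' = I \<and> J' = J then 1 else 0) * wedge (wedge_index \<phi> I') (conj_form (wedge_index \<phi> J')) vs) =
      wedge (wedge_index \<phi> I) (conj_form (wedge_index \<phi> J)) vs" (is "?l = ?r") for vs
  proof -
    have "?l = (\<Sum>I'\<in>multi_indices CARD('m) p. \<Sum>J'\<in>multi_indices CARD('m) q.
       if J' = J then (if I' = I then wedge (wedge_index \<phi> I') (conj_form (wedge_index \<phi> J)) vs else 0) else 0)"
      by (intro sum.cong refl) auto
    also have "\<dots> = ?r" using assms by (simp add: sum.delta)
    finally show ?thesis .
  qed
  then show ?thesis unfolding pq_span_def pq_expansion_def
    by (intro exI[of _ "\<lambda>I' J'. if I' = I \<and> J' = J then 1 else 0"] ext) simp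
qed

lemma one_form_anticommute:
  "wedge (one_form f) (wedge (one_form g) \<omega>) vs = - wedge (one_form g) (wedge (one_form f) \<omega>) vs"
proof -
  have "wedge (one_form f) (one_form g) = (\<lambda>vs. - wedge (one_form g) (one_form f) vs)"
    by (rule ext) (use wedge_commute[OF homog_one_form homog_one_form] in simp)
  then show ?thesis by (simp add: wedge_assoc[symmetric] wedge_minus_left)
qed

lemma one_form_square: "wedge (one_form f) (wedge (one_form f) \<omega>) = (\<lambda>vs. 0)"
proof
  fix vs
  have "wedge (one_form f) (wedge (one_form f) \<omega>) vs = - wedge (one_form f) (wedge (one_form f) \<omega>) vs"
    by (rule one_form_anticommute)
  then show "wedge (one_form f) (wedge (one_form f) \<omega>) vs = 0"
    unfolding eq_neg_iff_add_eq_0 by (simp flip: mult_2)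
qed

lemma wedge_list_repeat:
  assumes "f \<in> set fs" shows "wedge (one_form f) (wedge_list fs) = (\<lambda>vs. 0)"
  using assms
proof (induction fs)
  case (Cons g fs)
  show ?case
  proof (cases "f = g")
    case True
    then show ?thesis by (simp add: one_form_square)
  next
    case False
    then show ?thesis using Cons by (intro ext) (simp add: one_form_anticommute[of f g])
  qed
qed simp

lemma wedge_list_insort:
  "\<exists>s. \<forall>vs. wedge (one_form (\<phi> i)) (wedge_list (map \<phi> xs)) vs = s * wedge_list (map \<phi> (insort i xs)) vs"
proof (induction xs)
  case Nil
  then show ?case by (intro exI[of _ 1]) simp
next
  case (Cons x xs)
  then obtain s where s: "\<And>vs. wedge (one_form (\<phi> i)) (wedge_list (map \<phi> xs)) vs = s * wedge_list (map \<phi> (insort i xs)) vs"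
    by blast
  show ?case
  proof (cases "i \<le> x")
    case True
    then show ?thesis by (intro exI[of _ 1]) simp
  next
    case False
    have "wedge (one_form (\<phi> i)) (wedge_list (map \<phi> xs)) = (\<lambda>vs. s * wedge_list (map \<phi> (insort i xs)) vs)"
      using s by blast
    then show ?thesis using False
      by (intro exI[of _ "- s"]) (simp add: one_form_anticommute[of "\<phi> i"] wedge_scale_right)
  qed
qed

lemma wedge_index_insert:
  assumes "finite I"
  obtains s where "wedge (one_form (\<phi> i)) (wedge_index \<phi> I) = (\<lambda>vs. s * wedge_index \<phi> (insert i I) vs)"
    "i \<in> I \<Longrightarrow> s = 0"
proof (cases "i \<in> I")
  case True
  then have "\<phi> i \<in> set (map \<phi> (sorted_list_of_set I))" using assms by simp
  then have "wedge (one_form (\<phi> i)) (wedge_index \<phi> I) = (\<lambda>vs. 0 * wedge_index \<phi> (insert i I) vs)"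
    unfolding wedge_index_def by (simp add: wedge_list_repeat)
  then show ?thesis by (rule that) simp
next
  case False
  obtain s where s: "\<forall>vs. wedge (one_form (\<phi> i)) (wedge_list (map \<phi> (sorted_list_of_set I))) vs
      = s * wedge_list (map \<phi> (insort i (sorted_list_of_set I))) vs"
    using wedge_list_insort by blast
  have "sorted_list_of_set (insert i I) = insort i (sorted_list_of_set I)"
    using assms False by simp
  then show ?thesis using s False by (intro that[of s]) (auto simp: wedge_index_def)
qed

lemma homog_wedge_list: "homog (length fs) (wedge_list fs)"
proof (induction fs)
  case (Cons f fs)
  then show ?case using homog_wedge[OF homog_one_form, of "length fs" "wedge_list fs" f] by simp
qed (simp add: homog_unit_form)

lemma homog_wedge_index: "I \<in> multi_indices n p \<Longrightarrow> homog p (wedge_index \<phi> I)"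
  using homog_wedge_list[of "map \<phi> (sorted_list_of_set I)"]
  by (auto simp: wedge_index_def multi_indices_def)

lemma pq_span_wedge_hol:
  fixes \<phi> :: "nat \<Rightarrow> complex ^ 'm::finite \<Rightarrow> complex"
  assumes i: "i < CARD('m)" and "pq_span \<phi> p q \<omega>"
  shows "pq_span \<phi> (Suc p) q (wedge (one_form (\<phi> i)) \<omega>)"
proof -
  obtain c where c: "\<omega> = pq_expansion p q \<phi> c" using assms by (auto simp: pq_span_def)
  show ?thesis
    unfolding c pq_expansion_def wedge_sum_right wedge_scale_right
  proof (intro pq_span_sum pq_span_scale)
    fix I J assume IJ: "I \<in> multi_indices CARD('m) p" "J \<in> multi_indices CARD('m) q"
    then have fin: "finite I" by (auto simp: multi_indices_def intro: finite_subset)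
    obtain s where s: "wedge (one_form (\<phi> i)) (wedge_index \<phi> I) = (\<lambda>vs. s * wedge_index \<phi> (insert i I) vs)"
      "i \<in> I \<Longrightarrow> s = 0" using wedge_index_insert[OF fin, of \<phi> i] by blast
    have eq: "wedge (one_form (\<phi> i)) (wedge (wedge_index \<phi> I) (conj_form (wedge_index \<phi> J))) =
       (\<lambda>vs. s * wedge (wedge_index \<phi> (insert i I)) (conj_form (wedge_index \<phi> J)) vs)"
      by (rule ext) (simp add: wedge_assoc[symmetric] s(1) wedge_scale_left)
    show "pq_span \<phi> (Suc p) q (wedge (one_form (\<phi> i)) (wedge (wedge_index \<phi> I) (conj_form (wedge_index \<phi> J))))"
    proof (cases "i \<in> I")
      case True
      then show ?thesis by (simp add: eq s pq_span_zero)
    next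
      case False
      then have "insert i I \<in> multi_indices CARD('m) (Suc p)"
        using IJ i fin by (auto simp: multi_indices_def)
      then show ?thesis unfolding eq by (intro pq_span_scale pq_span_elem IJ)
    qed
  qed
qed

lemma pq_span_wedge_anti:
  fixes \<phi> :: "nat \<Rightarrow> complex ^ 'm::finite \<Rightarrow> complex"
  assumes i: "i < CARD('m)" and "pq_span \<phi> p q \<omega>"
  shows "pq_span \<phi> p (Suc q) (wedge (conj_form (one_form (\<phi> i))) \<omega>)"
proof -
  obtain c where c: "\<omega> = pq_expansion p q \<phi> c" using assms by (auto simp: pq_span_def)
  show ?thesis
    unfolding c pq_expansion_def wedge_sum_right wedge_scale_right
  proof (intro pq_span_sum pq_span_scale)
    fix I J assume IJ: "I \<in> multi_indices CARD('m) p" "J \<in> multi_indices CARD('m) q"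
    then have fin: "finite J" by (auto simp: multi_indices_def intro: finite_subset)
    obtain s where s: "wedge (one_form (\<phi> i)) (wedge_index \<phi> J) = (\<lambda>vs. s * wedge_index \<phi> (insert i J) vs)"
      "i \<in> J \<Longrightarrow> s = 0" using wedge_index_insert[OF fin, of \<phi> i] by blast
    have h1: "homog 1 (conj_form (one_form (\<phi> i)))" unfolding conj_form_one_form by (rule homog_one_form)
    have comm: "wedge (conj_form (one_form (\<phi> i))) (wedge_index \<phi> I) =
       (\<lambda>vs. (-1)^p * wedge (wedge_index \<phi> I) (conj_form (one_form (\<phi> i))) vs)"
      by (rule ext) (use wedge_commute[OF h1 homog_wedge_index[OF IJ(1)]] in simp)
    have conj: "wedge (conj_form (one_form (\<phi> i))) (conj_form (wedge_index \<phi> J)) =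
       (\<lambda>vs. cnj s * conj_form (wedge_index \<phi> (insert i J)) vs)"
      unfolding conj_form_wedge[symmetric] s(1) by (simp add: conj_form_def)
    have eq: "wedge (conj_form (one_form (\<phi> i))) (wedge (wedge_index \<phi> I) (conj_form (wedge_index \<phi> J))) =
       (\<lambda>vs. ((-1)^p * cnj s) * wedge (wedge_index \<phi> I) (conj_form (wedge_index \<phi> (insert i J))) vs)"
      unfolding wedge_assoc[symmetric] comm
      by (rule ext) (simp add: wedge_assoc conj wedge_scale_left wedge_scale_right)
    show "pq_span \<phi> p (Suc q) (wedge (conj_form (one_form (\<phi> i))) (wedge (wedge_index \<phi> I) (conj_form (wedge_index \<phi> J))))"
    proof (cases "i \<in> J")
      case True
      then show ?thesis by (simp add: eq s pq_span_zero)
    next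
      case False
      then have "insert i J \<in> multi_indices CARD('m) (Suc q)"
        using IJ i fin by (auto simp: multi_indices_def)
      then show ?thesis unfolding eq by (intro pq_span_scale pq_span_elem IJ)
    qed
  qed
qed

lemma conj_unit_form [simp]: "conj_form unit_form = unit_form"
  by (rule ext) (simp add: conj_form_def unit_form_def)

lemma htype_0_eq:
  assumes "htype 0 \<mu> \<omega>" shows "\<omega> = (\<lambda>vs. \<omega> [] * unit_form vs)"
  using alt_homog[OF htype_alt[OF assms]] by (auto simp: homog_def unit_form_def)

text \<open>Induction on the degree through \<open>euler_formula\<close>. The two halves need each
  other: for p = 0 there is no (p - 1, q) space for the contraction \<open>hol_ins\<close> to lie
  in, and the vanishing half disposes of that term; likewise for q = 0 and
  \<open>anti_ins\<close>.\<close>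

lemma htype_expansion:
  fixes e :: "nat \<Rightarrow> complex^'m::finite"
  assumes fr: "frame \<phi> e" and "htype k \<mu> \<omega>"
  shows "(\<forall>p q. p + q = k \<longrightarrow> \<mu> = int p - int q \<longrightarrow> pq_span \<phi> p q \<omega>) \<and>
    ((\<nexists>p q. p + q = k \<and> \<mu> = int p - int q) \<longrightarrow> \<omega> = (\<lambda>vs. 0))"
  using assms(2)
proof (induction k arbitrary: \<mu> \<omega>)
  case 0
  note eq = htype_0_eq[OF 0]
  have "pq_span \<phi> 0 0 (wedge (wedge_index \<phi> {}) (conj_form (wedge_index \<phi> {})))"
    by (rule pq_span_elem) simp_all
  then have "pq_span \<phi> 0 0 unit_form" by (simp add: wedge_index_def)
  then have 1: "pq_span \<phi> 0 0 \<omega>" by (subst eq) (rule pq_span_scale)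
  have "rot_deriv [] \<omega> = \<i> * of_int \<mu> * \<omega> []" using 0 by (simp add: htype_def del: rot_deriv.simps)
  then have "\<mu> \<noteq> 0 \<Longrightarrow> \<omega> [] = 0" by simp
  then have "\<mu> \<noteq> 0 \<Longrightarrow> \<omega> = (\<lambda>vs. 0)" by (subst eq) simp
  then show ?case using 1 by auto
next
  case (Suc k)
  have alt: "alt (Suc k) \<omega>" by (rule htype_alt[OF Suc.prems])
  have euler: "\<omega> = (\<lambda>vs. (1 / of_nat (Suc k)) * ((\<Sum>i<CARD('m). wedge (one_form (\<phi> i)) (hol_ins (e i) \<omega>) vs +
            wedge (conj_form (one_form (\<phi> i))) (anti_ins (e i) \<omega>) vs)))"
    by (rule ext, subst euler_formula[OF fr alt]) (simp del: of_nat_Suc)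
  note h = htype_hol_ins[OF Suc.prems] and a = htype_anti_ins[OF Suc.prems]
  show ?case
  proof (intro conjI allI impI)
    fix p q assume pq: "p + q = Suc k" "\<mu> = int p - int q"
    have 1: "pq_span \<phi> p q (wedge (one_form (\<phi> i)) (hol_ins (e i) \<omega>))" if i: "i < CARD('m)" for i
    proof (cases p)
      case 0
      then have "hol_ins (e i) \<omega> = (\<lambda>vs. 0)"
        using Suc.IH[OF h[of "e i"]] pq by auto
      then show ?thesis by (simp add: pq_span_zero)
    next
      case (Suc p')
      then have "pq_span \<phi> p' q (hol_ins (e i) \<omega>)"
        using Suc.IH[OF h[of "e i"]] pq by auto
      then show ?thesis unfolding Suc by (rule pq_span_wedge_hol[OF i])
    qed
    have 2: "pq_span \<phi> p q (wedge (conj_form (one_form (\<phi> i))) (anti_ins (e i) \<omega>))" if i: "i < CARD('m)" for i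
    proof (cases q)
      case 0
      then have "anti_ins (e i) \<omega> = (\<lambda>vs. 0)"
        using Suc.IH[OF a[of "e i"]] pq by auto
      then show ?thesis by (simp add: pq_span_zero)
    next
      case (Suc q')
      then have "pq_span \<phi> p q' (anti_ins (e i) \<omega>)"
        using Suc.IH[OF a[of "e i"]] pq by auto
      then show ?thesis unfolding Suc by (rule pq_span_wedge_anti[OF i])
    qed
    show "pq_span \<phi> p q \<omega>"
      by (subst euler) (intro pq_span_scale pq_span_sum pq_span_add 1 2, auto)
  next
    assume no: "\<nexists>p q. p + q = Suc k \<and> \<mu> = int p - int q"
    have 1: "hol_ins (e i) \<omega> = (\<lambda>vs. 0)" for i
    proof -
      have "\<nexists>p q. p + q = k \<and> \<mu> - 1 = int p - int q"
      proof (intro notI, elim exE conjE)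
        fix p q assume "p + q = k" "\<mu> - 1 = int p - int q"
        then show False using no[simplified, rule_format, of "Suc p" q] by simp
      qed
      then show ?thesis using Suc.IH[OF h[of "e i"]] by blast
    qed
    have 2: "anti_ins (e i) \<omega> = (\<lambda>vs. 0)" for i
    proof -
      have "\<nexists>p q. p + q = k \<and> \<mu> + 1 = int p - int q"
      proof (intro notI, elim exE conjE)
        fix p q assume "p + q = k" "\<mu> + 1 = int p - int q"
        then show False using no[simplified, rule_format, of p "Suc q"] by simp
      qed
      then show ?thesis using Suc.IH[OF a[of "e i"]] by blast
    qed
    show "\<omega> = (\<lambda>vs. 0)" by (subst euler) (simp add: 1 2)
  qed
qed

lemma htype_pq_span:
  "frame \<phi> e \<Longrightarrow> htype (p + q) (int p - int q) \<omega> \<Longrightarrow> pq_span \<phi> p q \<omega>"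
  using htype_expansion by blast

lemma htype_out_of_range:
  assumes "htype k \<mu> \<omega>" "\<bar>\<mu>\<bar> > int k" shows "\<omega> = (\<lambda>vs. 0)"
proof -
  obtain \<phi> and e :: "nat \<Rightarrow> complex^'a" where "frame \<phi> e" using frame_exists .
  moreover have "\<nexists>p q. p + q = k \<and> \<mu> = int p - int q" using assms(2) by auto
  ultimately show ?thesis using htype_expansion assms(1) by blast
qed

lemma htype_wedge_index:
  assumes "dual_basis (\<phi> :: nat \<Rightarrow> complex^'m::finite \<Rightarrow> complex)" "I \<in> multi_indices CARD('m) p"
  shows "htype p (int p) (wedge_index \<phi> I)"
proof -
  have "finite I" "I \<subseteq> {..<CARD('m)}" "card I = p" using assms by (auto simp: multi_indices_def intro: finite_subset)
  then show ?thesis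
    using htype_wedge_list[of "map \<phi> (sorted_list_of_set I)"] assms
    by (auto simp: wedge_index_def dual_basis_def)
qed

lemma htype_pq_expansion:
  fixes \<phi> :: "nat \<Rightarrow> complex^'m::finite \<Rightarrow> complex"
  assumes "dual_basis \<phi>"
  shows "htype (p + q) (int p - int q) (pq_expansion p q \<phi> c)"
  unfolding pq_expansion_def
proof (intro htype_sum htype_scale)
  fix I J assume "I \<in> multi_indices CARD('m) p" "J \<in> multi_indices CARD('m) q"
  then have "htype (p + q) (int p + - int q) (wedge (wedge_index \<phi> I) (conj_form (wedge_index \<phi> J)))"
    by (intro htype_wedge htype_conj htype_wedge_index assms)
  then show "htype (p + q) (int p - int q) (wedge (wedge_index \<phi> I) (conj_form (wedge_index \<phi> J)))" by simp
qed

text \<open>This removes the existential basis from \<open>pq_form\<close>, after which bidegree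
  passes through products, conjugation and complex linear pullback by formal rules.\<close>

lemma pq_form_iff: "pq_form p q \<omega> \<longleftrightarrow> htype (p + q) (int p - int q) \<omega>"
proof
  assume "pq_form p q \<omega>"
  then show "htype (p + q) (int p - int q) \<omega>"
    unfolding pq_form_def using htype_pq_expansion by blast
next
  assume h: "htype (p + q) (int p - int q) \<omega>"
  obtain \<phi> and e :: "nat \<Rightarrow> complex^'a" where fr: "frame \<phi> e" using frame_exists .
  then show "pq_form p q \<omega>"
    using htype_pq_span[OF fr h] frame_imp_dual_basis[OF fr] unfolding pq_form_def pq_span_def by blast
qed

section \<open>Forms of type (p, 0)\<close>

definition hol :: "nat \<Rightarrow> 'm::finite form \<Rightarrow> bool" where
  "hol p \<Psi> \<longleftrightarrow> htype p (int p) \<Psi>"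

lemma hol_expansion:
  fixes e :: "nat \<Rightarrow> complex^'m::finite"
  assumes "frame \<phi> e" "hol p \<Psi>"
  obtains c where "\<Psi> = (\<lambda>vs. \<Sum>I\<in>multi_indices CARD('m) p. c I * wedge_index \<phi> I vs)"
proof -
  have "pq_span \<phi> p 0 \<Psi>" using htype_pq_span[OF assms(1), of p 0] assms(2) by (simp add: hol_def)
  then obtain c where "\<Psi> = pq_expansion p 0 \<phi> c" by (auto simp: pq_span_def)
  then have "\<Psi> = (\<lambda>vs. \<Sum>I\<in>multi_indices CARD('m) p. c I {} * wedge_index \<phi> I vs)"
    by (simp add: pq_expansion_def wedge_index_def)
  then show ?thesis by (rule that)
qed

text \<open>The contraction would have degree p and \<mu> = p + 2, which is out of range. This is
  what makes (p, 0)-forms complex linear in each vector.\<close>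

lemma hol_anti_ins: "hol (Suc p) \<Psi> \<Longrightarrow> anti_ins v \<Psi> = (\<lambda>vs. 0)"
  by (rule htype_out_of_range[OF htype_anti_ins[of p "int (Suc p)"]]) (auto simp: hol_def)

lemma hol_ins_i:
  assumes "hol p \<Psi>" shows "ins (\<i> *s v) \<Psi> vs = \<i> * ins v \<Psi> vs"
proof (cases p)
  case 0
  then show ?thesis using alt_0_ins[OF htype_alt, of 0 \<Psi>] assms by (simp add: hol_def)
next
  case (Suc q)
  have "anti_ins v \<Psi> vs = 0" using hol_anti_ins[of q \<Psi> v] assms Suc by simp
  then have "ins v \<Psi> vs + \<i> * ins (\<i> *s v) \<Psi> vs = 0" by (simp add: anti_ins_def)
  then have "\<i> * (ins v \<Psi> vs + \<i> * ins (\<i> *s v) \<Psi> vs) = 0" by simp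
  then show ?thesis by (simp add: algebra_simps)
qed

lemma hol_ins:
  assumes "hol (Suc p) \<Psi>" shows "hol p (ins v \<Psi>)"
proof -
  have "hol_ins v \<Psi> = ins v \<Psi>"
    by (rule ext) (simp add: hol_ins_def hol_ins_i[OF assms])
  then show ?thesis using htype_hol_ins[of p "int (Suc p)" \<Psi> v] assms by (simp add: hol_def)
qed

lemma hol_alt: "hol p \<Psi> \<Longrightarrow> alt p \<Psi>"
  by (simp add: hol_def htype_def)

lemma sigma_0 [simp]: "sigma 0 = 1"
  by (simp add: sigma_def)

lemma sigma_Suc: "sigma (Suc p) = sigma p * ((-1) ^ p * \<i> / 2)"
proof -
  have "(Suc p)\<^sup>2 = p\<^sup>2 + 2 * p + 1" by (simp add: power2_eq_square)
  then have "\<i> ^ ((Suc p)\<^sup>2) = \<i> ^ (p\<^sup>2) * ((\<i> ^ 2) ^ p * \<i>)" by (simp add: power_add power_mult)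
  then show ?thesis by (simp add: sigma_def)
qed

text \<open>The sign is the one produced by moving a form of degree a past one of degree b, so
  products of squares keep the right constant.\<close>

lemma sigma_add: "sigma (a + b) = (-1) ^ (a * b) * sigma a * sigma b"
proof -
  have "(a + b)\<^sup>2 = a\<^sup>2 + b\<^sup>2 + 2 * (a * b)" by (simp add: power2_eq_square algebra_simps)
  then have "\<i> ^ ((a + b)\<^sup>2) = \<i> ^ (a\<^sup>2) * \<i> ^ (b\<^sup>2) * (\<i> ^ 2) ^ (a * b)"
    by (simp only: power_add power_mult)
  then show ?thesis by (simp add: sigma_def power_add)
qed

text \<open>The order of the real basis in which \<open>dv\<close> is positive.\<close>

fun jlist :: "(complex^'m::finite) list \<Rightarrow> (complex^'m) list" where
  "jlist [] = []"
| "jlist (v # vs) = v # (\<i> *s v) # jlist vs"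

lemma jlist_append: "jlist (us @ vs) = jlist us @ jlist vs"
  by (induction us) simp_all

lemma length_jlist [simp]: "length (jlist vs) = 2 * length vs"
  by (induction vs) simp_all

lemma set_jlist: "set (jlist vs) = (\<Union>v\<in>set vs. {v, \<i> *s v})"
  by (induction vs) auto

lemma map_jlist: "(\<And>v. L (\<i> *s v) = \<i> *s L v) \<Longrightarrow> map L (jlist vs) = jlist (map L vs)"
  by (induction vs) simp_all

lemma ins_conj: "ins v (conj_form \<omega>) = conj_form (ins v \<omega>)"
  by (simp add: ins_def conj_form_def)

text \<open>Contracting with v and then \<i> v must hit each factor once, since a second hit on the
  same factor repeats a vector up to the scalar \<i>. The two surviving terms add up to -2 \<i>
  (-1)^q times the product of the contractions, and \<open>sigma\<close> is exactly the constant
  that cancels these factors. With both forms equal the value is a squared modulus.\<close>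

lemma hol_wedge_conj_jlist:
  assumes "hol p \<Psi>" "hol p \<Theta>" "length vs = p"
  shows "sigma p * wedge \<Psi> (conj_form \<Theta>) (jlist vs) = \<Psi> vs * cnj (\<Theta> vs)"
  using assms
proof (induction vs arbitrary: p \<Psi> \<Theta>)
  case Nil
  then show ?case by (simp add: conj_form_def)
next
  case (Cons v vs)
  then obtain q where p: "p = Suc q" "length vs = q" by auto
  define P Q w where "P = ins v \<Psi>" and "Q = conj_form (ins v \<Theta>)" and "w = \<i> *s v"
  have hP: "hol q P" and hQ: "hol q (ins v \<Theta>)" using hol_ins Cons.prems p by (auto simp: P_def)
  \<comment> \<open>In a complex linear slot \<i> v is a multiple of v, so contracting with both
    gives zero.\<close>
  have rep: "ins w (ins v \<omega>) = (\<lambda>vs. 0)" if "hol p \<omega>" for \<omega>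
  proof
    fix us
    have "ins w (ins v \<omega>) us = - ins w \<omega> (v # us)"
      using alt_swap[OF hol_alt[OF that], of v w us] by (simp add: ins_def)
    also have "\<dots> = 0"
      unfolding w_def hol_ins_i[OF that] using alt_repeat[OF hol_alt[OF that]] by (simp add: ins_def)
    finally show "ins w (ins v \<omega>) us = 0" .
  qed
  have a: "ins w P = (\<lambda>vs. 0)" using rep Cons.prems by (simp add: P_def)
  have b: "ins w Q = (\<lambda>vs. 0)" using rep[OF Cons.prems(2)] by (simp add: Q_def ins_conj) (simp add: conj_form_def)
  have c: "ins w \<Psi> = (\<lambda>vs. \<i> * P vs)" by (rule ext) (simp add: w_def P_def hol_ins_i[OF Cons.prems(1)])
  have d: "ins w (conj_form \<Theta>) = (\<lambda>vs. (- \<i>) * Q vs)"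
    unfolding ins_conj by (rule ext) (simp add: w_def Q_def conj_form_def hol_ins_i[OF Cons.prems(2)])
  have tP: "twist P = (\<lambda>vs. (-1) ^ q * P vs)" using homog_twist[OF alt_homog[OF hol_alt[OF hP]]] .
  have t2: "twist (\<lambda>vs. \<i> * P vs) = (\<lambda>vs. \<i> * twist P vs)" by (rule ext) (simp add: twist_def)
  have "wedge \<Psi> (conj_form \<Theta>) (jlist (v # vs)) =
     wedge P (conj_form \<Theta>) (w # jlist vs) + wedge (twist \<Psi>) Q (w # jlist vs)"
    by (simp add: wedge_Cons[of \<Psi>] P_def Q_def w_def ins_conj)
  also have "\<dots> = (- 2 * \<i> * (-1) ^ q) * wedge P Q (jlist vs)"
    unfolding wedge_Cons a b c d ins_twist t2 tP
    by (simp add: wedge_scale_left wedge_scale_right wedge_minus_left wedge_minus_right)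
  finally have "sigma p * wedge \<Psi> (conj_form \<Theta>) (jlist (v # vs)) =
     (sigma p * (- 2 * \<i> * (-1) ^ q)) * wedge P Q (jlist vs)" by simp
  also have "sigma p * (- 2 * \<i> * (-1) ^ q) = sigma q * ((-1) ^ q * (-1) ^ q)"
    by (simp add: p sigma_Suc)
  also have "\<dots> = sigma q" by (simp flip: power_add mult_2)
  also have "sigma q * wedge P Q (jlist vs) = P vs * cnj (ins v \<Theta> vs)"
    unfolding Q_def using Cons.IH[OF hP hQ p(2)] .
  finally show ?case by (simp add: P_def ins_def)
qed


section \<open>Transversality on complex subspaces\<close>

lemma ins_wedge_list_kill:
  "(\<And>f. f \<in> set fs \<Longrightarrow> f v = 0) \<Longrightarrow> ins v (wedge_list fs) = (\<lambda>vs. 0)"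
proof (induction fs)
  case (Cons f fs)
  then show ?case by (intro ext) (simp add: ins_def[of v "wedge _ _"] wedge_one_form_Cons)
qed simp

lemma wedge_list_dual:
  assumes "length fs = length vs"
    and "\<And>i j. i < length fs \<Longrightarrow> j < length fs \<Longrightarrow> (fs ! i) (vs ! j) = (if i = j then 1 else 0)"
  shows "wedge_list fs vs = 1"
  using assms
proof (induction fs arbitrary: vs)
  case Nil
  then show ?case by (simp add: unit_form_def)
next
  case (Cons f fs)
  then obtain v us where vs: "vs = v # us" "length fs = length us" by (cases vs) auto
  have "f v = 1" using Cons.prems(2)[of 0 0] vs by simp
  moreover have "g v = 0" if "g \<in> set fs" for g
  proof -
    obtain i where "i < length fs" "g = fs ! i" using \<open>g \<in> set fs\<close> by (auto simp: in_set_conv_nth)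
    then show ?thesis using Cons.prems(2)[of "Suc i" 0] vs by simp
  qed
  then have "ins v (wedge_list fs) = (\<lambda>vs. 0)" by (rule ins_wedge_list_kill)
  moreover have "wedge_list fs us = 1"
    by (rule Cons.IH[OF vs(2)]) (use Cons.prems(2)[of "Suc i" "Suc j" for i j] vs in simp)
  ultimately show ?case by (simp add: vs wedge_one_form_Cons)
qed

text \<open>Vectors that annihilate one factor can only be handed to the other. In the mirror
  version the twists of \<open>\<alpha>\<close> have to disappear, which is why even degree is asked
  for there.\<close>

lemma wedge_contract_left:
  "(\<And>v. v \<in> set vs \<Longrightarrow> ins v \<beta> = (\<lambda>vs. 0)) \<Longrightarrow>
    wedge \<alpha> \<beta> (vs @ ws) = wedge (\<lambda>us. \<alpha> (vs @ us)) \<beta> ws"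
proof (induction vs arbitrary: \<alpha>)
  case (Cons v vs)
  then show ?case by (simp add: wedge_Cons) (simp add: ins_def)
qed simp

lemma wedge_contract_right:
  "(\<And>v. v \<in> set vs \<Longrightarrow> ins v \<alpha> = (\<lambda>vs. 0)) \<Longrightarrow> twist \<alpha> = \<alpha> \<Longrightarrow>
    wedge \<alpha> \<beta> (vs @ ws) = wedge \<alpha> (\<lambda>us. \<beta> (vs @ us)) ws"
proof (induction vs arbitrary: \<beta>)
  case (Cons v vs)
  then show ?case by (simp add: wedge_Cons) (simp add: ins_def)
qed simp

lemma homog_contract: "homog (length vs) \<alpha> \<Longrightarrow> (\<lambda>us. \<alpha> (vs @ us)) = (\<lambda>us. \<alpha> vs * unit_form us)"
  by (rule ext) (auto simp: homog_def unit_form_def)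

lemma homog_even_twist: "homog (2 * k) \<alpha> \<Longrightarrow> twist \<alpha> = \<alpha>"
proof -
  assume "homog (2 * k) \<alpha>"
  then have "twist \<alpha> vs = \<alpha> vs" for vs
    by (cases "length vs = 2 * k") (auto simp: homog_def twist_def)
  then show ?thesis by (rule ext)
qed

lemma wedge_append_left:
  assumes "homog (length vs) \<alpha>" "\<And>v. v \<in> set vs \<Longrightarrow> ins v \<beta> = (\<lambda>vs. 0)"
  shows "wedge \<alpha> \<beta> (vs @ ws) = \<alpha> vs * \<beta> ws"
proof -
  have "wedge \<alpha> \<beta> (vs @ ws) = wedge (\<lambda>us. \<alpha> (vs @ us)) \<beta> ws"
    by (rule wedge_contract_left) (rule assms)
  then show ?thesis by (simp add: homog_contract[OF assms(1)] wedge_scale_left)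
qed

lemma wedge_append_right:
  assumes "homog (length vs) \<beta>" "homog (2 * k) \<alpha>" "\<And>v. v \<in> set vs \<Longrightarrow> ins v \<alpha> = (\<lambda>vs. 0)"
  shows "wedge \<alpha> \<beta> (vs @ ws) = \<beta> vs * \<alpha> ws"
proof -
  have "wedge \<alpha> \<beta> (vs @ ws) = wedge \<alpha> (\<lambda>us. \<beta> (vs @ us)) ws"
    by (rule wedge_contract_right) (use assms(3) homog_even_twist[OF assms(2)] in auto)
  then show ?thesis by (simp add: homog_contract[OF assms(1)] wedge_scale_right)
qed

section \<open>Forms of top degree\<close>

definition pos_number :: "complex \<Rightarrow> bool" where
  "pos_number z \<longleftrightarrow> (\<exists>c::real. c > 0 \<and> z = of_real c)"

abbreviation top_of :: "(nat \<Rightarrow> complex ^ 'm::finite \<Rightarrow> complex) \<Rightarrow> 'm form" where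
  "top_of \<phi> \<equiv> wedge_list (map \<phi> [0..<CARD('m)])"

lemma sorted_list_lessThan [simp]: "sorted_list_of_set {..<n :: nat} = [0..<n]"
  by (simp add: lessThan_atLeast0)

lemma frame_top_eval:
  fixes e :: "nat \<Rightarrow> complex^'m::finite"
  assumes "frame \<phi> e" shows "top_of \<phi> (map e [0..<CARD('m)]) = 1"
  by (rule wedge_list_dual) (simp_all add: frame_apply[OF assms])

lemma hol_wedge_list: "(\<And>f. f \<in> set fs \<Longrightarrow> covector f) \<Longrightarrow> hol (length fs) (wedge_list fs)"
  unfolding hol_def by (rule htype_wedge_list)

lemma hol_wedge_list_map: "(\<And>i. i < k \<Longrightarrow> covector (\<psi> i)) \<Longrightarrow> hol k (wedge_list (map \<psi> [0..<k]))"
proof -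
  assume "\<And>i. i < k \<Longrightarrow> covector (\<psi> i)"
  then have "hol (length (map \<psi> [0..<k])) (wedge_list (map \<psi> [0..<k]))"
    by (intro hol_wedge_list) auto
  then show ?thesis by simp
qed

lemma htype_hol_conj:
  assumes "hol p \<Psi>" "hol p \<Theta>" shows "htype (2 * p) 0 (wedge \<Psi> (conj_form \<Theta>))"
  using htype_wedge[OF _ htype_conj, of p "int p" \<Psi> p "int p" \<Theta>] assms by (simp add: hol_def mult_2)

lemma hol_top:
  fixes e :: "nat \<Rightarrow> complex^'m::finite"
  assumes fr: "frame \<phi> e" and h: "hol CARD('m) \<Psi>"
  shows "\<Psi> = (\<lambda>vs. \<Psi> (map e [0..<CARD('m)]) * top_of \<phi> vs)"
proof -
  obtain c where c: "\<Psi> = (\<lambda>vs. \<Sum>I\<in>multi_indices CARD('m) CARD('m). c I * wedge_index \<phi> I vs)"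
    using hol_expansion[OF fr h] .
  then have c': "\<Psi> = (\<lambda>vs. c {..<CARD('m)} * top_of \<phi> vs)"
    by (simp add: multi_indices_full wedge_index_def)
  then have "\<Psi> (map e [0..<CARD('m)]) = c {..<CARD('m)}"
    by (subst c') (simp add: frame_top_eval[OF fr])
  then show ?thesis by (metis c')
qed

lemma frame_top_nonzero:
  fixes e :: "nat \<Rightarrow> complex^'m::finite"
  assumes fr: "frame \<phi> e" and "dual_basis \<phi>'"
  shows "top_of \<phi>' (map e [0..<CARD('m)]) \<noteq> 0"
proof
  assume z: "top_of \<phi>' (map e [0..<CARD('m)]) = 0"
  obtain e' where fr': "frame \<phi>' e'" using dual_basis_imp_frame[OF assms(2)] .
  have "hol CARD('m) (top_of \<phi>')"
    by (rule hol_wedge_list_map) (rule frame_covector[OF fr'])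
  from hol_top[OF fr this] have "top_of \<phi>' = (\<lambda>vs. 0)" by (simp add: z)
  then show False using frame_top_eval[OF fr'] by simp
qed

text \<open>Top forms are a one-dimensional space, so a single value determines the coefficient; the
  normalised volume form has value 1 on the list \<open>jlist\<close> of the frame vectors.\<close>

lemma top_form_eq:
  fixes e :: "nat \<Rightarrow> complex^'m::finite"
  assumes fr: "frame \<phi> e" and h: "htype (2 * CARD('m)) 0 \<tau>"
  shows "\<tau> = (\<lambda>vs. \<tau> (jlist (map e [0..<CARD('m)])) *
     (sigma CARD('m) * wedge (top_of \<phi>) (conj_form (top_of \<phi>)) vs))"
proof -
  have hol: "hol CARD('m) (top_of \<phi>)"
    by (rule hol_wedge_list_map) (rule frame_covector[OF fr])
  have "pq_span \<phi> CARD('m) CARD('m) \<tau>" using htype_pq_span[OF fr] h by (simp add: mult_2)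
  then obtain c where "\<tau> = pq_expansion CARD('m) CARD('m) \<phi> c" by (auto simp: pq_span_def)
  then obtain d where d: "\<tau> = (\<lambda>vs. d * wedge (top_of \<phi>) (conj_form (top_of \<phi>)) vs)"
    by (auto simp: pq_expansion_def multi_indices_full wedge_index_def)
  have s: "sigma CARD('m) \<noteq> 0" by (simp add: sigma_def)
  have "sigma CARD('m) * \<tau> (jlist (map e [0..<CARD('m)])) = d"
    using hol_wedge_conj_jlist[OF hol hol, of "map e [0..<CARD('m)]"]
    by (subst d) (simp add: frame_top_eval[OF fr])
  then have "\<tau> vs = \<tau> (jlist (map e [0..<CARD('m)])) *
     (sigma CARD('m) * wedge (top_of \<phi>) (conj_form (top_of \<phi>)) vs)" for vs
    using fun_cong[OF d, of vs] by (simp add: mult.left_commute mult.assoc[symmetric])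
  then show ?thesis by blast
qed

text \<open>Any other basis multiplies the volume form by the squared modulus of a nonzero
  determinant. Hence one frame, chosen to suit the situation, decides strict positivity.\<close>

lemma strictly_positive_top_iff:
  fixes e :: "nat \<Rightarrow> complex^'m::finite"
  assumes fr: "frame \<phi> e" and h: "htype (2 * CARD('m)) 0 \<tau>"
  shows "strictly_positive_top_form \<tau> \<longleftrightarrow> pos_number (\<tau> (jlist (map e [0..<CARD('m)])))"
proof
  assume "pos_number (\<tau> (jlist (map e [0..<CARD('m)])))"
  then obtain c :: real where c: "c > 0" "\<tau> (jlist (map e [0..<CARD('m)])) = of_real c"
    by (auto simp: pos_number_def)
  show "strictly_positive_top_form \<tau>"
    unfolding strictly_positive_top_form_def
    using c frame_imp_dual_basis[OF fr] top_form_eq[OF fr h]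
    by (intro exI[of _ \<phi>] exI[of _ c]) simp
next
  assume "strictly_positive_top_form \<tau>"
  then obtain \<phi>' and c :: real where db: "dual_basis \<phi>'" and c: "c > 0"
    and t: "\<tau> = (\<lambda>vs. of_real c * (sigma CARD('m) * wedge (top_of \<phi>') (conj_form (top_of \<phi>')) vs))"
    unfolding strictly_positive_top_form_def by blast
  have hol: "hol CARD('m) (top_of \<phi>')"
    by (rule hol_wedge_list_map) (use db in \<open>simp add: dual_basis_def\<close>)
  define z where "z = top_of \<phi>' (map e [0..<CARD('m)])"
  have "z \<noteq> 0" unfolding z_def by (rule frame_top_nonzero[OF fr db])
  have "\<tau> (jlist (map e [0..<CARD('m)])) = of_real c * (z * cnj z)"
    using hol_wedge_conj_jlist[OF hol hol, of "map e [0..<CARD('m)]"] by (simp add: t z_def)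
  also have "\<dots> = of_real (c * (norm z)\<^sup>2)"
    by (simp add: complex_norm_square[symmetric])
  finally show "pos_number (\<tau> (jlist (map e [0..<CARD('m)])))"
    unfolding pos_number_def using c \<open>z \<noteq> 0\<close> by (intro exI[of _ "c * (norm z)\<^sup>2"]) simp
qed

abbreviation elem_pos :: "nat \<Rightarrow> (nat \<Rightarrow> complex ^ 'm::finite \<Rightarrow> complex) \<Rightarrow> 'm form" where
  "elem_pos k \<psi> \<equiv> (\<lambda>vs. sigma k * wedge (wedge_list (map \<psi> [0..<k])) (conj_form (wedge_list (map \<psi> [0..<k]))) vs)"

lemma htype_elem_pos: "(\<And>i. i < k \<Longrightarrow> covector (\<psi> i)) \<Longrightarrow> htype (2 * k) 0 (elem_pos k \<psi>)"
  by (intro htype_scale htype_hol_conj hol_wedge_list_map)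

text \<open>The test covectors vanish on \<open>ws\<close>, so all of \<open>jlist ws\<close> goes
  to \<open>\<Omega>\<close>, and \<open>jlist us\<close> is left for the square.\<close>

lemma wedge_elem_pos_eval:
  assumes h: "homog (2 * p) \<Omega>" and cov: "\<And>i. i < k \<Longrightarrow> covector (\<psi> i)"
    and len: "length ws = p" "length us = k"
    and ker: "\<And>i w. i < k \<Longrightarrow> w \<in> set ws \<Longrightarrow> \<psi> i w = 0"
  shows "wedge \<Omega> (elem_pos k \<psi>) (jlist (ws @ us)) =
     \<Omega> (jlist ws) * (wedge_list (map \<psi> [0..<k]) us * cnj (wedge_list (map \<psi> [0..<k]) us))"
proof -
  let ?W = "wedge_list (map \<psi> [0..<k])"
  have hol: "hol k ?W" by (rule hol_wedge_list_map[OF cov])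
  have "ins v (elem_pos k \<psi>) = (\<lambda>vs. 0)" if v: "v \<in> set (jlist ws)" for v
  proof -
    have "\<psi> i v = 0" if "i < k" for i
      using v that ker by (auto simp: set_jlist covector_scale[OF cov])
    then have z: "ins v ?W = (\<lambda>vs. 0)" by (intro ins_wedge_list_kill) auto
    then have "ins v (conj_form ?W) = (\<lambda>vs. 0)" unfolding ins_conj by (simp add: conj_form_def)
    then have "ins v (wedge ?W (conj_form ?W)) = (\<lambda>vs. 0)" using z by (simp add: ins_wedge)
    then show ?thesis by (simp add: ins_def fun_eq_iff)
  qed
  then have "wedge \<Omega> (elem_pos k \<psi>) (jlist ws @ jlist us) = \<Omega> (jlist ws) * elem_pos k \<psi> (jlist us)"
    by (intro wedge_append_left) (use h len in simp_all)
  then show ?thesis using hol_wedge_conj_jlist[OF hol hol len(2)] by (simp add: jlist_append)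
qed

text \<open>Complete \<open>ws\<close> to a frame. The covectors dual to the added vectors are
  independent, vanish on \<open>ws\<close> and form the identity matrix on the added vectors, so
  testing \<Omega> against them returns its value on \<open>jlist ws\<close>.\<close>

lemma transverse_imp_pos:
  fixes \<Omega> :: "'m::finite form"
  assumes tr: "transverse_form p \<Omega>" and ws: "distinct ws" "vec.independent (set ws)" "length ws = p"
  shows "pos_number (\<Omega> (jlist ws))"
proof -
  obtain \<phi> e where fr: "frame \<phi> e" and e: "\<And>i. i < length ws \<Longrightarrow> e i = ws ! i" and le: "length ws \<le> CARD('m)"
    using indep_list_frame[OF ws(1,2)] by blast
  define k where "k = CARD('m) - p"
  have n: "CARD('m) = p + k" using le ws by (simp add: k_def)
  define \<psi> where "\<psi> i = \<phi> (p + i)" for i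
  have cov: "covector (\<psi> i)" if "i < k" for i using frame_covector[OF fr, of "p + i"] that n by (simp add: \<psi>_def)
  have "lin_indep_family k \<psi>"
    unfolding lin_indep_family_def
  proof (intro allI impI)
    fix a j assume a: "\<forall>v. (\<Sum>i<k. a i * \<psi> i v) = 0" and j: "j < k"
    have "0 = (\<Sum>i<k. a i * \<psi> i (e (p + j)))" using a by simp
    also have "\<dots> = (\<Sum>i<k. if i = j then a i else 0)"
      by (rule sum.cong) (auto simp: \<psi>_def frame_apply[OF fr] j n)
    finally show "a j = 0" using j by simp
  qed
  then have sp: "strictly_positive_top_form (wedge \<Omega> (elem_pos k \<psi>))"
    using tr cov unfolding transverse_form_def k_def[symmetric] by blast
  have hO: "htype (2 * p) 0 \<Omega>" using tr by (simp add: transverse_form_def pq_form_iff mult_2)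
  have ht: "htype (2 * CARD('m)) 0 (wedge \<Omega> (elem_pos k \<psi>))"
    using htype_wedge[OF hO htype_elem_pos[OF cov]] by (simp add: n)
  define us where "us = map e [p..<p+k]"
  have dec: "map e [0..<CARD('m)] = ws @ us"
  proof -
    have "map e [0..<p] = ws" using e ws(3) by (intro nth_equalityI) auto
    then show ?thesis by (simp add: n us_def upt_add_eq_append[of 0 p k])
  qed
  have ker: "\<psi> i w = 0" if "i < k" "w \<in> set ws" for i w
  proof -
    obtain j where j: "j < p" "ws ! j = w" using \<open>w \<in> set ws\<close> ws(3) by (auto simp: in_set_conv_nth)
    then have "w = e j" using e ws(3) by simp
    moreover have "p + i < CARD('m)" "j < CARD('m)" "p + i \<noteq> j" using j(1) that(1) n by simp_all
    ultimately show ?thesis using frame_apply[OF fr, of "p + i" j] by (simp add: \<psi>_def)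
  qed
  have "wedge_list (map \<psi> [0..<k]) us = 1"
    by (rule wedge_list_dual) (auto simp: us_def \<psi>_def frame_apply[OF fr] n)
  then have "wedge \<Omega> (elem_pos k \<psi>) (jlist (ws @ us)) = \<Omega> (jlist ws)"
    using wedge_elem_pos_eval[OF alt_homog[OF htype_alt[OF hO]] cov ws(3) _ ker] by (simp add: us_def)
  then show ?thesis using strictly_positive_top_iff[OF fr ht] sp by (simp add: dec)
qed

lemma frame_basis:
  fixes e :: "nat \<Rightarrow> complex^'m::finite"
  assumes "frame \<phi> e"
  shows "vec.span (e ` {..<CARD('m)}) = UNIV" "vec.independent (e ` {..<CARD('m)})" "inj_on e {..<CARD('m)}"
proof -
  have "v \<in> vec.span (e ` {..<CARD('m)})" for v
    by (subst frame_expand[OF assms, symmetric]) (intro vec.span_sum vec.span_scale vec.span_base, auto)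
  then show sp: "vec.span (e ` {..<CARD('m)}) = UNIV" by blast
  show "vec.independent (e ` {..<CARD('m)})"
    by (rule vec.card_le_dim_spanning[of _ UNIV])
      (use sp vec_dim_card[where 'a=complex and 'n='m] card_image_le[of "{..<CARD('m)}" e] in \<open>auto simp del: vec.dim_UNIV\<close>)
  show "inj_on e {..<CARD('m)}"
  proof (rule inj_onI)
    fix i j assume ij: "i \<in> {..<CARD('m)}" "j \<in> {..<CARD('m)}" "e i = e j"
    then have "\<phi> i (e i) = \<phi> i (e j)" by simp
    then show "i = j" using ij frame_apply[OF assms, of i i] frame_apply[OF assms, of i j] by (auto split: if_splits)
  qed
qed

text \<open>The common kernel of a family of independent test covectors is a complex subspace of
  dimension p. One basis per subspace is enough, since a change of basis multiplies the value by a
  positive number; this freedom is used later to adapt the basis to a projection.\<close>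

lemma transverse_formI:
  fixes \<Omega> :: "'m::finite form"
  assumes re: "real_form \<Omega>" and h: "htype (2 * p) 0 \<Omega>" and p: "p \<le> CARD('m)"
    and pos: "\<And>V. vec.subspace V \<Longrightarrow> vec.dim V = p \<Longrightarrow>
      \<exists>ws. length ws = p \<and> set ws \<subseteq> V \<and> V \<subseteq> vec.span (set ws) \<and> pos_number (\<Omega> (jlist ws))"
  shows "transverse_form p \<Omega>"
proof -
  define k where "k = CARD('m) - p"
  have n: "CARD('m) = p + k" using p by (simp add: k_def)
  have "strictly_positive_top_form (wedge \<Omega> (elem_pos k \<psi>))"
    if cov: "\<And>i. i < k \<Longrightarrow> covector (\<psi> i)" and ind: "lin_indep_family k \<psi>" for \<psi> :: "nat \<Rightarrow> complex^'m \<Rightarrow> complex"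
  proof -
    obtain \<phi> e where fr: "frame \<phi> e" and phi: "\<And>i. i < k \<Longrightarrow> \<phi> i = \<psi> i"
      using indep_covectors_frame[OF cov ind] by blast
    define V where "V = {v. \<forall>i<k. \<psi> i v = 0}"
    have sub: "vec.subspace V"
      unfolding vec.subspace_def V_def
      by (auto simp: covector_zero[OF cov] covector_add[OF cov] covector_scale[OF cov])
    have "vec.dim V = p"
    proof (rule vec.dim_unique)
      show "e ` {k..<CARD('m)} \<subseteq> V"
        by (auto simp: V_def phi[symmetric] frame_apply[OF fr] n)
      show "V \<subseteq> vec.span (e ` {k..<CARD('m)})"
      proof
        fix v assume v: "v \<in> V"
        have "v = (\<Sum>i<CARD('m). \<phi> i v *s e i)" by (simp add: frame_expand[OF fr])
        also have "\<dots> = (\<Sum>i\<in>{k..<CARD('m)}. \<phi> i v *s e i)"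
          by (rule sum.mono_neutral_right) (use v phi in \<open>auto simp: V_def\<close>)
        also have "\<dots> \<in> vec.span (e ` {k..<CARD('m)})"
          by (intro vec.span_sum vec.span_scale vec.span_base) auto
        finally show "v \<in> vec.span (e ` {k..<CARD('m)})" .
      qed
      show "vec.independent (e ` {k..<CARD('m)})"
        by (rule vec.independent_mono[OF frame_basis(2)[OF fr]]) auto
      show "card (e ` {k..<CARD('m)}) = p"
        by (subst card_image) (auto intro: inj_on_subset[OF frame_basis(3)[OF fr]] simp: n)
    qed
    then obtain ws where ws: "length ws = p" "set ws \<subseteq> V" "V \<subseteq> vec.span (set ws)" "pos_number (\<Omega> (jlist ws))"
      using pos[OF sub] by blast
    \<comment> \<open>These vectors are dual to the test covectors and complete \<open>ws\<close> to
      a basis of the whole space.\<close>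
    define us where "us = map e [0..<k]"
    have len: "length (ws @ us) = CARD('m)" by (simp add: us_def ws n)
    have "v \<in> vec.span (set (ws @ us))" for v
    proof -
      define w where "w = (\<Sum>i<k. \<phi> i v *s e i)"
      have "w \<in> vec.span (set (ws @ us))"
        unfolding w_def by (intro vec.span_sum vec.span_scale vec.span_base) (auto simp: us_def)
      moreover have "v - w \<in> V"
      proof -
        have "\<psi> j (v - w) = 0" if j: "j < k" for j
        proof -
          have "\<psi> j w = (\<Sum>i<k. if i = j then \<phi> i v else 0)"
            unfolding w_def covector_sum[OF cov[OF j]]
            by (rule sum.cong) (use j in \<open>auto simp: covector_scale[OF frame_covector[OF fr]] phi[symmetric] frame_apply[OF fr] n\<close>)
          then show ?thesis using j by (simp add: covector_diff[OF cov[OF j]] phi)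
        qed
        then show ?thesis by (simp add: V_def)
      qed
      then have "v - w \<in> vec.span (set (ws @ us))"
        using ws(3) vec.span_mono[of "set ws" "set (ws @ us)"] by auto
      ultimately have "(v - w) + w \<in> vec.span (set (ws @ us))" by (rule vec.span_add[rotated])
      then show ?thesis by simp
    qed
    then obtain \<phi>' where fr': "frame \<phi>' (\<lambda>i. (ws @ us) ! i)"
      using frame_of_spanning_list[OF len] by blast
    have ht: "htype (2 * CARD('m)) 0 (wedge \<Omega> (elem_pos k \<psi>))"
      using htype_wedge[OF h htype_elem_pos[OF cov]] by (simp add: n)
    have "wedge_list (map \<psi> [0..<k]) us = 1"
      by (rule wedge_list_dual) (auto simp: us_def phi[symmetric] frame_apply[OF fr] n)
    moreover have ker: "\<psi> i w = 0" if "i < k" "w \<in> set ws" for i w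
      using that ws(2) by (auto simp: V_def)
    ultimately have "wedge \<Omega> (elem_pos k \<psi>) (jlist (ws @ us)) = \<Omega> (jlist ws)"
      using wedge_elem_pos_eval[OF alt_homog[OF htype_alt[OF h]] cov ws(1) _ ker] by (simp add: us_def)
    moreover have "map ((!) (ws @ us)) [0..<CARD('m)] = ws @ us"
      using map_nth[of "ws @ us"] by (simp only: len)
    ultimately show ?thesis using strictly_positive_top_iff[OF fr' ht] ws(4) by simp
  qed
  then show ?thesis
    using re h unfolding transverse_form_def k_def[symmetric] by (simp add: pq_form_iff mult_2)
qed


section \<open>Positive semidefinite matrices and positive forms\<close>

lemma of_real_cmod_sq: "(complex_of_real (norm z))\<^sup>2 = z * cnj z"
  by (simp add: complex_norm_square[symmetric])

definition sesq :: "'i set \<Rightarrow> ('i \<Rightarrow> 'i \<Rightarrow> complex) \<Rightarrow> ('i \<Rightarrow> complex) \<Rightarrow> ('i \<Rightarrow> complex) \<Rightarrow> complex" where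
  "sesq S c x y = (\<Sum>I\<in>S. \<Sum>J\<in>S. cnj (x I) * c I J * y J)"

definition psd :: "'i set \<Rightarrow> ('i \<Rightarrow> 'i \<Rightarrow> complex) \<Rightarrow> bool" where
  "psd S c \<longleftrightarrow> hermitian_on S c \<and> (\<forall>x. 0 \<le> Re (sesq S c x x))"

lemma sesq_add_left: "sesq S c (\<lambda>i. x i + y i) z = sesq S c x z + sesq S c y z"
  by (simp add: sesq_def algebra_simps sum.distrib)

lemma sesq_add_right: "sesq S c z (\<lambda>i. x i + y i) = sesq S c z x + sesq S c z y"
  by (simp add: sesq_def algebra_simps sum.distrib)

lemma sesq_scale_left: "sesq S c (\<lambda>i. a * x i) z = cnj a * sesq S c x z"
  by (simp add: sesq_def algebra_simps sum_distrib_left)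

lemma sesq_scale_right: "sesq S c z (\<lambda>i. a * x i) = a * sesq S c z x"
  by (simp add: sesq_def algebra_simps sum_distrib_left)

lemma sesq_cong: "(\<And>i. i \<in> S \<Longrightarrow> x i = x' i) \<Longrightarrow> (\<And>i. i \<in> S \<Longrightarrow> y i = y' i) \<Longrightarrow> sesq S c x y = sesq S c x' y'"
  by (simp add: sesq_def cong: sum.cong)

lemma sesq_hermitian: "hermitian_on S c \<Longrightarrow> sesq S c y x = cnj (sesq S c x y)"
proof -
  assume h: "hermitian_on S c"
  have "sesq S c y x = (\<Sum>J\<in>S. \<Sum>I\<in>S. cnj (y I) * c I J * x J)"
    unfolding sesq_def by (rule sum.swap)
  also have "\<dots> = (\<Sum>J\<in>S. \<Sum>I\<in>S. cnj (cnj (x J) * c J I * y I))"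
  proof (intro sum.cong refl)
    fix I J assume "I \<in> S" "J \<in> S"
    then have "c I J = cnj (c J I)" using h unfolding hermitian_on_def by blast
    then show "cnj (y I) * c I J * x J = cnj (cnj (x J) * c J I * y I)"
      by (simp only: complex_cnj_mult complex_cnj_cnj) (simp only: mult.commute mult.left_commute)
  qed
  finally show ?thesis by (simp add: sesq_def)
qed

text \<open>Move from x to x - t b, where b is the image of x under the matrix. The form changes to
  first order by -2 t |b|^2, which cannot be negative for small t > 0 unless b = 0.\<close>

lemma psd_null:
  assumes "finite S" "psd S c" "Re (sesq S c x x) = 0" "I \<in> S"
  shows "(\<Sum>J\<in>S. c I J * x J) = 0"
proof -
  define b where "b I = (\<Sum>J\<in>S. c I J * x J)" for I
  define B where "B = (\<Sum>I\<in>S. (norm (b I))\<^sup>2)"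
  define K where "K = Re (sesq S c b b)"
  have bx: "sesq S c b x = of_real B"
    unfolding sesq_def B_def of_real_sum
    by (intro sum.cong refl)
      (simp add: b_def[symmetric] sum_distrib_left[symmetric] mult.assoc of_real_cmod_sq)
  have xb: "sesq S c x b = of_real B"
    using sesq_hermitian[of S c x b] assms(2) bx by (simp add: psd_def)
  have ineq: "0 \<le> - 2 * t * B + t\<^sup>2 * K" for t :: real
  proof -
    have "0 \<le> Re (sesq S c (\<lambda>i. x i + of_real (- t) * b i) (\<lambda>i. x i + of_real (- t) * b i))"
      using assms(2) unfolding psd_def by blast
    also have "\<dots> = - 2 * t * B + t\<^sup>2 * K"
      unfolding sesq_add_left sesq_add_right sesq_scale_left sesq_scale_right bx xb
      using assms(3) by (simp add: K_def power2_eq_square algebra_simps)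
    finally show ?thesis .
  qed
  have "B = 0"
  proof (rule ccontr)
    assume "B \<noteq> 0"
    then have B: "B > 0" unfolding B_def by (metis order_le_less sum_nonneg zero_le_power2)
    \<comment> \<open>Small enough that t K < B, so the quadratic term cannot compensate the linear
      one; the added 1 covers K = 0.\<close>
    define t where "t = B / (\<bar>K\<bar> + 1)"
    have t: "t > 0" using B by (simp add: t_def)
    have "t * K \<le> t * \<bar>K\<bar>" using t by (intro mult_left_mono) auto
    also have "\<dots> < t * (\<bar>K\<bar> + 1)" using t by simp
    also have "\<dots> = B" by (simp add: t_def)
    finally have "t * (t * K) < t * (2 * B)" using t B by (intro mult_strict_left_mono) auto
    then show False using ineq[of t] by (simp add: power2_eq_square algebra_simps)
  qed
  then have "\<forall>I\<in>S. (norm (b I))\<^sup>2 = 0"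
    unfolding B_def using sum_nonneg_eq_0_iff[OF assms(1), of "\<lambda>I. (norm (b I))\<^sup>2"] by simp
  then show ?thesis using assms(4) by (simp add: b_def)
qed

lemma sesq_min_exists:
  assumes fin: "finite S" and "S \<noteq> {}"
  obtains x where "(\<Sum>I\<in>S. (norm (x I))\<^sup>2) = 1"
    "\<And>y. (\<Sum>I\<in>S. (norm (y I))\<^sup>2) = 1 \<Longrightarrow> Re (sesq S c x x) \<le> Re (sesq S c y y)"
proof -
  \<comment> \<open>The index type may be infinite. Fixing the coordinates outside \<open>S\<close>
    to 0 makes this a product of compact sets, compact by Tychonoff; the unit sphere is then cut out
    by a closed condition.\<close>
  define K where "K = (PiE UNIV (\<lambda>i. if i \<in> S then cball 0 1 else {0 :: complex}))"
  define N where "N x = (\<Sum>I\<in>S. (norm (x I :: complex))\<^sup>2)" for x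
  have coord: "continuous_on A (\<lambda>x. x i)" for A and i :: 'a
    by (rule continuous_on_subset[OF continuous_on_product_coordinates]) simp
  have "compact K"
  proof -
    have "compactin (product_topology (\<lambda>i. euclidean) UNIV) K"
      unfolding K_def by (subst compactin_PiE) (auto simp: compactin_euclidean_iff)
    then show ?thesis by (simp add: euclidean_product_topology compactin_euclidean_iff)
  qed
  moreover have "closed {x. N x = 1}"
    unfolding N_def by (intro closed_Collect_eq continuous_intros coord)
  ultimately have comp: "compact (K \<inter> {x. N x = 1})" by (rule compact_Int_closed)
  obtain a where a: "a \<in> S" using assms by blast
  have "(\<lambda>i. if i = a then 1 else 0) \<in> K \<inter> {x. N x = 1}"
    using a fin by (auto simp: K_def N_def if_distrib[of "\<lambda>x. (norm x)\<^sup>2"] cong: if_cong)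
  then have ne: "K \<inter> {x. N x = 1} \<noteq> {}" by blast
  have cont: "continuous_on (K \<inter> {x. N x = 1}) (\<lambda>x. Re (sesq S c x x))"
    unfolding sesq_def by (intro continuous_intros coord)
  obtain x where x: "x \<in> K \<inter> {x. N x = 1}"
    and min: "\<And>y. y \<in> K \<inter> {x. N x = 1} \<Longrightarrow> Re (sesq S c x x) \<le> Re (sesq S c y y)"
    using continuous_attains_inf[OF comp ne cont] by blast
  have "Re (sesq S c x x) \<le> Re (sesq S c y y)" if y: "N y = 1" for y
  proof -
    define y' where "y' i = (if i \<in> S then y i else 0)" for i
    have "norm (y i) \<le> 1" if "i \<in> S" for i
    proof -
      have "(norm (y i))\<^sup>2 \<le> N y" unfolding N_def by (rule member_le_sum) (use that fin in auto)
      then show ?thesis using y by (simp add: power_le_one_iff)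
    qed
    moreover have "N y' = 1" using y by (simp add: N_def y'_def cong: sum.cong)
    ultimately have "y' \<in> K \<inter> {x. N x = 1}" by (auto simp: K_def y'_def)
    from min[OF this] show ?thesis using sesq_cong[of S y' y y' y c] by (simp add: y'_def)
  qed
  then show ?thesis using x that by (auto simp: N_def)
qed

text \<open>The minimum \<mu> of the Rayleigh quotient is attained at some unit vector x. Then
  \<open>c\<close> minus \<mu> times the identity is positive semidefinite with x as a null vector,
  so \<open>psd_null\<close> makes x an eigenvector and the hypothesis yields \<mu> \<ge> 0. Only
  the least eigenvalue is used.\<close>

lemma nonneg_eigenvalues_imp_psd:
  assumes fin: "finite S" and herm: "hermitian_on S c"
    and ev: "\<And>\<mu>. eigenvalue_on S c \<mu> \<Longrightarrow> 0 \<le> Re \<mu>"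
  shows "psd S c"
proof (cases "S = {}")
  case True
  then show ?thesis by (simp add: psd_def sesq_def hermitian_on_def)
next
  case False
  define N where "N x = (\<Sum>I\<in>S. (norm (x I :: complex))\<^sup>2)" for x
  obtain x where x: "N x = 1" and min: "\<And>y. N y = 1 \<Longrightarrow> Re (sesq S c x x) \<le> Re (sesq S c y y)"
    using sesq_min_exists[OF fin False, of c] unfolding N_def by blast
  define \<mu> where "\<mu> = Re (sesq S c x x)"
  have N0: "N y \<ge> 0" for y by (simp add: N_def sum_nonneg)
  have low: "\<mu> * N y \<le> Re (sesq S c y y)" for y
  proof (cases "N y = 0")
    case True
    then have "\<forall>I\<in>S. y I = 0" using sum_nonneg_eq_0_iff[OF fin, of "\<lambda>I. (norm (y I))\<^sup>2"] by (simp add: N_def)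
    then have "sesq S c y y = 0" by (simp add: sesq_def)
    then show ?thesis using True by simp
  next
    case False
    then have pos: "N y > 0" using N0[of y] by simp
    define r where "r = 1 / sqrt (N y)"
    have r2: "r\<^sup>2 = 1 / N y" using pos by (simp add: r_def power_divide)
    have "N (\<lambda>i. of_real r * y i) = r\<^sup>2 * N y"
      by (simp add: N_def norm_mult power_mult_distrib sum_distrib_left)
    then have "\<mu> \<le> Re (sesq S c (\<lambda>i. of_real r * y i) (\<lambda>i. of_real r * y i))"
      unfolding \<mu>_def using r2 pos by (intro min) simp
    also have "\<dots> = r\<^sup>2 * Re (sesq S c y y)"
      unfolding sesq_scale_left sesq_scale_right by (simp add: power2_eq_square)
    finally show ?thesis using r2 pos by (simp add: field_simps)
  qed
  \<comment> \<open>Shifting by the minimum turns the minimiser into a null vector.\<close>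
  define c' where "c' I J = c I J - (if I = J then of_real \<mu> else 0)" for I J
  have c'y: "(\<Sum>J\<in>S. c' I J * y J) = (\<Sum>J\<in>S. c I J * y J) - of_real \<mu> * y I" if "I \<in> S" for I y
  proof -
    have "(\<Sum>J\<in>S. c' I J * y J) = (\<Sum>J\<in>S. c I J * y J) - (\<Sum>J\<in>S. if I = J then of_real \<mu> * y J else 0)"
      unfolding sum_subtractf[symmetric] by (rule sum.cong) (auto simp: c'_def algebra_simps)
    then show ?thesis using fin that by simp
  qed
  have sesq': "sesq S c' y y = sesq S c y y - of_real (\<mu> * N y)" for y
  proof -
    have e: "sesq S d y y = (\<Sum>I\<in>S. cnj (y I) * (\<Sum>J\<in>S. d I J * y J))" for d
      by (simp add: sesq_def sum_distrib_left mult.assoc)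
    have "(\<Sum>I\<in>S. cnj (y I) * (of_real \<mu> * y I)) = of_real (\<mu> * N y)"
      unfolding N_def of_real_mult of_real_sum sum_distrib_left
      by (intro sum.cong refl) (simp add: of_real_cmod_sq mult.commute mult.left_commute)
    then show ?thesis unfolding e
      by (simp add: c'y right_diff_distrib sum_subtractf cong: sum.cong)
  qed
  have "psd S c'"
    unfolding psd_def
  proof (intro conjI allI)
    show "hermitian_on S c'"
      unfolding hermitian_on_def
    proof (intro ballI)
      fix I J assume "I \<in> S" "J \<in> S"
      then have "c J I = cnj (c I J)" using herm unfolding hermitian_on_def by blast
      then show "c' J I = cnj (c' I J)" by (simp only: c'_def) simp
    qed
    show "0 \<le> Re (sesq S c' y y)" for y using low[of y] by (simp add: sesq')
  qed
  moreover have "Re (sesq S c' x x) = 0" by (simp add: sesq' x \<mu>_def)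
  ultimately have "(\<Sum>J\<in>S. c' I J * x J) = 0" if "I \<in> S" for I
    using psd_null[OF fin] that by blast
  then have "(\<Sum>J\<in>S. c I J * x J) = of_real \<mu> * x I" if "I \<in> S" for I
    using c'y[OF that, of x] that by simp
  moreover have "\<exists>I\<in>S. x I \<noteq> 0" using x by (auto simp: N_def intro: ccontr)
  ultimately have "eigenvalue_on S c (of_real \<mu>)" unfolding eigenvalue_on_def by blast
  then have "0 \<le> \<mu>" using ev[of "of_real \<mu>"] by simp
  then have "0 \<le> Re (sesq S c y y)" for y
    using low[of y] N0[of y] by (meson mult_nonneg_nonneg order_trans)
  then show ?thesis using herm by (simp add: psd_def)
qed

text \<open>Cholesky decomposition: split off a rank one matrix at a pivot.\<close>

lemma psd_decomp:
  assumes "finite S" "psd S c"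
  shows "\<exists>N u. \<forall>I\<in>S. \<forall>J\<in>S. c I J = (\<Sum>j<(N::nat). u j I * cnj (u j J))"
  using assms
proof (induction S arbitrary: c rule: finite_induct)
  case empty
  then show ?case by simp
next
  case (insert a S c)
  have herm: "c J I = cnj (c I J)" if "I \<in> insert a S" "J \<in> insert a S" for I J
    using insert.prems that unfolding psd_def hermitian_on_def by blast
  have exp: "sesq (insert a S) c x x = sesq S c x x + cnj (x a) * (\<Sum>J\<in>S. c a J * x J)
     + cnj (\<Sum>J\<in>S. c a J * x J) * x a + cnj (x a) * c a a * x a" for x
  proof -
    have "(\<Sum>I\<in>S. cnj (x I) * c I a * x a) = cnj (\<Sum>J\<in>S. c a J * x J) * x a"
      unfolding cnj_sum sum_distrib_right
      by (intro sum.cong refl) (simp add: herm[of a])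
    then show ?thesis using insert.hyps
      by (simp add: sesq_def sum.distrib sum_distrib_left algebra_simps)
  qed
  define d where "d = Re (c a a)"
  have caa: "c a a = of_real d" using arg_cong[OF herm[of a a], of Im] by (simp add: d_def complex_eq_iff)
  define \<delta> where "\<delta> I = (if I = a then 1 else 0 :: complex)" for I
  have sd: "sesq (insert a S) c \<delta> \<delta> = of_real d"
  proof -
    have z: "\<delta> I = 0" if "I \<in> S" for I using insert.hyps that by (auto simp: \<delta>_def)
    show ?thesis unfolding exp by (simp add: sesq_def z caa cong: sum.cong) (simp add: \<delta>_def)
  qed
  then have d0: "d \<ge> 0" using insert.prems unfolding psd_def by (metis Re_complex_of_real)
  \<comment> \<open>The Schur complement of the pivot d. For d = 0 nothing has to be subtracted, as
    the next fact shows.\<close>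
  define c' where "c' I J = c I J - (if d = 0 then 0 else c I a * c a J / of_real d)" for I J
  \<comment> \<open>With zero pivot the indicator of \<open>a\<close> is a null vector, and
    \<open>psd_null\<close> clears its row and column.\<close>
  have row: "c I a = 0 \<and> c a I = 0" if "d = 0" "I \<in> insert a S" for I
  proof -
    have "(\<Sum>J\<in>insert a S. c I J * \<delta> J) = 0"
      by (rule psd_null[OF _ insert.prems _ that(2)]) (use insert.hyps sd that(1) in auto)
    moreover have "(\<Sum>J\<in>insert a S. c I J * \<delta> J) = c I a"
      using insert.hyps by (simp add: \<delta>_def if_distrib cong: if_cong)
    ultimately show ?thesis using herm[of I a] that(2) by simp
  qed
  have "psd S c'"
    unfolding psd_def
  proof (intro conjI allI)
    show "hermitian_on S c'"
      unfolding hermitian_on_def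
    proof (intro ballI)
      fix I J assume IJ: "I \<in> S" "J \<in> S"
      have "c J I = cnj (c I J)" "c J a = cnj (c a J)" "c a I = cnj (c I a)"
        using IJ by (auto intro: herm)
      then show "c' J I = cnj (c' I J)" by (simp only: c'_def) simp
    qed
    fix x
    define s where "s = (\<Sum>J\<in>S. c a J * x J)"
    \<comment> \<open>Completing the square: this value at \<open>a\<close> minimises the form in
      that coordinate and leaves exactly the Schur complement. For d = 0 the quotient is 0 by
      convention, which is harmless because the cross terms then vanish.\<close>
    define y where "y I = (if I = a then - s / of_real d else x I)" for I
    have y: "y I = x I" if "I \<in> S" for I using that insert.hyps by (auto simp: y_def)
    have sy: "(\<Sum>J\<in>S. c a J * y J) = s" by (simp add: s_def y cong: sum.cong)
    have qy: "sesq S c y y = sesq S c x x" by (rule sesq_cong) (simp_all add: y)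
    have c'x: "sesq S c' x x = sesq S c x x - (if d = 0 then 0 else cnj s * s / of_real d)"
    proof (cases "d = 0")
      case True
      then show ?thesis by (simp add: c'_def sesq_def)
    next
      case False
      have "cnj s = (\<Sum>I\<in>S. cnj (x I) * c I a)"
        unfolding s_def cnj_sum by (intro sum.cong refl) (simp add: herm[of a])
      then have "cnj s * s = (\<Sum>I\<in>S. \<Sum>J\<in>S. (cnj (x I) * c I a) * (c a J * x J))"
        unfolding s_def by (simp add: sum_product)
      then show ?thesis using False
        by (simp add: c'_def sesq_def algebra_simps sum_subtractf sum_divide_distrib)
    qed
    have "0 \<le> Re (sesq (insert a S) c y y)" using insert.prems unfolding psd_def by blast
    also have "sesq (insert a S) c y y = sesq S c' x x"
      unfolding exp sy qy c'x caa
      by (cases "d = 0") (simp_all add: y_def field_simps)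
    finally show "0 \<le> Re (sesq S c' x x)" .
  qed
  then obtain N :: nat and u where u: "\<And>I J. I \<in> S \<Longrightarrow> J \<in> S \<Longrightarrow> c' I J = (\<Sum>j<N. u j I * cnj (u j J))"
    using insert.IH by blast
  define w where "w j I = (if j < N then (if I = a then 0 else u j I)
     else if d = 0 then 0 else c I a / of_real (sqrt d))" for j I
  have wN: "w N I * cnj (w N J) = (if d = 0 then 0 else c I a * c a J / of_real d)"
    if "I \<in> insert a S" "J \<in> insert a S" for I J
  proof -
    have "complex_of_real (sqrt d) * complex_of_real (sqrt d) = of_real d"
      using d0 by (simp flip: of_real_mult)
    then show ?thesis using herm[of a J] herm[of J a] that by (simp add: w_def)
  qed
  have "c I J = (\<Sum>j<Suc N. w j I * cnj (w j J))" if IJ: "I \<in> insert a S" "J \<in> insert a S" for I J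
  proof (cases "I = a \<or> J = a")
    case True
    then have "(\<Sum>j<N. w j I * cnj (w j J)) = 0" by (intro sum.neutral) (auto simp: w_def)
    then show ?thesis using True IJ row by (auto simp: wN caa)
  next
    case False
    then have "(\<Sum>j<N. w j I * cnj (w j J)) = c' I J"
      using u[of I J] IJ by (simp add: w_def)
    then show ?thesis using IJ by (simp add: wN c'_def)
  qed
  then show ?case by blast
qed

text \<open>Positivity with the non-negative eigenvalues absorbed into the (p, 0)-forms. No basis
  and no matrix is mentioned, so sums, products and pullbacks are immediate to describe;
  \<open>positive_form\<close> is translated once in each direction.\<close>

definition pos_sum :: "nat \<Rightarrow> 'm::finite form \<Rightarrow> bool" where
  "pos_sum p \<Omega> \<longleftrightarrow> (\<exists>(N::nat) \<Psi>. (\<forall>j<N. hol p (\<Psi> j)) \<and>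
     \<Omega> = (\<lambda>vs. \<Sum>j<N. sigma p * wedge (\<Psi> j) (conj_form (\<Psi> j)) vs))"

lemma conj_form_sum: "conj_form (\<lambda>vs. \<Sum>I\<in>A. u I * f I vs) = (\<lambda>vs. \<Sum>I\<in>A. cnj (u I) * conj_form (f I) vs)"
  by (rule ext) (simp add: conj_form_def)

lemma wedge_conj_lincomb:
  "wedge (\<lambda>vs. \<Sum>I\<in>A. u I * f I vs) (conj_form (\<lambda>vs. \<Sum>J\<in>A. u J * f J vs)) vs =
    (\<Sum>I\<in>A. \<Sum>J\<in>A. u I * cnj (u J) * wedge (f I) (conj_form (f J)) vs)"
  by (simp add: conj_form_sum wedge_sum_left wedge_sum_right wedge_scale_left wedge_scale_right
      sum_distrib_left mult.assoc)

lemma pq_expansion_sum_rank_one: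
  fixes \<phi> :: "nat \<Rightarrow> complex ^ 'm::finite \<Rightarrow> complex" and p :: nat
  defines "\<Psi> \<equiv> \<lambda>u vs. \<Sum>I\<in>multi_indices CARD('m) p. u I * wedge_index \<phi> I vs"
  shows "pq_expansion p p \<phi> (\<lambda>I J. \<Sum>j\<in>A. u j I * cnj (u j J)) vs =
    (\<Sum>j\<in>A. wedge (\<Psi> (u j)) (conj_form (\<Psi> (u j))) vs)"
  unfolding pq_expansion_def \<Psi>_def wedge_conj_lincomb sum_distrib_right
  by (rule trans[OF sum.cong[OF refl sum.swap] sum.swap])

lemma positive_form_imp_pos_sum:
  fixes \<Omega> :: "'m::finite form"
  assumes "positive_form p \<Omega>" shows "pos_sum p \<Omega>"
proof -
  let ?M = "multi_indices CARD('m) p"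
  obtain \<phi> c where db: "dual_basis \<phi>" and O: "\<Omega> = (\<lambda>vs. sigma p * pq_expansion p p \<phi> c vs)"
    and herm: "hermitian_on ?M c" and ev: "\<And>\<mu>. eigenvalue_on ?M c \<mu> \<Longrightarrow> 0 \<le> Re \<mu>"
    using assms unfolding positive_form_def by blast
  have "psd ?M c" by (rule nonneg_eigenvalues_imp_psd[OF _ herm ev]) simp
  then obtain N :: nat and u where u: "\<And>I J. I \<in> ?M \<Longrightarrow> J \<in> ?M \<Longrightarrow> c I J = (\<Sum>j<N. u j I * cnj (u j J))"
    using psd_decomp[OF finite_multi_indices] by blast
  define \<Psi> where "\<Psi> j = (\<lambda>vs. \<Sum>I\<in>?M. u j I * wedge_index \<phi> I vs)" for j
  have "hol p (\<Psi> j)" for j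
    unfolding hol_def \<Psi>_def by (intro htype_sum htype_scale htype_wedge_index[OF db])
  moreover have "\<Omega> vs = (\<Sum>j<N. sigma p * wedge (\<Psi> j) (conj_form (\<Psi> j)) vs)" for vs
  proof -
    have "pq_expansion p p \<phi> c vs = pq_expansion p p \<phi> (\<lambda>I J. \<Sum>j<N. u j I * cnj (u j J)) vs"
      unfolding pq_expansion_def by (intro sum.cong refl) (simp add: u)
    also have "\<dots> = (\<Sum>j<N. wedge (\<Psi> j) (conj_form (\<Psi> j)) vs)"
      unfolding pq_expansion_sum_rank_one \<Psi>_def ..
    finally show ?thesis by (simp add: O sum_distrib_left)
  qed
  ultimately show ?thesis unfolding pos_sum_def by blast
qed

lemma pos_sum_imp_positive_form:
  fixes \<Omega> :: "'m::finite form"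
  assumes "pos_sum p \<Omega>" shows "positive_form p \<Omega>"
proof -
  let ?M = "multi_indices CARD('m) p"
  obtain N :: nat and \<Psi> where hol: "\<And>j. j < N \<Longrightarrow> hol p (\<Psi> j)"
    and O: "\<Omega> = (\<lambda>vs. \<Sum>j<N. sigma p * wedge (\<Psi> j) (conj_form (\<Psi> j)) vs)"
    using assms unfolding pos_sum_def by blast
  obtain \<phi> and e :: "nat \<Rightarrow> complex^'m" where fr: "frame \<phi> e" using frame_exists .
  have "\<exists>c. \<Psi> j = (\<lambda>vs. \<Sum>I\<in>?M. c I * wedge_index \<phi> I vs)" if "j < N" for j
    using hol_expansion[OF fr hol[OF that]] by metis
  then obtain u where u: "\<And>j. j < N \<Longrightarrow> \<Psi> j = (\<lambda>vs. \<Sum>I\<in>?M. u j I * wedge_index \<phi> I vs)"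
    by metis
  define c where "c I J = (\<Sum>j<N. u j I * cnj (u j J))" for I J
  have "\<Omega> vs = sigma p * pq_expansion p p \<phi> c vs" for vs
  proof -
    have "pq_expansion p p \<phi> c vs = (\<Sum>j<N. wedge (\<Psi> j) (conj_form (\<Psi> j)) vs)"
      unfolding c_def[abs_def] pq_expansion_sum_rank_one
      by (intro sum.cong refl) (simp add: u)
    then show ?thesis by (simp add: O sum_distrib_left)
  qed
  moreover have "hermitian_on ?M c"
    by (simp add: hermitian_on_def c_def mult.commute)
  moreover have "\<mu> \<in> \<real> \<and> 0 \<le> Re \<mu>" if ev: "eigenvalue_on ?M c \<mu>" for \<mu>
  proof -
    obtain x where x0: "\<exists>I\<in>?M. x I \<noteq> 0" and x: "\<And>I. I \<in> ?M \<Longrightarrow> (\<Sum>J\<in>?M. c I J * x J) = \<mu> * x I"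
      using ev unfolding eigenvalue_on_def by blast
    \<comment> \<open>For an eigenvector x the quadratic form equals both \<mu> |x|^2 and the sum of
      the |s j|^2, so \<mu> is the quotient K / B of non-negative numbers.\<close>
    define s where "s j = (\<Sum>J\<in>?M. cnj (u j J) * x J)" for j
    define B where "B = (\<Sum>I\<in>?M. (norm (x I))\<^sup>2)"
    define K where "K = (\<Sum>j<N. (norm (s j))\<^sup>2)"
    have "(\<Sum>I\<in>?M. cnj (x I) * (\<Sum>J\<in>?M. c I J * x J)) = \<mu> * of_real B"
      unfolding B_def of_real_sum sum_distrib_left[of \<mu>]
      by (intro sum.cong refl) (simp add: x of_real_cmod_sq)
    moreover have "(\<Sum>I\<in>?M. cnj (x I) * (\<Sum>J\<in>?M. c I J * x J)) = of_real K"
    proof -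
      have "(\<Sum>J\<in>?M. c I J * x J) = (\<Sum>j<N. u j I * s j)" for I
        unfolding c_def s_def sum_distrib_right sum_distrib_left
        by (subst sum.swap) (simp add: mult.assoc)
      then have "(\<Sum>I\<in>?M. cnj (x I) * (\<Sum>J\<in>?M. c I J * x J)) = (\<Sum>j<N. (\<Sum>I\<in>?M. cnj (x I) * u j I) * s j)"
        by (simp add: sum_distrib_left sum_distrib_right mult.assoc) (rule sum.swap)
      also have "\<dots> = (\<Sum>j<N. s j * cnj (s j))"
        by (intro sum.cong refl) (simp add: s_def mult.commute)
      finally show ?thesis by (simp add: K_def of_real_cmod_sq)
    qed
    ultimately have eq: "\<mu> * of_real B = of_real K" by simp
    obtain I where I: "I \<in> ?M" "x I \<noteq> 0" using x0 by blast
    have "(norm (x I))\<^sup>2 \<le> B" unfolding B_def by (rule member_le_sum) (use I in auto)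
    then have B: "B > 0" using I by (smt (verit) zero_less_norm_iff zero_less_power)
    have "\<mu> = of_real (K / B)" using eq B by (simp add: field_simps)
    moreover have "K \<ge> 0" by (simp add: K_def sum_nonneg)
    ultimately show ?thesis using B by simp
  qed
  ultimately show ?thesis
    unfolding positive_form_def using frame_imp_dual_basis[OF fr] by blast
qed


section \<open>Products of positive forms\<close>

abbreviation cxlin :: "(complex^'m::finite \<Rightarrow> complex^'n::finite) \<Rightarrow> bool" where
  "cxlin L \<equiv> Vector_Spaces.linear (*s) (*s) L"

lemma cxlin_iff: "cxlin L \<longleftrightarrow> (\<forall>u v. L (u + v) = L u + L v) \<and> (\<forall>c v. L (c *s v) = c *s L v)"
  unfolding Vector_Spaces.linear_iff by (simp add: vec.vector_space_axioms)

lemma cxlin_add: "cxlin L \<Longrightarrow> L (u + v) = L u + L v"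
  and cxlin_scale: "cxlin L \<Longrightarrow> L (c *s v) = c *s L v"
  by (simp_all add: cxlin_iff)

lemma scaleR_eq_smult: "r *\<^sub>R x = complex_of_real r *s x"
  by (simp add: vec_eq_iff) (simp add: scaleR_conv_of_real)

lemma cxlin_linear: "cxlin L \<Longrightarrow> linear L"
  by (intro linearI) (simp_all add: cxlin_iff scaleR_eq_smult)

lemma cxlin_zero: "cxlin L \<Longrightarrow> L 0 = 0"
  using linear_0 cxlin_linear by blast

lemma cxlin_diff: "cxlin L \<Longrightarrow> L (u - v) = L u - L v"
  using linear_diff cxlin_linear by blast

lemma htype_pullback_cxlin: "cxlin L \<Longrightarrow> htype k \<mu> \<omega> \<Longrightarrow> htype k \<mu> (\<lambda>vs. \<omega> (map L vs))"
  by (intro htype_pullback cxlin_linear) (simp_all add: cxlin_scale)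

lemma conj_form_map: "conj_form (\<lambda>vs. \<omega> (map L vs)) = (\<lambda>vs. conj_form \<omega> (map L vs))"
  by (simp add: conj_form_def)

lemma pos_sum_pullback:
  assumes L: "cxlin L" and "pos_sum p \<Omega>"
  shows "pos_sum p (\<lambda>vs. \<Omega> (map L vs))"
proof -
  obtain N :: nat and \<Psi> where hol: "\<And>j. j < N \<Longrightarrow> hol p (\<Psi> j)"
    and O: "\<Omega> = (\<lambda>vs. \<Sum>j<N. sigma p * wedge (\<Psi> j) (conj_form (\<Psi> j)) vs)"
    using assms unfolding pos_sum_def by blast
  show ?thesis
    unfolding pos_sum_def
    by (rule exI[of _ N], rule exI[of _ "\<lambda>j vs. \<Psi> j (map L vs)"])
      (use hol in \<open>simp add: hol_def htype_pullback_cxlin[OF L] O wedge_map conj_form_map\<close>)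
qed

lemma pos_sum_finite:
  assumes "finite A" "\<And>i. i \<in> A \<Longrightarrow> hol p (f i)"
  shows "pos_sum p (\<lambda>vs. \<Sum>i\<in>A. sigma p * wedge (f i) (conj_form (f i)) vs)"
proof -
  obtain h where h: "bij_betw h {..<card A} A"
    using ex_bij_betw_nat_finite[OF assms(1)] by (auto simp: atLeast0LessThan)
  have "(\<Sum>i\<in>A. sigma p * wedge (f i) (conj_form (f i)) vs) =
      (\<Sum>j<card A. sigma p * wedge (f (h j)) (conj_form (f (h j))) vs)" for vs
    using sum.reindex_bij_betw[OF h, of "\<lambda>i. sigma p * wedge (f i) (conj_form (f i)) vs"] by simp
  moreover have "hol p (f (h j))" if "j < card A" for j
    using h that assms(2) by (auto simp: bij_betw_def)
  ultimately show ?thesis unfolding pos_sum_def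
    by (intro exI[of _ "card A"] exI[of _ "\<lambda>j. f (h j)"]) auto
qed

text \<open>A product of two squares is the square of the product: moving conj \<Psi> past \<Xi>
  costs (-1)^(a b), and \<open>sigma_add\<close> returns the same sign. The double sum is then a sum
  of squares over pairs.\<close>

lemma pos_sum_wedge:
  assumes "pos_sum a A" "pos_sum b B"
  shows "pos_sum (a + b) (wedge A B)"
proof -
  obtain N :: nat and \<Psi> where hol: "\<And>j. j < N \<Longrightarrow> hol a (\<Psi> j)"
    and A: "A = (\<lambda>vs. \<Sum>j<N. sigma a * wedge (\<Psi> j) (conj_form (\<Psi> j)) vs)"
    using assms unfolding pos_sum_def by blast
  obtain M :: nat and \<Xi> where hol': "\<And>j. j < M \<Longrightarrow> hol b (\<Xi> j)"
    and B: "B = (\<lambda>vs. \<Sum>j<M. sigma b * wedge (\<Xi> j) (conj_form (\<Xi> j)) vs)"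
    using assms unfolding pos_sum_def by blast
  have sw: "sigma a * (sigma b * wedge (wedge (\<Psi> i) (conj_form (\<Psi> i))) (wedge (\<Xi> j) (conj_form (\<Xi> j))) vs) =
     sigma (a + b) * wedge (wedge (\<Psi> i) (\<Xi> j)) (conj_form (wedge (\<Psi> i) (\<Xi> j))) vs"
    if ij: "i < N" "j < M" for i j vs
  proof -
    have h1: "homog a (conj_form (\<Psi> i))" using hol[OF ij(1)] by (intro alt_homog alt_conj hol_alt)
    have h2: "homog b (\<Xi> j)" using hol'[OF ij(2)] by (intro alt_homog hol_alt)
    have comm: "wedge (conj_form (\<Psi> i)) (\<Xi> j) = (\<lambda>vs. (-1) ^ (a * b) * wedge (\<Xi> j) (conj_form (\<Psi> i)) vs)"
      by (rule ext) (rule wedge_commute[OF h1 h2])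
    have "wedge (wedge (\<Psi> i) (conj_form (\<Psi> i))) (wedge (\<Xi> j) (conj_form (\<Xi> j))) =
       wedge (\<Psi> i) (wedge (wedge (conj_form (\<Psi> i)) (\<Xi> j)) (conj_form (\<Xi> j)))"
      by (simp add: wedge_assoc)
    also have "\<dots> = (\<lambda>vs. (-1) ^ (a * b) * wedge (\<Psi> i) (wedge (wedge (\<Xi> j) (conj_form (\<Psi> i))) (conj_form (\<Xi> j))) vs)"
      unfolding comm by (rule ext) (simp only: wedge_scale_left[abs_def] wedge_scale_right)
    also have "wedge (\<Psi> i) (wedge (wedge (\<Xi> j) (conj_form (\<Psi> i))) (conj_form (\<Xi> j))) =
       wedge (wedge (\<Psi> i) (\<Xi> j)) (conj_form (wedge (\<Psi> i) (\<Xi> j)))"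
      by (simp add: wedge_assoc conj_form_wedge)
    finally show ?thesis by (simp add: sigma_add)
  qed
  have hh: "hol (a + b) (wedge (\<Psi> i) (\<Xi> j))" if "i < N" "j < M" for i j
    using htype_wedge[of a "int a" "\<Psi> i" b "int b" "\<Xi> j"] hol hol' that by (simp add: hol_def)
  have "wedge A B vs = (\<Sum>ij\<in>{..<N}\<times>{..<M}. sigma (a + b) *
      wedge (wedge (\<Psi> (fst ij)) (\<Xi> (snd ij))) (conj_form (wedge (\<Psi> (fst ij)) (\<Xi> (snd ij)))) vs)" for vs
  proof -
    have "wedge A B vs = (\<Sum>i<N. \<Sum>j<M. sigma (a + b) * wedge (wedge (\<Psi> i) (\<Xi> j)) (conj_form (wedge (\<Psi> i) (\<Xi> j))) vs)"
      unfolding A B wedge_sum_left wedge_sum_right wedge_scale_left wedge_scale_right sum_distrib_left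
      by (intro sum.cong refl) (simp add: sw)
    then show ?thesis by (simp add: sum.cartesian_product split_beta)
  qed
  then have "wedge A B = (\<lambda>vs. \<Sum>ij\<in>{..<N}\<times>{..<M}. sigma (a + b) *
      wedge (wedge (\<Psi> (fst ij)) (\<Xi> (snd ij))) (conj_form (wedge (\<Psi> (fst ij)) (\<Xi> (snd ij)))) vs)" by (rule ext)
  then show ?thesis using pos_sum_finite[of "{..<N}\<times>{..<M}" "a + b" "\<lambda>ij. wedge (\<Psi> (fst ij)) (\<Xi> (snd ij))"] hh by auto
qed

lemma pos_sum_sum:
  assumes "finite A" "\<And>i. i \<in> A \<Longrightarrow> pos_sum p (f i)"
  shows "pos_sum p (\<lambda>vs. \<Sum>i\<in>A. f i vs)"
proof -
  define Q where "Q i N \<Psi> \<longleftrightarrow> (\<forall>j<(N::nat). hol p (\<Psi> j)) \<and>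
     f i = (\<lambda>vs. \<Sum>j<N. sigma p * wedge (\<Psi> j) (conj_form (\<Psi> j)) vs)" for i N \<Psi>
  have "\<forall>i\<in>A. \<exists>N \<Psi>. Q i N \<Psi>"
    using assms(2) unfolding pos_sum_def Q_def by blast
  then obtain N \<Psi> where Q: "\<And>i. i \<in> A \<Longrightarrow> Q i (N i) (\<Psi> i)" by metis
  then have hol: "\<And>i j. i \<in> A \<Longrightarrow> j < N i \<Longrightarrow> hol p (\<Psi> i j)"
    and f: "\<And>i. i \<in> A \<Longrightarrow> f i = (\<lambda>vs. \<Sum>j<N i. sigma p * wedge (\<Psi> i j) (conj_form (\<Psi> i j)) vs)"
    unfolding Q_def by blast+
  have "(\<Sum>i\<in>A. f i vs) = (\<Sum>ij\<in>Sigma A (\<lambda>i. {..<N i}).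
      sigma p * wedge (\<Psi> (fst ij) (snd ij)) (conj_form (\<Psi> (fst ij) (snd ij))) vs)" for vs
    using assms(1) by (simp add: f sum.Sigma split_beta)
  then have "(\<lambda>vs. \<Sum>i\<in>A. f i vs) = (\<lambda>vs. \<Sum>ij\<in>Sigma A (\<lambda>i. {..<N i}).
      sigma p * wedge (\<Psi> (fst ij) (snd ij)) (conj_form (\<Psi> (fst ij) (snd ij))) vs)" by (rule ext)
  then show ?thesis
    using pos_sum_finite[of "Sigma A (\<lambda>i. {..<N i})" p "\<lambda>ij. \<Psi> (fst ij) (snd ij)"] hol assms(1) by auto
qed

lemma pos_sum_htype: "pos_sum p \<Omega> \<Longrightarrow> htype (2 * p) 0 \<Omega>"
  unfolding pos_sum_def by (auto intro!: htype_sum htype_scale htype_hol_conj)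

lemma real_form_iff: "real_form \<omega> \<longleftrightarrow> conj_form \<omega> = \<omega>"
  by (auto simp: real_form_def conj_form_def fun_eq_iff Reals_cnj_iff)

text \<open>Conjugation exchanges the two factors of a square, at the price of (-1)^(p p), and
  conjugates \<open>sigma p\<close>, which contributes the same sign.\<close>

lemma pos_sum_real:
  assumes "pos_sum p \<Omega>" shows "real_form \<Omega>"
proof -
  obtain N :: nat and \<Psi> where hol: "\<And>j. j < N \<Longrightarrow> hol p (\<Psi> j)"
    and O: "\<Omega> = (\<lambda>vs. \<Sum>j<N. sigma p * wedge (\<Psi> j) (conj_form (\<Psi> j)) vs)"
    using assms unfolding pos_sum_def by blast
  have "cnj (sigma p * wedge (\<Psi> j) (conj_form (\<Psi> j)) vs) = sigma p * wedge (\<Psi> j) (conj_form (\<Psi> j)) vs"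
    if j: "j < N" for j vs
  proof -
    have h: "homog p (\<Psi> j)" "homog p (conj_form (\<Psi> j))"
      using alt_homog[OF hol_alt[OF hol[OF j]]] alt_homog[OF alt_conj[OF hol_alt[OF hol[OF j]]]] by simp_all
    have "cnj (wedge (\<Psi> j) (conj_form (\<Psi> j)) vs) = conj_form (wedge (\<Psi> j) (conj_form (\<Psi> j))) vs"
      by (simp add: conj_form_def)
    also have "\<dots> = wedge (conj_form (\<Psi> j)) (\<Psi> j) vs"
      unfolding conj_form_wedge by (simp add: conj_form_def)
    also have "\<dots> = (-1) ^ (p * p) * wedge (\<Psi> j) (conj_form (\<Psi> j)) vs"
      by (rule wedge_commute[OF h(2,1)])
    finally have 1: "cnj (wedge (\<Psi> j) (conj_form (\<Psi> j)) vs) = (-1) ^ (p * p) * wedge (\<Psi> j) (conj_form (\<Psi> j)) vs" .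
    have "cnj (sigma p) = (-1) ^ (p * p) * sigma p"
    proof -
      have "cnj \<i> ^ (p * p) = (-1) ^ (p * p) * \<i> ^ (p * p)" by (simp flip: power_mult_distrib)
      then show ?thesis by (simp add: sigma_def power2_eq_square)
    qed
    then have "cnj (sigma p * wedge (\<Psi> j) (conj_form (\<Psi> j)) vs) =
        ((-1) ^ (p * p) * (-1) ^ (p * p)) * (sigma p * wedge (\<Psi> j) (conj_form (\<Psi> j)) vs)"
      by (simp add: 1)
    then show ?thesis by (simp flip: power_add mult_2)
  qed
  then show ?thesis unfolding real_form_iff by (simp add: O conj_form_def)
qed

lemma pos_sum_nonneg:
  assumes "pos_sum p \<Omega>" "length ws = p"
  shows "\<exists>c::real. 0 \<le> c \<and> \<Omega> (jlist ws) = of_real c"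
proof -
  obtain N :: nat and \<Psi> where hol: "\<And>j. j < N \<Longrightarrow> hol p (\<Psi> j)"
    and O: "\<Omega> = (\<lambda>vs. \<Sum>j<N. sigma p * wedge (\<Psi> j) (conj_form (\<Psi> j)) vs)"
    using assms unfolding pos_sum_def by blast
  have "\<Omega> (jlist ws) = (\<Sum>j<N. \<Psi> j ws * cnj (\<Psi> j ws))"
    unfolding O by (intro sum.cong refl hol_wedge_conj_jlist) (use hol assms in auto)
  also have "\<dots> = of_real (\<Sum>j<N. (norm (\<Psi> j ws))\<^sup>2)"
    by (simp add: of_real_cmod_sq)
  finally show ?thesis by (intro exI[of _ "\<Sum>j<N. (norm (\<Psi> j ws))\<^sup>2"]) (simp add: sum_nonneg)
qed

text \<open>Transverse and positive in the form in which both are used: a sum of squares with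
  positive values on independent lists. Volume forms, of degree p equal to the dimension, fit the
  same pattern.\<close>

definition strict_pos :: "nat \<Rightarrow> 'm::finite form \<Rightarrow> bool" where
  "strict_pos p \<Omega> \<longleftrightarrow> pos_sum p \<Omega> \<and>
     (\<forall>ws. length ws = p \<longrightarrow> distinct ws \<longrightarrow> vec.independent (set ws) \<longrightarrow> pos_number (\<Omega> (jlist ws)))"

lemma transverse_positive_imp_strict_pos:
  "transverse_form p \<Omega> \<Longrightarrow> positive_form p \<Omega> \<Longrightarrow> strict_pos p \<Omega>"
  unfolding strict_pos_def using positive_form_imp_pos_sum transverse_imp_pos by blast

section \<open>The two projections of a product of vector spaces\<close>

definition pr1 :: "complex^('m::finite + 'n::finite) \<Rightarrow> complex^'m" where
  "pr1 w = (\<chi> i. w $ Inl i)"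

definition pr2 :: "complex^('m::finite + 'n::finite) \<Rightarrow> complex^'n" where
  "pr2 w = (\<chi> i. w $ Inr i)"

lemma cxlin_pr1: "cxlin pr1" and cxlin_pr2: "cxlin pr2"
  by (simp_all add: cxlin_iff pr1_def pr2_def vec_eq_iff)

lemma pr_eqI: "pr1 u = pr1 v \<Longrightarrow> pr2 u = pr2 v \<Longrightarrow> u = v"
proof -
  assume a: "pr1 u = pr1 v" "pr2 u = pr2 v"
  have "u $ i = v $ i" for i
  proof (cases i)
    case (Inl j)
    then show ?thesis using arg_cong[OF a(1), of "\<lambda>x. x $ j"] by (simp add: pr1_def)
  next
    case (Inr j)
    then show ?thesis using arg_cong[OF a(2), of "\<lambda>x. x $ j"] by (simp add: pr2_def)
  qed
  then show ?thesis by (simp add: vec_eq_iff)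
qed

lemma covector_span_zero:
  assumes "covector f" "\<And>v. v \<in> S \<Longrightarrow> f v = 0" "x \<in> vec.span S"
  shows "f x = 0"
  using assms(3)
  by (induction rule: vec.span_induct_alt)
    (simp_all add: covector_zero covector_add covector_scale assms)

lemma indep_append_span_Int:
  fixes ks :: "(complex^'m::finite) list"
  assumes "distinct (ks @ rs)" "vec.independent (set (ks @ rs))"
    and x: "x \<in> vec.span (set ks)" "x \<in> vec.span (set rs)"
  shows "x = 0"
proof -
  obtain \<phi> e where fr: "frame \<phi> e" and e: "\<And>i. i < length (ks @ rs) \<Longrightarrow> e i = (ks @ rs) ! i"
    and le: "length (ks @ rs) \<le> CARD('m)"
    using indep_list_frame[OF assms(1,2)] by blast
  have "\<phi> i x = 0" if i: "i < CARD('m)" for i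
  proof (cases "i < length ks")
    case True
    have "\<phi> i v = 0" if v: "v \<in> set rs" for v
    proof -
      obtain j where j: "j < length rs" "rs ! j = v" using v by (auto simp: in_set_conv_nth)
      have "v = e (length ks + j)" using e[of "length ks + j"] j by simp
      moreover have "length ks + j < CARD('m)" "i \<noteq> length ks + j" using True j le by auto
      ultimately show ?thesis using frame_apply[OF fr i] by simp
    qed
    then show ?thesis using covector_span_zero[OF frame_covector[OF fr i] _ x(2)] by blast
  next
    case False
    have "\<phi> i v = 0" if v: "v \<in> set ks" for v
    proof -
      obtain j where j: "j < length ks" "ks ! j = v" using v by (auto simp: in_set_conv_nth)
      have "v = e j" using e[of j] j by (simp add: nth_append)
      moreover have "j < CARD('m)" "i \<noteq> j" using False j le by auto
      ultimately show ?thesis using frame_apply[OF fr i] by simp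
    qed
    then show ?thesis using covector_span_zero[OF frame_covector[OF fr i] _ x(1)] by blast
  qed
  then have "(\<Sum>i<CARD('m). \<phi> i x *s e i) = 0" by (intro sum.neutral) auto
  then show ?thesis using frame_expand[OF fr, of x] by simp
qed

lemma ins_pullback_kill:
  assumes "alt k \<alpha>" "L v = 0" shows "ins v (\<lambda>vs. \<alpha> (map L vs)) = (\<lambda>vs. 0)"
  using linear_0[OF alt_linear_head[OF assms(1)]] assms(2) by (simp add: ins_def)

text \<open>The vectors \<open>ks\<close> die under \<open>L\<close>, so they all go to
  \<open>B\<close>, whose degree they exhaust; \<open>rs\<close> is then left to \<open>A\<close>.
  Hence nothing is required of the images of \<open>rs\<close> under \<open>M\<close>.\<close>

lemma wedge_pullback_eval:
  assumes A: "htype (2 * a) 0 A" and B: "htype (2 * b) 0 B"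
    and L: "cxlin L" "cxlin M" and len: "length ks = b"
    and ker: "\<And>v. v \<in> set ks \<Longrightarrow> L v = 0"
  shows "wedge (\<lambda>vs. A (map L vs)) (\<lambda>vs. B (map M vs)) (jlist (ks @ rs)) =
     B (jlist (map M ks)) * A (jlist (map L rs))"
proof -
  have hA: "homog (2 * a) (\<lambda>vs. A (map L vs))" and hB: "homog (2 * b) (\<lambda>vs. B (map M vs))"
    using htype_pullback_cxlin[OF L(1) A] htype_pullback_cxlin[OF L(2) B] by (auto intro: alt_homog htype_alt)
  have "wedge (\<lambda>vs. A (map L vs)) (\<lambda>vs. B (map M vs)) (jlist ks @ jlist rs) =
     B (map M (jlist ks)) * A (map L (jlist rs))"
  proof (rule wedge_append_right[where k = a])
    show "homog (length (jlist ks)) (\<lambda>vs. B (map M vs))" using hB len by simp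
    show "homog (2 * a) (\<lambda>vs. A (map L vs))" by (rule hA)
    fix v assume "v \<in> set (jlist ks)"
    then have "L v = 0" using ker by (auto simp: set_jlist cxlin_scale[OF L(1)])
    then show "ins v (\<lambda>vs. A (map L vs)) = (\<lambda>vs. 0)" by (rule ins_pullback_kill[OF htype_alt[OF A]])
  qed
  then show ?thesis
    using L by (simp add: jlist_append map_jlist cxlin_scale)
qed

text \<open>
  For transversality on a subspace \<open>V\<close>, take a basis \<open>ks @ rs\<close> of \<open>V\<close> with \<open>ks\<close> a basis of the
  vertical part of \<open>V\<close>. The summand whose bidegrees match the lengths of \<open>rs\<close> and \<open>ks\<close> is
  strictly positive on it, and all the others are non-negative.
\<close>

lemma product_form_transverse:
  fixes A :: "nat \<Rightarrow> 'm::finite form" and B :: "nat \<Rightarrow> 'n::finite form"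
  assumes A: "\<And>b. b \<le> l \<Longrightarrow> strict_pos (CARD('m) - b) (A b)"
    and B: "\<And>b. b \<le> l \<Longrightarrow> strict_pos (CARD('n) - b) (B b)"
    and l: "l \<le> CARD('m)" "l \<le> CARD('n)"
  defines "\<Theta> \<equiv> (\<lambda>vs. \<Sum>b\<le>l. wedge (\<lambda>vs. A b (map pr1 vs)) (\<lambda>vs. B (l - b) (map pr2 vs)) vs)"
  shows "transverse_form (CARD('m) + CARD('n) - l) \<Theta>" "positive_form (CARD('m) + CARD('n) - l) \<Theta>"
proof -
  let ?s = "CARD('m) + CARD('n) - l"
  have term_pos: "pos_sum ?s (wedge (\<lambda>vs. A b (map pr1 vs)) (\<lambda>vs. B (l - b) (map pr2 vs)))" if b: "b \<le> l" for b
  proof -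
    have "pos_sum ((CARD('m) - b) + (CARD('n) - (l - b))) (wedge (\<lambda>vs. A b (map pr1 vs)) (\<lambda>vs. B (l - b) (map pr2 vs)))"
      using A[OF b] B[of "l - b"] unfolding strict_pos_def
      by (intro pos_sum_wedge pos_sum_pullback cxlin_pr1 cxlin_pr2) auto
    moreover have "(CARD('m) - b) + (CARD('n) - (l - b)) = ?s" using b l by simp
    ultimately show ?thesis by simp
  qed
  have pos: "pos_sum ?s \<Theta>" unfolding \<Theta>_def by (rule pos_sum_sum) (use term_pos in auto)
  then show "positive_form ?s \<Theta>" by (rule pos_sum_imp_positive_form)
  show "transverse_form ?s \<Theta>"
  proof (rule transverse_formI)
    show "real_form \<Theta>" by (rule pos_sum_real[OF pos])
    show "htype (2 * ?s) 0 \<Theta>" by (rule pos_sum_htype[OF pos])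
    show "?s \<le> CARD('m + 'n)" by simp
    fix V :: "(complex^('m+'n)) set" assume V: "vec.subspace V" "vec.dim V = ?s"
    define K where "K = {v \<in> V. pr1 v = 0}"
    have K: "vec.subspace K"
      using V(1) unfolding vec.subspace_def K_def
      by (auto simp: cxlin_zero[OF cxlin_pr1] cxlin_add[OF cxlin_pr1] cxlin_scale[OF cxlin_pr1])
    obtain ks where ks: "set ks \<subseteq> K" "K \<subseteq> vec.span (set ks)" "distinct ks" "vec.independent (set ks)"
      using indep_list_extend[of "[]" K] by (auto simp: vec.independent_empty)
    have "set ks \<subseteq> V" using ks(1) by (auto simp: K_def)
    then obtain rs where rs: "set rs \<subseteq> V" "V \<subseteq> vec.span (set (ks @ rs))" "distinct (ks @ rs)"
      "vec.independent (set (ks @ rs))"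
      using indep_list_extend[OF ks(3,4)] by blast
    have sub: "set (ks @ rs) \<subseteq> V" using rs(1) \<open>set ks \<subseteq> V\<close> by auto
    have "card (set (ks @ rs)) = ?s"
      using vec.basis_card_eq_dim[OF sub rs(2,4)] V(2) by simp
    then have len: "length ks + length rs = ?s" using distinct_card[OF rs(3)] by simp
    have spK: "vec.span (set ks) \<subseteq> K" by (rule vec.span_minimal[OF ks(1) K])
    have spR: "vec.span (set rs) \<subseteq> V" by (rule vec.span_minimal[OF rs(1) V(1)])
    \<comment> \<open>Vectors of \<open>K\<close> have zero first projection, so the second one
      determines them. On the complement spanned by \<open>rs\<close> the first projection is
      injective, because its kernel in \<open>V\<close> is \<open>K\<close>.\<close>
    have inj2: "inj_on pr2 (vec.span (set ks))"
    proof (rule inj_onI)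
      fix u v assume uv: "u \<in> vec.span (set ks)" "v \<in> vec.span (set ks)" "pr2 u = pr2 v"
      then have "u \<in> K" "v \<in> K" using spK by blast+
      then show "u = v" using uv(3) by (intro pr_eqI) (simp_all add: K_def)
    qed
    have inj1: "inj_on pr1 (vec.span (set rs))"
    proof (rule inj_onI)
      fix u v assume uv: "u \<in> vec.span (set rs)" "v \<in> vec.span (set rs)" "pr1 u = pr1 v"
      then have d: "u - v \<in> vec.span (set rs)" by (intro vec.span_diff)
      then have "u - v \<in> K" using spR uv(3) by (auto simp: K_def cxlin_diff[OF cxlin_pr1])
      then have "u - v \<in> vec.span (set ks)" using ks(2) by blast
      then have "u - v = 0" using indep_append_span_Int[OF rs(3,4)] d by blast
      then show "u = v" by simp
    qed
    have "vec.independent (set rs)" by (rule vec.independent_mono[OF rs(4)]) auto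
    then have ind1: "vec.independent (set (map pr1 rs))"
      using vec.linear_independent_injective_image[OF cxlin_pr1 _ inj1] by simp
    have ind2: "vec.independent (set (map pr2 ks))"
      using vec.linear_independent_injective_image[OF cxlin_pr2 ks(4) inj2] by simp
    have d1: "distinct (map pr1 rs)"
      using rs(3) inj_on_subset[OF inj1 vec.span_superset] by (simp add: distinct_map)
    have d2: "distinct (map pr2 ks)"
      using ks(3) inj_on_subset[OF inj2 vec.span_superset] by (simp add: distinct_map)
    have le1: "length rs \<le> CARD('m)" using indep_list_frame[OF d1 ind1] by (metis length_map)
    have le2: "length ks \<le> CARD('n)" using indep_list_frame[OF d2 ind2] by (metis length_map)
    \<comment> \<open>\<open>length rs\<close> is the dimension of the image of \<open>V\<close>
      under \<open>pr1\<close>, so b is its codimension; l - b is then the codimension of the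
      vertical part in the second factor.\<close>
    define b where "b = CARD('m) - length rs"
    have b: "b \<le> l" "length rs = CARD('m) - b" "length ks = CARD('n) - (l - b)"
      using le1 le2 len l by (auto simp: b_def)
    let ?t = "\<lambda>b. wedge (\<lambda>vs. A b (map pr1 vs)) (\<lambda>vs. B (l - b) (map pr2 vs)) (jlist (ks @ rs))"
    have "?t b = B (l - b) (jlist (map pr2 ks)) * A b (jlist (map pr1 rs))"
      by (rule wedge_pullback_eval[OF pos_sum_htype pos_sum_htype cxlin_pr1 cxlin_pr2 b(3)])
        (use A[OF b(1)] B[of "l - b"] ks(1) in \<open>auto simp: strict_pos_def K_def\<close>)
    moreover have "pos_number (A b (jlist (map pr1 rs)))"
      using A[OF b(1)] d1 ind1 b(2) unfolding strict_pos_def by (metis length_map)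
    moreover have "pos_number (B (l - b) (jlist (map pr2 ks)))"
      using B[of "l - b"] d2 ind2 b(3) unfolding strict_pos_def by (metis diff_le_self length_map)
    ultimately obtain r :: real where r: "r > 0" "?t b = of_real r"
      unfolding pos_number_def by (metis mult_pos_pos of_real_mult)
    have "\<exists>c::real. 0 \<le> c \<and> ?t b' = of_real c" if "b' \<le> l" for b'
      using pos_sum_nonneg[OF term_pos[OF that], of "ks @ rs"] len by simp
    then obtain c :: "nat \<Rightarrow> real" where c: "\<And>b'. b' \<le> l \<Longrightarrow> 0 \<le> c b' \<and> ?t b' = of_real (c b')" by metis
    have "\<Theta> (jlist (ks @ rs)) = of_real (\<Sum>b'\<le>l. c b')"
      unfolding \<Theta>_def of_real_sum by (intro sum.cong refl) (use c in auto)
    moreover have "(\<Sum>b'\<le>l. c b') > 0"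
    proof (rule sum_pos2[of _ b])
      show "0 < c b" using c[OF b(1)] r by simp
    qed (use b(1) c in auto)
    ultimately have "pos_number (\<Theta> (jlist (ks @ rs)))" unfolding pos_number_def by blast
    then show "\<exists>ws. length ws = ?s \<and> set ws \<subseteq> V \<and> V \<subseteq> vec.span (set ws) \<and> pos_number (\<Theta> (jlist ws))"
      using len sub rs(2) by (intro exI[of _ "ks @ rs"]) auto
  qed
qed

lemma volume_strict_pos:
  fixes \<phi> :: "nat \<Rightarrow> complex^'m::finite \<Rightarrow> complex" and g :: real
  assumes db: "dual_basis \<phi>" and g: "g > 0"
  shows "strict_pos CARD('m) (\<lambda>vs. of_real g * elem_pos CARD('m) \<phi> vs)"
proof -
  have hol: "hol CARD('m) (top_of \<phi>)"
    by (rule hol_wedge_list_map) (use db in \<open>simp add: dual_basis_def\<close>)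
  \<comment> \<open>The root of the positive factor goes into the (n, 0)-form, which exhibits the
    volume form as a single square.\<close>
  define \<Psi> where "\<Psi> = (\<lambda>vs. of_real (sqrt g) * top_of \<phi> vs)"
  have "complex_of_real (sqrt g) * complex_of_real (sqrt g) = of_real g"
    using g by (simp flip: of_real_mult)
  moreover have "conj_form \<Psi> = (\<lambda>vs. of_real (sqrt g) * conj_form (top_of \<phi>) vs)"
    by (simp add: \<Psi>_def conj_form_def)
  ultimately have eq: "(\<lambda>vs. of_real g * elem_pos CARD('m) \<phi> vs) =
      (\<lambda>vs. \<Sum>j<Suc 0. sigma CARD('m) * wedge \<Psi> (conj_form \<Psi>) vs)"
    by (auto simp: \<Psi>_def wedge_scale_left wedge_scale_right mult.assoc[symmetric] mult.commute mult.left_commute)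
  have "hol CARD('m) \<Psi>" using hol unfolding hol_def \<Psi>_def by (rule htype_scale)
  then have "pos_sum CARD('m) (\<lambda>vs. of_real g * elem_pos CARD('m) \<phi> vs)"
    unfolding pos_sum_def eq by (intro exI[of _ "Suc 0"] exI[of _ "\<lambda>_. \<Psi>"]) simp
  moreover have "pos_number (of_real g * elem_pos CARD('m) \<phi> (jlist ws))"
    if ws: "length ws = CARD('m)" "distinct ws" "vec.independent (set ws)" for ws
  proof -
    obtain \<eta> e where fr: "frame \<eta> e" and e: "\<And>i. i < length ws \<Longrightarrow> e i = ws ! i"
      using indep_list_frame[OF ws(2,3)] by blast
    have "map e [0..<CARD('m)] = ws" using e ws(1) by (intro nth_equalityI) auto
    then have nz: "top_of \<phi> ws \<noteq> 0" using frame_top_nonzero[OF fr db] by simp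
    have "of_real g * elem_pos CARD('m) \<phi> (jlist ws) = of_real (g * (norm (top_of \<phi> ws))\<^sup>2)"
      using hol_wedge_conj_jlist[OF hol hol ws(1)] by (simp add: of_real_cmod_sq)
    then show ?thesis
      unfolding pos_number_def using g nz by (intro exI[of _ "g * (norm (top_of \<phi> ws))\<^sup>2"]) simp
  qed
  ultimately show ?thesis by (simp add: strict_pos_def)
qed


section \<open>Smooth coefficients and derivatives of forms\<close>

lemma frechet_derivative_eq: "(f has_derivative D) (at x) \<Longrightarrow> frechet_derivative f (at x) = D"
  using frechet_derivative_at by metis

lemma has_derivative_cong_open:
  assumes "open S" "x \<in> S" "\<And>y. y \<in> S \<Longrightarrow> f y = g y"
  shows "(f has_derivative D) (at x) \<longleftrightarrow> (g has_derivative D) (at x)"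
  using has_derivative_transform_within_open[of f D x UNIV S g]
    has_derivative_transform_within_open[of g D x UNIV S f] assms by auto

lemma frechet_derivative_cong_open:
  assumes "open S" "x \<in> S" "\<And>y. y \<in> S \<Longrightarrow> f y = g y"
  shows "frechet_derivative f (at x) = frechet_derivative g (at x)"
  unfolding frechet_derivative_def using has_derivative_cong_open[OF assms] by simp

lemma differentiable_cong_open:
  assumes "open S" "x \<in> S" "\<And>y. y \<in> S \<Longrightarrow> f y = g y"
  shows "f differentiable (at x) \<longleftrightarrow> g differentiable (at x)"
  unfolding differentiable_def using has_derivative_cong_open[OF assms] by simp

lemma frechet_derivative_add:
  assumes "f differentiable (at x)" "g differentiable (at x)"
  shows "frechet_derivative (\<lambda>x. f x + g x) (at x) =
    (\<lambda>v. frechet_derivative f (at x) v + frechet_derivative g (at x) v)"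
  using assms by (intro frechet_derivative_eq has_derivative_add) (simp_all add: frechet_derivative_works[symmetric])

lemma frechet_derivative_mult:
  fixes f g :: "'a::real_normed_vector \<Rightarrow> complex"
  assumes "f differentiable (at x)" "g differentiable (at x)"
  shows "frechet_derivative (\<lambda>x. f x * g x) (at x) =
    (\<lambda>v. f x * frechet_derivative g (at x) v + frechet_derivative f (at x) v * g x)"
  using assms by (intro frechet_derivative_eq has_derivative_mult) (simp_all add: frechet_derivative_works[symmetric])

section \<open>Stability of smoothness under algebraic operations and composition\<close>

lemma C_k_on_cong:
  assumes "open S" "\<And>y. y \<in> S \<Longrightarrow> f y = g y"
  shows "C_k_on k f S \<longleftrightarrow> C_k_on k g S"
  using assms(2)
proof (induction k arbitrary: f g)
  case 0
  then show ?case by (auto cong: continuous_on_cong)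
next
  case (Suc k)
  have "C_k_on k (\<lambda>x. frechet_derivative f (at x) v) S \<longleftrightarrow> C_k_on k (\<lambda>x. frechet_derivative g (at x) v) S" for v
  proof (rule Suc.IH)
    fix y assume "y \<in> S"
    then show "frechet_derivative f (at y) v = frechet_derivative g (at y) v"
      using frechet_derivative_cong_open[OF assms(1) _ Suc.prems, of y] by simp
  qed
  moreover have "f differentiable (at x) \<longleftrightarrow> g differentiable (at x)" if "x \<in> S" for x
    by (rule differentiable_cong_open[OF assms(1) that Suc.prems])
  ultimately show ?case by auto
qed

lemma C_k_on_SucD: "C_k_on (Suc k) f S \<Longrightarrow> C_k_on k f S"
proof (induction k arbitrary: f)
  case 0
  then show ?case
    using continuous_at_imp_continuous_on[of S f] differentiable_imp_continuous_within[of f _ UNIV] by simp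
next
  case (Suc k)
  have "C_k_on k (\<lambda>x. frechet_derivative f (at x) v) S" for v
    using Suc.prems Suc.IH[of "\<lambda>x. frechet_derivative f (at x) v"] by (simp del: C_k_on.simps(2) add: C_k_on.simps(2)[of "Suc k" f])
  then show ?case using Suc.prems by simp
qed

lemma C_k_on_const: "open S \<Longrightarrow> C_k_on k (\<lambda>x. c) S"
proof (induction k arbitrary: c)
  case (Suc k)
  have "frechet_derivative (\<lambda>x. c) (at x) v = 0" for x v :: 'a
    by (simp add: frechet_derivative_eq[of _ "\<lambda>v. 0"])
  then show ?case using Suc by simp
qed simp

lemma C_k_on_add:
  assumes "open S" shows "C_k_on k f S \<Longrightarrow> C_k_on k g S \<Longrightarrow> C_k_on k (\<lambda>x. f x + g x) S"
proof (induction k arbitrary: f g)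
  case 0
  then show ?case by (simp add: continuous_on_add)
next
  case (Suc k)
  have "C_k_on k (\<lambda>x. frechet_derivative (\<lambda>x. f x + g x) (at x) v) S" for v
  proof (subst C_k_on_cong[OF assms])
    show "frechet_derivative (\<lambda>x. f x + g x) (at x) v =
       frechet_derivative f (at x) v + frechet_derivative g (at x) v" if "x \<in> S" for x
      using Suc.prems that by (simp add: frechet_derivative_add)
    show "C_k_on k (\<lambda>x. frechet_derivative f (at x) v + frechet_derivative g (at x) v) S"
      using Suc by simp
  qed
  then show ?case using Suc.prems by simp
qed

lemma C_k_on_mult:
  assumes "open S" shows "C_k_on k f S \<Longrightarrow> C_k_on k g S \<Longrightarrow> C_k_on k (\<lambda>x. f x * g x) S"
proof (induction k arbitrary: f g)
  case 0
  then show ?case by (simp add: continuous_on_mult)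
next
  case (Suc k)
  have "C_k_on k (\<lambda>x. frechet_derivative (\<lambda>x. f x * g x) (at x) v) S" for v
  proof (subst C_k_on_cong[OF assms])
    show "frechet_derivative (\<lambda>x. f x * g x) (at x) v =
       f x * frechet_derivative g (at x) v + frechet_derivative f (at x) v * g x" if "x \<in> S" for x
      using Suc.prems that by (simp add: frechet_derivative_mult)
    show "C_k_on k (\<lambda>x. f x * frechet_derivative g (at x) v + frechet_derivative f (at x) v * g x) S"
      using Suc C_k_on_SucD[OF Suc.prems(1)] C_k_on_SucD[OF Suc.prems(2)]
      by (intro C_k_on_add[OF assms] Suc.IH) simp_all
  qed
  then show ?case using Suc.prems by (simp add: differentiable_mult)
qed

lemma C_k_on_linear_compose:
  assumes "open S" "bounded_linear L"
  shows "L ` S \<subseteq> T \<Longrightarrow> C_k_on k f T \<Longrightarrow> C_k_on k (\<lambda>x. f (L x)) S"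
proof (induction k arbitrary: f)
  case 0
  then show ?case
    using continuous_on_compose2[of T f S L] linear_continuous_on[OF assms(2)] by simp
next
  case (Suc k)
  have der: "((\<lambda>x. f (L x)) has_derivative (\<lambda>v. frechet_derivative f (at (L x)) (L v))) (at x)" if "x \<in> S" for x
  proof -
    have "(f has_derivative frechet_derivative f (at (L x))) (at (L x))"
      using Suc.prems that by (intro frechet_derivative_works[THEN iffD1]) auto
    then show ?thesis
      by (rule has_derivative_compose[OF bounded_linear_imp_has_derivative[OF assms(2)]])
  qed
  have "C_k_on k (\<lambda>x. frechet_derivative (\<lambda>x. f (L x)) (at x) v) S" for v
  proof (subst C_k_on_cong[OF assms(1)])
    show "frechet_derivative (\<lambda>x. f (L x)) (at x) v = frechet_derivative f (at (L x)) (L v)" if "x \<in> S" for x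
      using frechet_derivative_eq[OF der[OF that]] by simp
    show "C_k_on k (\<lambda>x. frechet_derivative f (at (L x)) (L v)) S"
      using Suc.IH[of "\<lambda>y. frechet_derivative f (at y) (L v)"] Suc.prems by simp
  qed
  moreover have "(\<lambda>x. f (L x)) differentiable (at x)" if "x \<in> S" for x
    using der[OF that] by (rule differentiableI)
  ultimately show ?case by simp
qed

text \<open>Differentiation lowers the exponent by one, so the induction on \<open>k\<close> runs
  over all exponents at once. Away from the branch cut the power is holomorphic in its base.\<close>

lemma C_k_on_powr:
  assumes "open S"
  shows "C_k_on k f S \<Longrightarrow> (\<And>x. x \<in> S \<Longrightarrow> f x \<notin> \<real>\<^sub>\<le>\<^sub>0) \<Longrightarrow> C_k_on k (\<lambda>x. f x powr a) S"
proof (induction k arbitrary: f a)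
  case 0
  have nz: "f x \<noteq> 0" if "x \<in> S" for x using 0(2)[OF that] by auto
  have "continuous_on S (\<lambda>x. exp (a * Ln (f x)))"
    using 0 by (intro continuous_intros) auto
  then show ?case using nz by (simp add: powr_def cong: continuous_on_cong)
next
  case (Suc k)
  have der: "((\<lambda>x. f x powr a) has_derivative (\<lambda>v. a * f x powr (a - 1) * frechet_derivative f (at x) v)) (at x)"
    if "x \<in> S" for x
  proof -
    have 1: "(f has_derivative frechet_derivative f (at x)) (at x)"
      using Suc.prems that by (intro frechet_derivative_works[THEN iffD1]) auto
    have 2: "((\<lambda>z. z powr a) has_derivative (*) (a * f x powr (a - 1))) (at (f x))"
      using has_field_derivative_powr[OF Suc.prems(2)[OF that], of a] by (simp add: has_field_derivative_def)
    show ?thesis using has_derivative_compose[OF 1 2] by simp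
  qed
  have "C_k_on k (\<lambda>x. frechet_derivative (\<lambda>x. f x powr a) (at x) v) S" for v
  proof (subst C_k_on_cong[OF assms])
    show "frechet_derivative (\<lambda>x. f x powr a) (at x) v = a * f x powr (a - 1) * frechet_derivative f (at x) v" if "x \<in> S" for x
      using frechet_derivative_eq[OF der[OF that]] by simp
    show "C_k_on k (\<lambda>x. a * f x powr (a - 1) * frechet_derivative f (at x) v) S"
      using Suc.prems C_k_on_SucD[OF Suc.prems(1)]
      by (intro C_k_on_mult[OF assms] C_k_on_const[OF assms] Suc.IH) auto
  qed
  moreover have "(\<lambda>x. f x powr a) differentiable (at x)" if "x \<in> S" for x
    using der[OF that] by (rule differentiableI)
  ultimately show ?case by simp
qed

lemma C_infinity_on_const: "open S \<Longrightarrow> C_infinity_on (\<lambda>x. c) S"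
  by (simp add: C_infinity_on_def C_k_on_const)

lemma C_infinity_on_add: "open S \<Longrightarrow> C_infinity_on f S \<Longrightarrow> C_infinity_on g S \<Longrightarrow> C_infinity_on (\<lambda>x. f x + g x) S"
  by (simp add: C_infinity_on_def C_k_on_add)

lemma C_infinity_on_mult: "open S \<Longrightarrow> C_infinity_on f S \<Longrightarrow> C_infinity_on g S \<Longrightarrow> C_infinity_on (\<lambda>x. f x * g x) S"
  by (simp add: C_infinity_on_def C_k_on_mult)

lemma C_infinity_on_sum:
  "open S \<Longrightarrow> (\<And>i. i \<in> A \<Longrightarrow> C_infinity_on (f i) S) \<Longrightarrow> C_infinity_on (\<lambda>x. \<Sum>i\<in>A. f i x) S"
  by (induction A rule: infinite_finite_induct) (simp_all add: C_infinity_on_const C_infinity_on_add)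

lemma C_infinity_on_prod:
  "open S \<Longrightarrow> (\<And>i. i \<in> A \<Longrightarrow> C_infinity_on (f i) S) \<Longrightarrow> C_infinity_on (\<lambda>x. \<Prod>i\<in>A. f i x) S"
  by (induction A rule: infinite_finite_induct) (simp_all add: C_infinity_on_const C_infinity_on_mult)

lemma C_infinity_on_linear_compose:
  "open S \<Longrightarrow> bounded_linear L \<Longrightarrow> L ` S \<subseteq> T \<Longrightarrow> C_infinity_on f T \<Longrightarrow> C_infinity_on (\<lambda>x. f (L x)) S"
  unfolding C_infinity_on_def using C_k_on_linear_compose by blast

lemma C_infinity_on_powr:
  "open S \<Longrightarrow> C_infinity_on f S \<Longrightarrow> (\<And>x. x \<in> S \<Longrightarrow> f x \<notin> \<real>\<^sub>\<le>\<^sub>0) \<Longrightarrow> C_infinity_on (\<lambda>x. f x powr a) S"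
  by (simp add: C_infinity_on_def C_k_on_powr)

lemma C_infinity_on_differentiable: "C_infinity_on f S \<Longrightarrow> z \<in> S \<Longrightarrow> f differentiable (at z)"
  using C_k_on.simps(2)[of 0 f S] unfolding C_infinity_on_def by blast

lemma C_infinity_on_frechet: "C_infinity_on f S \<Longrightarrow> C_infinity_on (\<lambda>x. frechet_derivative f (at x) v) S"
  unfolding C_infinity_on_def using C_k_on.simps(2) by blast

lemma C_infinity_on_cnj:
  assumes "open S" "C_infinity_on f S" shows "C_infinity_on (\<lambda>x. cnj (f x)) S"
proof -
  have "C_k_on k f S \<Longrightarrow> C_k_on k (\<lambda>x. cnj (f x)) S" for k f
  proof (induction k arbitrary: f)
    case 0
    then show ?case by (simp add: continuous_on_cnj)
  next
    case (Suc k)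
    have der: "((\<lambda>x. cnj (f x)) has_derivative (\<lambda>v. cnj (frechet_derivative f (at x) v))) (at x)" if "x \<in> S" for x
      using Suc.prems that by (intro has_derivative_cnj frechet_derivative_works[THEN iffD1]) auto
    have "C_k_on k (\<lambda>x. frechet_derivative (\<lambda>x. cnj (f x)) (at x) v) S" for v
    proof (subst C_k_on_cong[OF assms(1)])
      show "frechet_derivative (\<lambda>x. cnj (f x)) (at x) v = cnj (frechet_derivative f (at x) v)" if "x \<in> S" for x
        using frechet_derivative_eq[OF der[OF that]] by simp
      show "C_k_on k (\<lambda>x. cnj (frechet_derivative f (at x) v)) S"
        using Suc by simp
    qed
    moreover have "(\<lambda>x. cnj (f x)) differentiable (at x)" if "x \<in> S" for x
      using der[OF that] by (rule differentiableI)
    ultimately show ?case by simp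
  qed
  then show ?thesis using assms(2) by (simp add: C_infinity_on_def)
qed

text \<open>The operators d, \<partial> and its conjugate are the cases (1, 0), (1/2, -\<i>/2) and
  (1/2, \<i>/2), so each rule of calculus is proved once for all three.\<close>

definition D_lin :: "complex \<Rightarrow> complex \<Rightarrow> (complex ^ 'm::finite \<Rightarrow> complex) \<Rightarrow> complex ^ 'm \<Rightarrow> complex ^ 'm \<Rightarrow> complex" where
  "D_lin a b f z v = a * frechet_derivative f (at z) v + b * frechet_derivative f (at z) (\<i> *s v)"

lemma D_full_eq: "D_full = D_lin 1 0"
  by (intro ext) (simp add: D_full_def D_lin_def)

lemma D_hol_eq: "D_hol = D_lin (1/2) (- \<i> / 2)"
  by (intro ext) (simp add: D_hol_def D_full_def D_lin_def field_simps)

lemma D_antihol_eq: "D_antihol = D_lin (1/2) (\<i> / 2)"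
  by (intro ext) (simp add: D_antihol_def D_full_def D_lin_def field_simps)

lemma D_lin_cong:
  "open S \<Longrightarrow> z \<in> S \<Longrightarrow> (\<And>y. y \<in> S \<Longrightarrow> f y = g y) \<Longrightarrow> D_lin a b f z v = D_lin a b g z v"
  unfolding D_lin_def using frechet_derivative_cong_open[of S z f g] by simp

lemma D_lin_const [simp]: "D_lin a b (\<lambda>y. c) z v = 0"
  by (simp add: D_lin_def frechet_derivative_eq[of "\<lambda>y. c" "\<lambda>v. 0"])

lemma D_lin_add:
  assumes "f differentiable (at z)" "g differentiable (at z)"
  shows "D_lin a b (\<lambda>y. f y + g y) z v = D_lin a b f z v + D_lin a b g z v"
  using assms by (simp add: D_lin_def frechet_derivative_add algebra_simps)

lemma D_lin_mult:
  assumes "f differentiable (at z)" "g differentiable (at z)"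
  shows "D_lin a b (\<lambda>y. f y * g y) z v = D_lin a b f z v * g z + f z * D_lin a b g z v"
  using assms by (simp add: D_lin_def frechet_derivative_mult algebra_simps)

lemma D_lin_cmult:
  assumes "f differentiable (at z)" shows "D_lin a b (\<lambda>y. c * f y) z v = c * D_lin a b f z v"
  using D_lin_mult[of "\<lambda>y. c" z f a b v] assms by simp

lemma D_lin_sum:
  assumes "\<And>i. i \<in> A \<Longrightarrow> f i differentiable (at z)"
  shows "D_lin a b (\<lambda>y. \<Sum>i\<in>A. f i y) z v = (\<Sum>i\<in>A. D_lin a b (f i) z v)"
  using assms
  by (induction A rule: infinite_finite_induct) (simp_all add: D_lin_add)

text \<open>Complex linearity carries the direction \<i> v to \<i> L v. A merely real linear map
  would mix \<partial> with its conjugate.\<close>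

lemma D_lin_compose:
  assumes L: "cxlin L" and f: "f differentiable (at (L w))"
  shows "D_lin a b (\<lambda>w. f (L w)) w v = D_lin a b f (L w) (L v)"
proof -
  have "bounded_linear L" using cxlin_linear[OF L] by (simp add: linear_conv_bounded_linear)
  then have "((\<lambda>w. f (L w)) has_derivative (\<lambda>v. frechet_derivative f (at (L w)) (L v))) (at w)"
    using has_derivative_compose[OF bounded_linear_imp_has_derivative[of L "at w"], of f "frechet_derivative f (at (L w))"]
      frechet_derivative_works[THEN iffD1, OF f] by simp
  then show ?thesis by (simp add: D_lin_def frechet_derivative_eq cxlin_scale[OF L])
qed

lemma C_infinity_on_D_lin:
  "open S \<Longrightarrow> C_infinity_on f S \<Longrightarrow> C_infinity_on (\<lambda>z. D_lin a b f z v) S"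
  unfolding D_lin_def
  by (intro C_infinity_on_add C_infinity_on_mult C_infinity_on_const C_infinity_on_frechet)

lemma linear_D_lin: "f differentiable (at z) \<Longrightarrow> linear (D_lin a b f z)"
proof -
  assume "f differentiable (at z)"
  then have "linear (frechet_derivative f (at z))" by (rule linear_frechet_derivative)
  moreover have "\<i> *s (u + v) = \<i> *s u + \<i> *s v" "\<i> *s (r *\<^sub>R v) = r *\<^sub>R (\<i> *s v)"
    for u v :: "complex^'a" and r
    by (simp_all add: vec_eq_iff algebra_simps)
  ultimately show ?thesis
    by (simp add: linear_iff D_lin_def algebra_simps)
qed

section \<open>Derivatives of fields of forms in one chart\<close>

definition chart_deriv ::
  "((complex ^ 'm::finite \<Rightarrow> complex) \<Rightarrow> complex ^ 'm \<Rightarrow> complex ^ 'm \<Rightarrow> complex) \<Rightarrow>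
     (complex ^ 'm \<Rightarrow> 'm form) \<Rightarrow> complex ^ 'm \<Rightarrow> 'm form" where
  "chart_deriv D \<alpha> z = (\<lambda>vs. \<Sum>i<length vs. (-1) ^ i * D (\<lambda>y. \<alpha> y (omit i vs)) z (vs ! i))"

lemma ext_derivative_eq_chart_deriv: "ext_derivative D \<omega> c z = chart_deriv D (\<omega> c) z"
  by (simp add: ext_derivative_def chart_deriv_def)

lemma chart_deriv_Nil [simp]: "chart_deriv D \<alpha> z [] = 0"
  by (simp add: chart_deriv_def)

text \<open>Cartan's formula for a constant vector field v: contracting the derivative gives the
  derivative along v minus the derivative of the contraction. It matches \<open>wedge_Cons\<close>
  and makes induction on the vectors possible.\<close>

lemma chart_deriv_Cons: "chart_deriv D \<alpha> z (v # vs) = D (\<lambda>y. \<alpha> y vs) z v - chart_deriv D (\<lambda>y. ins v (\<alpha> y)) z vs"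
  unfolding chart_deriv_def by (simp add: sum.lessThan_Suc_shift omit_def ins_def sum_negf del: sum.lessThan_Suc)

definition diff_field :: "(complex ^ 'm::finite \<Rightarrow> 'm form) \<Rightarrow> complex ^ 'm \<Rightarrow> bool" where
  "diff_field \<alpha> z \<longleftrightarrow> (\<forall>vs. (\<lambda>y. \<alpha> y vs) differentiable (at z))"

lemma diff_field_ins: "diff_field \<alpha> z \<Longrightarrow> diff_field (\<lambda>y. ins v (\<alpha> y)) z"
  by (simp add: diff_field_def ins_def)

lemma diff_field_twist: "diff_field \<alpha> z \<Longrightarrow> diff_field (\<lambda>y. twist (\<alpha> y)) z"
  by (simp add: diff_field_def twist_def)

lemma diff_field_wedge: "diff_field \<alpha> z \<Longrightarrow> diff_field \<beta> z \<Longrightarrow> diff_field (\<lambda>y. wedge (\<alpha> y) (\<beta> y)) z"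
  unfolding diff_field_def wedge_def
  by (intro allI differentiable_sum ballI differentiable_mult) (auto simp: finite_Pow_iff)

lemma chart_deriv_add:
  assumes "diff_field \<alpha> z" "diff_field \<beta> z"
  shows "chart_deriv (D_lin a b) (\<lambda>y vs. \<alpha> y vs + \<beta> y vs) z vs = chart_deriv (D_lin a b) \<alpha> z vs + chart_deriv (D_lin a b) \<beta> z vs"
  using assms by (simp add: chart_deriv_def diff_field_def D_lin_add algebra_simps sum.distrib)

lemma chart_deriv_sum:
  assumes "\<And>i. i \<in> A \<Longrightarrow> diff_field (f i) z"
  shows "chart_deriv (D_lin a b) (\<lambda>y vs. \<Sum>i\<in>A. f i y vs) z vs = (\<Sum>i\<in>A. chart_deriv (D_lin a b) (f i) z vs)"
  unfolding chart_deriv_def using assms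
  by (subst sum.swap) (simp add: diff_field_def D_lin_sum sum_distrib_left)

lemma chart_deriv_twist:
  assumes "diff_field \<alpha> z"
  shows "chart_deriv (D_lin a b) (\<lambda>y. twist (\<alpha> y)) z = (\<lambda>vs. - twist (chart_deriv (D_lin a b) \<alpha> z) vs)"
proof
  fix vs
  show "chart_deriv (D_lin a b) (\<lambda>y. twist (\<alpha> y)) z vs = - twist (chart_deriv (D_lin a b) \<alpha> z) vs"
    using assms unfolding chart_deriv_def twist_def sum_distrib_left sum_negf[symmetric]
  proof (intro sum.cong refl)
    fix i assume "i \<in> {..<length vs}"
    then have "Suc (length (omit i vs)) = length vs" by (simp add: omit_def)
    then show "(-1) ^ i * D_lin a b (\<lambda>y. (-1) ^ length (omit i vs) * \<alpha> y (omit i vs)) z (vs ! i) =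
        - ((-1) ^ length vs * ((-1) ^ i * D_lin a b (\<lambda>y. \<alpha> y (omit i vs)) z (vs ! i)))"
      using assms by (subst D_lin_cmult) (auto simp: diff_field_def simp flip: \<open>Suc (length (omit i vs)) = length vs\<close>)
  qed
qed

lemma D_lin_wedge:
  assumes "diff_field \<alpha> z" "diff_field \<beta> z"
  shows "D_lin a b (\<lambda>y. wedge (\<alpha> y) (\<beta> y) vs) z v =
     wedge (\<lambda>ws. D_lin a b (\<lambda>y. \<alpha> y ws) z v) (\<beta> z) vs + wedge (\<alpha> z) (\<lambda>ws. D_lin a b (\<lambda>y. \<beta> y ws) z v) vs"
proof -
  have d: "(\<lambda>y. \<alpha> y ws) differentiable (at z)" "(\<lambda>y. \<beta> y ws) differentiable (at z)" for ws
    using assms by (auto simp: diff_field_def)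
  have "D_lin a b (\<lambda>y. wedge (\<alpha> y) (\<beta> y) vs) z v =
     (\<Sum>S\<in>Pow {..<length vs}. D_lin a b (\<lambda>y. (-1) ^ card {(i, j). i \<in> S \<and> j \<in> {..<length vs} - S \<and> j < i}
        * \<alpha> y (nths vs S) * \<beta> y (nths vs (- S))) z v)"
    unfolding wedge_def by (rule D_lin_sum) (intro differentiable_mult d differentiable_const)
  also have "\<dots> = (\<Sum>S\<in>Pow {..<length vs}. (-1) ^ card {(i, j). i \<in> S \<and> j \<in> {..<length vs} - S \<and> j < i} *
       (D_lin a b (\<lambda>y. \<alpha> y (nths vs S)) z v * \<beta> z (nths vs (- S)) +
        \<alpha> z (nths vs S) * D_lin a b (\<lambda>y. \<beta> y (nths vs (- S))) z v))"
    by (intro sum.cong refl) (simp add: mult.assoc D_lin_cmult D_lin_mult d differentiable_mult)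
  finally show ?thesis
    by (simp add: wedge_def sum.distrib[symmetric] algebra_simps)
qed

lemma ins_chart_deriv: "ins v (chart_deriv D \<alpha> z) = (\<lambda>ws. D (\<lambda>y. \<alpha> y ws) z v + (-1) * chart_deriv D (\<lambda>y. ins v (\<alpha> y)) z ws)"
  by (rule ext) (simp add: ins_app chart_deriv_Cons)

text \<open>The Leibniz rule, with \<open>twist\<close> in place of the usual sign so that no
  degrees are fixed. In the induction step the derivative raises the degree by one, which is the
  minus sign of \<open>chart_deriv_twist\<close>.\<close>

lemma chart_deriv_wedge:
  assumes "diff_field \<alpha> z" "diff_field \<beta> z"
  shows "chart_deriv (D_lin a b) (\<lambda>y. wedge (\<alpha> y) (\<beta> y)) z vs =
     wedge (chart_deriv (D_lin a b) \<alpha> z) (\<beta> z) vs + wedge (twist (\<alpha> z)) (chart_deriv (D_lin a b) \<beta> z) vs"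
  using assms
proof (induction vs arbitrary: \<alpha> \<beta>)
  case Nil
  then show ?case by simp
next
  case (Cons v vs)
  let ?D = "D_lin a b"
  note d = Cons.prems
  note ia = diff_field_ins[OF d(1), of v] and ib = diff_field_ins[OF d(2), of v] and ta = diff_field_twist[OF d(1)]
  have tw: "twist (chart_deriv ?D \<alpha> z) = (\<lambda>vs. - chart_deriv ?D (\<lambda>y. twist (\<alpha> y)) z vs)"
    by (simp add: chart_deriv_twist[OF d(1)])
  have "chart_deriv ?D (\<lambda>y. wedge (\<alpha> y) (\<beta> y)) z (v # vs) =
      ?D (\<lambda>y. wedge (\<alpha> y) (\<beta> y) vs) z v -
      (chart_deriv ?D (\<lambda>y. wedge (ins v (\<alpha> y)) (\<beta> y)) z vs + chart_deriv ?D (\<lambda>y. wedge (twist (\<alpha> y)) (ins v (\<beta> y))) z vs)"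
    by (simp add: chart_deriv_Cons ins_wedge chart_deriv_add diff_field_wedge ia ib ta d)
  also have "\<dots> = wedge (chart_deriv ?D \<alpha> z) (\<beta> z) (v # vs) + wedge (twist (\<alpha> z)) (chart_deriv ?D \<beta> z) (v # vs)"
    unfolding D_lin_wedge[OF d] Cons.IH[OF ia d(2)] Cons.IH[OF ta ib] wedge_Cons ins_chart_deriv tw ins_twist
      wedge_add_left wedge_add_right wedge_scale_left wedge_scale_right wedge_minus_left twist_twist
    by simp
  finally show ?case .
qed

lemma chart_deriv_cong:
  assumes "open S" "z \<in> S" "\<And>y vs. y \<in> S \<Longrightarrow> \<alpha> y vs = \<beta> y vs"
  shows "chart_deriv (D_lin a b) \<alpha> z = chart_deriv (D_lin a b) \<beta> z"
  unfolding chart_deriv_def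
  by (intro ext sum.cong refl arg_cong2[where f = "(*)"]) (rule D_lin_cong[OF assms(1,2)], rule assms(3))

lemma chart_deriv_pullback:
  assumes L: "cxlin L" and d: "diff_field \<alpha> (L w)"
  shows "chart_deriv (D_lin a b) (\<lambda>w vs. \<alpha> (L w) (map L vs)) w vs = chart_deriv (D_lin a b) \<alpha> (L w) (map L vs)"
proof -
  have "map L (omit i vs) = omit i (map L vs)" for i
    by (simp add: omit_def take_map drop_map)
  moreover have "(\<lambda>y. \<alpha> y ws) differentiable (at (L w))" for ws using d by (simp add: diff_field_def)
  ultimately show ?thesis
    unfolding chart_deriv_def by (intro sum.cong) (auto simp: D_lin_compose[OF L, of "\<lambda>y. \<alpha> y ws" for ws])
qed

lemma chart_deriv_function_times_const:
  assumes "g differentiable (at z)"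
  shows "chart_deriv (D_lin a b) (\<lambda>y vs. g y * \<kappa> vs) z vs = wedge (one_form (D_lin a b g z)) \<kappa> vs"
proof (induction vs arbitrary: \<kappa>)
  case Nil
  then show ?case by (simp add: one_form_def)
next
  case (Cons v vs)
  have "D_lin a b (\<lambda>y. g y * \<kappa> vs) z v = D_lin a b g z v * \<kappa> vs"
    using D_lin_mult[of g z "\<lambda>y. \<kappa> vs"] assms by simp
  moreover have "(\<lambda>y. ins v (\<lambda>vs. g y * \<kappa> vs)) = (\<lambda>y vs. g y * ins v \<kappa> vs)"
    by (simp add: ins_def)
  ultimately show ?case by (simp add: chart_deriv_Cons wedge_one_form_Cons Cons.IH)
qed

text \<open>The differential of a function is only real linear, hence a combination of the \<phi> i
  and their conjugates. Each of these already occurs in the volume form.\<close>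

lemma one_form_wedge_volume:
  fixes e :: "nat \<Rightarrow> complex^'m::finite"
  assumes fr: "frame \<phi> e" and f: "linear f"
  shows "wedge (one_form f) (elem_pos CARD('m) \<phi>) = (\<lambda>vs. 0)"
proof -
  let ?F = "top_of \<phi>"
  have h: "homog CARD('m) ?F" using homog_wedge_list[of "map \<phi> [0..<CARD('m)]"] by simp
  have 1: "wedge (one_form (\<phi> i)) (wedge ?F (conj_form ?F)) = (\<lambda>vs. 0)" if i: "i < CARD('m)" for i
  proof -
    have "wedge (one_form (\<phi> i)) ?F = (\<lambda>vs. 0)" by (rule wedge_list_repeat) (use i in auto)
    then show ?thesis by (simp add: wedge_assoc[symmetric])
  qed
  have 2: "wedge (conj_form (one_form (\<phi> i))) (wedge ?F (conj_form ?F)) = (\<lambda>vs. 0)" if i: "i < CARD('m)" for i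
  proof -
    have z: "wedge (conj_form (one_form (\<phi> i))) (conj_form ?F) = (\<lambda>vs. 0)"
    proof -
      have "wedge (one_form (\<phi> i)) ?F = (\<lambda>vs. 0)" by (rule wedge_list_repeat) (use i in auto)
      then show ?thesis unfolding conj_form_wedge[symmetric] by (simp add: conj_form_def)
    qed
    have "wedge (conj_form (one_form (\<phi> i))) ?F = (\<lambda>vs. (-1) ^ (1 * CARD('m)) * wedge ?F (conj_form (one_form (\<phi> i))) vs)"
      unfolding conj_form_one_form by (rule ext) (rule wedge_commute[OF homog_one_form h])
    then show ?thesis
      by (simp add: wedge_assoc[symmetric] wedge_scale_left[abs_def]) (simp add: wedge_assoc z)
  qed
  have smult: "c *s u = Re c *\<^sub>R u + Im c *\<^sub>R (\<i> *s u)" for c and u :: "complex^'m"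
    by (simp add: vec_eq_iff complex_eq_iff)
  \<comment> \<open>The coefficients of the complex linear and the antilinear part of
    \<open>f\<close> on the frame vector \<open>e i\<close>.\<close>
  define c d where "c i = (f (e i) - \<i> * f (\<i> *s e i)) / 2"
    and "d i = (f (e i) + \<i> * f (\<i> *s e i)) / 2" for i
  have fv: "f v = (\<Sum>i<CARD('m). c i * \<phi> i v + d i * cnj (\<phi> i v))" for v
  proof -
    have "f v = f (\<Sum>i<CARD('m). \<phi> i v *s e i)" by (simp add: frame_expand[OF fr])
    also have "\<dots> = (\<Sum>i<CARD('m). Re (\<phi> i v) *\<^sub>R f (e i) + Im (\<phi> i v) *\<^sub>R f (\<i> *s e i))"
      by (subst smult) (simp add: linear_sum[OF f] linear_add[OF f] linear_scale[OF f])
    also have "\<dots> = (\<Sum>i<CARD('m). c i * \<phi> i v + d i * cnj (\<phi> i v))"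
      by (intro sum.cong refl, simp add: c_def d_def complex_eq_iff algebra_simps, simp add: field_simps)
    finally show ?thesis .
  qed
  have "one_form f = (\<lambda>vs. \<Sum>i<CARD('m). c i * one_form (\<phi> i) vs + d i * conj_form (one_form (\<phi> i)) vs)"
    by (intro ext) (auto simp: one_form_def conj_form_def fv)
  then show ?thesis
    by (intro ext) (simp add: wedge_sum_left wedge_add_left wedge_scale_left wedge_scale_right 1 2)
qed


section \<open>The volume form of a transverse form of codimension one\<close>

lemma openin_chart: "complex_manifold X \<Longrightarrow> c \<in> cm_atlas X \<Longrightarrow> openin (cm_top X) (fst c)"
  by (simp add: complex_manifold_def)

lemma open_chart_image: "complex_manifold X \<Longrightarrow> c \<in> cm_atlas X \<Longrightarrow> open (chart_image c)"
  by (simp add: complex_manifold_def)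

lemma chart_homeo:
  "complex_manifold X \<Longrightarrow> c \<in> cm_atlas X \<Longrightarrow>
    homeomorphic_map (subtopology (cm_top X) (fst c)) (top_of_set (chart_image c)) (snd c)"
  by (simp add: complex_manifold_def)

lemma topspace_chart: "complex_manifold X \<Longrightarrow> c \<in> cm_atlas X \<Longrightarrow> topspace (subtopology (cm_top X) (fst c)) = fst c"
  using openin_subset[OF openin_chart] by fastforce

lemma inj_on_chart: "complex_manifold X \<Longrightarrow> c \<in> cm_atlas X \<Longrightarrow> inj_on (snd c) (fst c)"
  using homeomorphic_imp_injective_map[OF chart_homeo] topspace_chart by metis

lemma transition_apply:
  "complex_manifold X \<Longrightarrow> c \<in> cm_atlas X \<Longrightarrow> x \<in> fst c \<Longrightarrow> transition c c' (snd c x) = snd c' x"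
  by (simp add: transition_def inv_into_f_f[OF inj_on_chart])

lemma transition_dom_in_chart: "z \<in> transition_dom c c' \<Longrightarrow> z \<in> chart_image c"
  by (auto simp: transition_dom_def chart_image_def)

lemma transition_in_chart:
  "complex_manifold X \<Longrightarrow> c \<in> cm_atlas X \<Longrightarrow> z \<in> transition_dom c c' \<Longrightarrow> transition c c' z \<in> chart_image c'"
  by (auto simp: transition_dom_def chart_image_def transition_apply)

lemma open_transition_dom:
  assumes "complex_manifold X" "c \<in> cm_atlas X" "c' \<in> cm_atlas X"
  shows "open (transition_dom c c')"
proof -
  have "openin (subtopology (cm_top X) (fst c)) (fst c \<inter> fst c')"
    unfolding openin_subtopology using openin_chart[OF assms(1,3)] by (intro exI[of _ "fst c'"]) auto
  then have "openin (top_of_set (chart_image c)) (snd c ` (fst c \<inter> fst c'))"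
    using homeomorphic_imp_open_map[OF chart_homeo[OF assms(1,2)]] by (simp add: open_map_def)
  then show ?thesis
    using open_chart_image[OF assms(1,2)] by (simp add: transition_dom_def openin_open_eq)
qed

lemma transition_derivative:
  assumes "complex_manifold X" "c \<in> cm_atlas X" "c' \<in> cm_atlas X" "z \<in> transition_dom c c'"
  shows "(transition c c' has_derivative frechet_derivative (transition c c') (at z)) (at z)"
    and "cxlin (frechet_derivative (transition c c') (at z))"
proof -
  obtain D where D: "(transition c c' has_derivative D) (at z)" "cxlin D"
    using assms unfolding complex_manifold_def holomorphic_map_on_def by blast
  then show "(transition c c' has_derivative frechet_derivative (transition c c') (at z)) (at z)"
    and "cxlin (frechet_derivative (transition c c') (at z))"
    by (simp_all add: frechet_derivative_eq[OF D(1)])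
qed

lemma smooth_form_alt: "smooth_form X k \<omega> \<Longrightarrow> c \<in> cm_atlas X \<Longrightarrow> z \<in> chart_image c \<Longrightarrow> alt k (\<omega> c z)"
  by (simp add: smooth_form_def everywhere_def alternating_iff)

lemma smooth_form_C_infinity: "smooth_form X k \<omega> \<Longrightarrow> c \<in> cm_atlas X \<Longrightarrow> C_infinity_on (\<lambda>z. \<omega> c z vs) (chart_image c)"
  by (simp add: smooth_form_def)

lemma smooth_form_diff: "smooth_form X k \<omega> \<Longrightarrow> c \<in> cm_atlas X \<Longrightarrow> z \<in> chart_image c \<Longrightarrow> diff_field (\<omega> c) z"
  unfolding diff_field_def using C_infinity_on_differentiable smooth_form_C_infinity by blast

lemma smooth_form_transition:
  "smooth_form X k \<omega> \<Longrightarrow> c \<in> cm_atlas X \<Longrightarrow> c' \<in> cm_atlas X \<Longrightarrow> z \<in> transition_dom c c' \<Longrightarrow>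
    \<omega> c z vs = \<omega> c' (transition c c' z) (map (frechet_derivative (transition c c') (at z)) vs)"
  unfolding smooth_form_def by blast

lemma C_infinity_on_wedge:
  assumes "open S" "\<And>vs. C_infinity_on (\<lambda>z. \<alpha> z vs) S" "\<And>vs. C_infinity_on (\<lambda>z. \<beta> z vs) S"
  shows "C_infinity_on (\<lambda>z. wedge (\<alpha> z) (\<beta> z) vs) S"
  unfolding wedge_def by (intro C_infinity_on_sum C_infinity_on_mult C_infinity_on_const assms)

text \<open>The coordinates are indexed by an unordered finite type, whereas multi-indices live in
  the naturals; one fixed enumeration connects the two.\<close>

definition std_index :: "nat \<Rightarrow> 'm::finite" where
  "std_index = (SOME h. bij_betw h {..<CARD('m)} (UNIV :: 'm set))"

lemma bij_std_index: "bij_betw std_index {..<CARD('m)} (UNIV :: 'm::finite set)"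
proof -
  obtain h where "bij_betw h {..<CARD('m)} (UNIV :: 'm set)"
    using ex_bij_betw_nat_finite[of "UNIV :: 'm set"] by (auto simp: atLeast0LessThan)
  then show ?thesis unfolding std_index_def by (rule someI[of "\<lambda>h. bij_betw h {..<CARD('m)} (UNIV :: 'm set)"])
qed

definition std_rank :: "'m::finite \<Rightarrow> nat" where
  "std_rank = the_inv_into {..<CARD('m)} std_index"

lemma std_rank_less: "std_rank (k :: 'm::finite) < CARD('m)"
  and std_index_rank: "std_index (std_rank k) = (k :: 'm::finite)"
  using bij_std_index[where 'm='m] unfolding std_rank_def bij_betw_def
  by (auto simp: f_the_inv_into_f the_inv_into_into[where B = "{..<CARD('m)}", simplified])

lemma std_rank_index: "i < CARD('m) \<Longrightarrow> std_rank (std_index i :: 'm::finite) = i"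
  using bij_std_index[where 'm='m] unfolding std_rank_def bij_betw_def by (simp add: the_inv_into_f_f)

lemma std_index_eq_iff:
  "i < CARD('m) \<Longrightarrow> j < CARD('m) \<Longrightarrow> (std_index i :: 'm::finite) = std_index j \<longleftrightarrow> i = j"
  using std_rank_index by metis

definition coord :: "nat \<Rightarrow> complex^'m::finite \<Rightarrow> complex" where
  "coord i v = v $ std_index i"

definition std_vec :: "nat \<Rightarrow> complex^'m::finite" where
  "std_vec i = axis (std_index i) 1"

abbreviation std_list :: "(complex^'m::finite) list" where
  "std_list \<equiv> map std_vec [0..<CARD('m)]"

lemma covector_coord: "covector (coord i)"
  by (simp add: covector_iff coord_def)

lemma frame_std: "frame coord (std_vec :: nat \<Rightarrow> complex^'m::finite)"
proof (rule frameI_inj)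
  show "covector (coord i :: complex^'m \<Rightarrow> _)" for i by (rule covector_coord)
  show "coord i (std_vec j :: complex^'m) = (if i = j then 1 else 0)" if "i < CARD('m)" "j < CARD('m)" for i j
    using that by (auto simp: coord_def std_vec_def axis_def std_index_eq_iff)
  fix v :: "complex^'m" assume v: "\<And>i. i < CARD('m) \<Longrightarrow> coord i v = 0"
  have "v $ k = 0" for k using v[OF std_rank_less[of k]] by (simp add: coord_def std_index_rank)
  then show "v = 0" by (simp add: vec_eq_iff)
qed

text \<open>Alternation brings any slot to the front, so complex linearity in the first slot gives
  it in all, and each slot contributes one \<i> to \<open>rot_deriv\<close>.\<close>

lemma hol_of_head_linear:
  assumes "alt k \<omega>" "\<And>v vs. \<omega> ((\<i> *s v) # vs) = \<i> * \<omega> (v # vs)"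
  shows "hol k \<omega>"
  unfolding hol_def htype_def
proof (intro conjI allI)
  show "alt k \<omega>" by (rule assms)
  show "rot_deriv vs \<omega> = \<i> * of_int (int k) * \<omega> vs" for vs
    using assms
  proof (induction vs arbitrary: k \<omega>)
    case Nil
    then show ?case by (cases k) simp_all
  next
    case (Cons v vs)
    show ?case
    proof (cases k)
      case 0
      then show ?thesis using Cons.prems alt_0_ins[of \<omega> v] by simp
    next
      case (Suc j)
      have "ins v \<omega> ((\<i> *s u) # ws) = \<i> * ins v \<omega> (u # ws)" for u ws
      proof -
        have "ins v \<omega> ((\<i> *s u) # ws) = - \<omega> ((\<i> *s u) # v # ws)"
          using alt_swap[OF Cons.prems(1), of v "\<i> *s u" ws] by (simp add: ins_def)
        also have "\<dots> = \<i> * - \<omega> (u # v # ws)" by (simp add: Cons.prems(2))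
        also have "- \<omega> (u # v # ws) = ins v \<omega> (u # ws)"
          using alt_swap[OF Cons.prems(1), of v u ws] by (simp add: ins_def)
        finally show ?thesis .
      qed
      moreover have "alt j (ins v \<omega>)" using Cons.prems(1) Suc by simp
      ultimately have "rot_deriv vs (ins v \<omega>) = \<i> * of_int (int j) * ins v \<omega> vs" by (intro Cons.IH)
      then show ?thesis by (simp add: Suc Cons.prems(2) ins_app algebra_simps)
    qed
  qed
qed

text \<open>The determinant is itself an (m, 0)-form. That space is one-dimensional, and both sides
  are 1 on the standard basis, so no expansion of the iterated wedge is needed.\<close>

lemma top_of_coord_eq_det:
  fixes vs :: "(complex^'m::finite) list"
  assumes "length vs = CARD('m)"
  shows "top_of coord vs = det (\<chi> i. vs ! std_rank i)"
proof -
  define \<delta> :: "'m form" where "\<delta> vs = (if length vs = CARD('m) then det (\<chi> i. vs ! std_rank i) else 0)" for vs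
  have upd: "(\<chi> r::'m. vs[i := v] ! std_rank r) = (\<chi> r. if r = std_index i then v else vs ! std_rank r)"
    if "length vs = CARD('m)" "i < CARD('m)" for vs :: "(complex^'m) list" and i v
  proof -
    have "vs[i := v] ! std_rank r = (if r = std_index i then v else vs ! std_rank r)" for r :: 'm
      using that std_rank_index[where 'm='m and i=i] std_index_rank[of r] by (auto simp: nth_list_update)
    then show ?thesis by simp
  qed
  have add: "\<delta> (vs[i := u + v]) = \<delta> (vs[i := u]) + \<delta> (vs[i := v])"
    and scale: "\<delta> (vs[i := a *s v]) = a * \<delta> (vs[i := v])"
    if "length vs = CARD('m)" "i < CARD('m)" for vs i u v a
    using that by (simp_all add: \<delta>_def upd det_row_add det_row_mul)
  have "alternating_form CARD('m) \<delta>"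
    unfolding alternating_form_def
  proof (intro conjI allI impI)
    fix vs :: "(complex^'m) list" and i assume "length vs = CARD('m)" "i < CARD('m)"
    then show "linear (\<lambda>v. \<delta> (vs[i := v]))"
      by (intro linearI) (simp_all add: add scale scaleR_eq_smult scaleR_conv_of_real)
  next
    fix vs :: "(complex^'m) list" and i j
    assume a: "length vs = CARD('m)" "i < j" "j < CARD('m)" "vs ! i = vs ! j"
    have "(std_index i :: 'm) \<noteq> std_index j" using a std_index_eq_iff[where 'm='m and i=i and j=j] by simp
    moreover have "row (std_index i) (\<chi> r. vs ! std_rank (r :: 'm)) = row (std_index j) (\<chi> r. vs ! std_rank (r :: 'm))"
      using a std_rank_index[where 'm='m and i=i] std_rank_index[where 'm='m and i=j] by (simp add: row_def vec_eq_iff)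
    ultimately show "\<delta> vs = 0" unfolding \<delta>_def using det_identical_rows by (simp add: a(1))
  qed (simp add: \<delta>_def)
  then have alt: "alt CARD('m) \<delta>" by (simp add: alternating_iff)
  have "hol CARD('m) \<delta>"
  proof (rule hol_of_head_linear[OF alt])
    fix v vs
    show "\<delta> ((\<i> *s v) # vs) = \<i> * \<delta> (v # vs)"
    proof (cases "Suc (length vs) = CARD('m)")
      case True
      then show ?thesis using scale[of "v # vs" 0 \<i> v] by simp
    qed (simp add: \<delta>_def)
  qed
  then have "\<delta> = (\<lambda>vs. \<delta> std_list * top_of coord vs)" by (rule hol_top[OF frame_std])
  moreover have "\<delta> std_list = 1"
  proof -
    have "(\<chi> i. std_list ! std_rank i) = (mat 1 :: complex^'m^'m)"
      by (simp add: vec_eq_iff std_rank_less std_vec_def std_index_rank mat_def axis_def)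
    then show ?thesis by (simp add: \<delta>_def)
  qed
  ultimately have "\<delta> vs = top_of coord vs" by (metis mult_1)
  then show ?thesis using assms by (simp add: \<delta>_def)
qed

lemma top_form_pullback:
  fixes A :: "complex^'m::finite \<Rightarrow> complex^'m"
  assumes A: "cxlin A" and \<tau>: "htype (2 * CARD('m)) 0 \<tau>"
  shows "\<tau> (jlist (map A std_list)) = \<tau> (jlist std_list) * (det (matrix A) * cnj (det (matrix A)))"
proof -
  have hol: "hol CARD('m) (top_of coord :: 'm form)" by (rule hol_wedge_list_map) (rule covector_coord)
  have "\<tau> (jlist (map A std_list)) = \<tau> (jlist std_list) * elem_pos CARD('m) coord (jlist (map A std_list))"
    by (subst top_form_eq[OF frame_std \<tau>]) simp
  moreover have "elem_pos CARD('m) coord (jlist (map A std_list)) =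
     top_of coord (map A std_list) * cnj (top_of coord (map A std_list))"
    by (rule hol_wedge_conj_jlist[OF hol hol]) simp
  moreover have "top_of coord (map A std_list) = det (matrix A)"
  proof -
    have "(\<chi> i. map A std_list ! std_rank i) = transpose (matrix A)"
      by (simp add: vec_eq_iff std_rank_less std_vec_def std_index_rank matrix_def transpose_def)
    then show ?thesis by (subst top_of_coord_eq_det) (simp_all add: det_transpose)
  qed
  ultimately show ?thesis by simp
qed

section \<open>The induced Hermitian matrix and its determinant\<close>

definition pair_form :: "'m::finite \<Rightarrow> 'm \<Rightarrow> 'm form" where
  "pair_form i j = (\<lambda>vs. sigma 1 * wedge (one_form (\<lambda>v. v $ i)) (conj_form (one_form (\<lambda>v. v $ j))) vs)"

text \<open>
  The Hermitian form on covectors induced by an \<open>(n - 1, n - 1)\<close>-form. A suitable root of its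
  determinant transforms like the coefficient of a volume form.
\<close>

definition codim1_matrix :: "'m::finite form \<Rightarrow> complex^'m^'m" where
  "codim1_matrix \<Omega> = (\<chi> i j. wedge \<Omega> (pair_form i j) (jlist std_list))"

lemma htype_pair_form: "htype 2 0 (pair_form i j)"
proof -
  have "htype (1 + 1) (1 + - 1) (wedge (one_form (\<lambda>v. v $ i)) (conj_form (one_form (\<lambda>v. v $ j))))"
    by (intro htype_wedge htype_conj htype_one_form covector_component)
  then have "htype 2 0 (wedge (one_form (\<lambda>v. v $ i)) (conj_form (one_form (\<lambda>v. v $ j))))"
    by (simp add: numeral_2_eq_2)
  then show ?thesis unfolding pair_form_def by (rule htype_scale)
qed

lemma one_form_lincomb:
  "one_form (\<lambda>v. \<Sum>k\<in>UNIV. a k * v $ k) = (\<lambda>vs. \<Sum>k\<in>UNIV. a k * one_form (\<lambda>v. v $ k) vs)"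
  by (rule ext) (simp add: one_form_def)

lemma pair_form_lincomb:
  "sigma 1 * wedge (one_form (\<lambda>v. \<Sum>k\<in>UNIV. a k * v $ k)) (conj_form (one_form (\<lambda>v. \<Sum>l\<in>UNIV. b l * v $ l))) vs =
    (\<Sum>k\<in>UNIV. \<Sum>l\<in>UNIV. a k * cnj (b l) * pair_form k l vs)"
  unfolding one_form_lincomb conj_form_sum pair_form_def
  by (simp add: wedge_sum_left wedge_sum_right wedge_scale_left wedge_scale_right sum_distrib_left algebra_simps)

lemma cxlin_component: "cxlin A \<Longrightarrow> A v $ i = (\<Sum>k\<in>UNIV. matrix A $ i $ k * v $ k)"
proof -
  assume "cxlin A"
  then have "A v $ i = (matrix A *v v) $ i" by (simp add: matrix_works)
  then show ?thesis by (simp add: matrix_vector_mult_def)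
qed

lemma one_form_map: "one_form f (map A vs) = one_form (\<lambda>v. f (A v)) vs"
  by (auto simp: one_form_def)

text \<open>The form \<Omega> \<and> \<open>pair_form i j\<close> is evaluated on the image of the
  standard basis in two ways. As a top form it picks up |det A|^2; after pulling back, the
  coordinate covectors become the rows of the matrix of A.\<close>

lemma codim1_matrix_pullback:
  fixes A :: "complex^'m::finite \<Rightarrow> complex^'m"
  assumes A: "cxlin A" and \<Omega>: "htype (2 * (CARD('m) - 1)) 0 \<Omega>"
  shows "(det (matrix A) * cnj (det (matrix A))) * codim1_matrix \<Omega> $ i $ j =
    (\<Sum>k\<in>UNIV. \<Sum>l\<in>UNIV. matrix A $ i $ k * cnj (matrix A $ j $ l) * codim1_matrix (\<lambda>vs. \<Omega> (map A vs)) $ k $ l)"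
proof -
  have "2 * (CARD('m) - 1) + 2 = 2 * CARD('m)" by (metis One_nat_def Suc_pred mult_Suc_right add.commute zero_less_card_finite)
  then have ht: "htype (2 * CARD('m)) 0 (wedge \<Omega> (pair_form i j))"
    using htype_wedge[OF \<Omega> htype_pair_form[of i j]] by simp
  have pb: "pair_form i j (map A vs) = (\<Sum>k\<in>UNIV. \<Sum>l\<in>UNIV. matrix A $ i $ k * cnj (matrix A $ j $ l) * pair_form k l vs)" for vs
  proof -
    have "pair_form i j (map A vs) = sigma 1 * wedge (one_form (\<lambda>v. \<Sum>k\<in>UNIV. matrix A $ i $ k * v $ k))
        (conj_form (one_form (\<lambda>v. \<Sum>l\<in>UNIV. matrix A $ j $ l * v $ l))) vs"
      unfolding pair_form_def wedge_map conj_form_map[symmetric]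
      by (simp add: one_form_map cxlin_component[OF A])
    then show ?thesis by (simp only: pair_form_lincomb)
  qed
  have "wedge \<Omega> (pair_form i j) (jlist (map A std_list)) =
      wedge (\<lambda>vs. \<Omega> (map A vs)) (\<lambda>vs. pair_form i j (map A vs)) (jlist std_list)"
    by (subst map_jlist[symmetric]) (simp_all add: cxlin_scale[OF A] wedge_map)
  also have "\<dots> = (\<Sum>k\<in>UNIV. \<Sum>l\<in>UNIV. matrix A $ i $ k * cnj (matrix A $ j $ l) * codim1_matrix (\<lambda>vs. \<Omega> (map A vs)) $ k $ l)"
    unfolding pb wedge_sum_right wedge_scale_right by (simp add: codim1_matrix_def)
  finally show ?thesis unfolding top_form_pullback[OF A ht] by (simp add: codim1_matrix_def mult.commute)
qed

lemma det_cnj: "det (\<chi> i j. cnj (A $ i $ j)) = cnj (det A)"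
  by (simp add: det_def)

text \<open>Determinants in H A^*-conjugation form: the scalar |det A|^2 comes out of m rows on one
  side, while the matrix of A and its adjoint contribute it once on the other. For invertible A the
  modulus of the determinant thus scales by |det A|^(2 (m - 1)).\<close>

lemma det_codim1_matrix_pullback:
  fixes A :: "complex^'m::finite \<Rightarrow> complex^'m"
  assumes A: "cxlin A" and \<Omega>: "htype (2 * (CARD('m) - 1)) 0 \<Omega>"
  defines "r \<equiv> (norm (det (matrix A)))\<^sup>2"
  shows "r ^ CARD('m) * norm (det (codim1_matrix \<Omega>)) = r * norm (det (codim1_matrix (\<lambda>vs. \<Omega> (map A vs))))"
proof -
  let ?M = "matrix A" and ?H = "codim1_matrix (\<lambda>vs. \<Omega> (map A vs))"
  have r: "complex_of_real r = det ?M * cnj (det ?M)" by (simp add: r_def of_real_cmod_sq)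
  have "(\<chi> i. of_real r *s codim1_matrix \<Omega> $ i) = ?M ** ?H ** transpose (\<chi> i j. cnj (?M $ i $ j))"
  proof -
    have "of_real r * codim1_matrix \<Omega> $ i $ j = (?M ** ?H ** transpose (\<chi> i j. cnj (?M $ i $ j))) $ i $ j" for i j
      unfolding r codim1_matrix_pullback[OF A \<Omega>] matrix_matrix_mult_def transpose_def
      by (simp only: sum_distrib_right sum_distrib_left vec_lambda_beta) (subst sum.swap, simp only: mult_ac)
    then show ?thesis by (simp add: vec_eq_iff)
  qed
  then have "det (\<chi> i. of_real r *s codim1_matrix \<Omega> $ i) = det ?M * det ?H * cnj (det ?M)"
    by (simp add: det_mul det_cnj)
  moreover have "det (\<chi> i. of_real r *s codim1_matrix \<Omega> $ i) = of_real r ^ CARD('m) * det (codim1_matrix \<Omega>)"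
    using det_rows_mul[of "\<lambda>_. of_real r" "\<lambda>i. codim1_matrix \<Omega> $ i"] by simp
  ultimately have "of_real r ^ CARD('m) * det (codim1_matrix \<Omega>) = det ?M * det ?H * cnj (det ?M)" by simp
  then have "norm (of_real r ^ CARD('m) * det (codim1_matrix \<Omega>)) = norm (det ?M * det ?H * cnj (det ?M))" by simp
  then show ?thesis by (simp add: norm_mult norm_power r_def power2_eq_square mult.commute mult.left_commute)
qed

text \<open>A null vector x of the matrix gives the nonzero covector with coefficients conj x, and
  on the square of this covector \<Omega> takes the value zero, against transversality.\<close>

lemma transverse_det_codim1_nonzero:
  fixes \<Omega> :: "'m::finite form"
  assumes tr: "transverse_form (CARD('m) - 1) \<Omega>"
  shows "det (codim1_matrix \<Omega>) \<noteq> 0"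
proof
  let ?H = "codim1_matrix \<Omega>"
  assume "det ?H = 0"
  then have "\<not> invertible ?H" by (simp add: invertible_det_nz)
  then obtain x where x: "?H *v x = 0" "x \<noteq> 0"
    unfolding invertible_left_inverse matrix_left_invertible_ker by blast
  define f where "f v = (\<Sum>k\<in>UNIV. cnj (x $ k) * v $ k)" for v :: "complex^'m"
  have cov: "covector f" by (simp add: covector_iff f_def algebra_simps sum.distrib sum_distrib_left)
  have n1: "CARD('m) - (CARD('m) - 1) = 1" using zero_less_card_finite[where 'a='m] by linarith
  obtain k where k: "x $ k \<noteq> 0" using x(2) by (auto simp: vec_eq_iff)
  have "f (axis k 1) = cnj (x $ k)" by (simp add: f_def axis_def if_distrib cong: if_cong)
  then have "lin_indep_family 1 (\<lambda>_. f)" unfolding lin_indep_family_def using k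
    by (auto simp: dest!: spec[of _ "axis k 1"])
  then have lin: "(\<forall>i<1::nat. covector f) \<and> lin_indep_family 1 (\<lambda>_. f)" using cov by blast
  have "\<forall>\<psi>. (\<forall>i<1. covector (\<psi> i)) \<and> lin_indep_family 1 \<psi> \<longrightarrow>
      strictly_positive_top_form (wedge \<Omega> (elem_pos 1 \<psi>))"
    using tr unfolding transverse_form_def n1 by blast
  from spec[OF this, of "\<lambda>_. f"] have sp: "strictly_positive_top_form (wedge \<Omega> (elem_pos 1 (\<lambda>_. f)))"
    using lin by (rule mp)
  have \<Omega>: "htype (2 * (CARD('m) - 1)) 0 \<Omega>" using tr by (simp add: transverse_form_def pq_form_iff mult_2)
  have "2 * (CARD('m) - 1) + 2 * 1 = 2 * CARD('m)" using zero_less_card_finite[where 'a='m] by arith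
  then have ht: "htype (2 * CARD('m)) 0 (wedge \<Omega> (elem_pos 1 (\<lambda>_. f)))"
    using htype_wedge[OF \<Omega> htype_elem_pos[of 1 "\<lambda>_. f"]] cov by simp
  have "elem_pos 1 (\<lambda>_. f) = (\<lambda>vs. \<Sum>k\<in>UNIV. \<Sum>l\<in>UNIV. cnj (x $ k) * cnj (cnj (x $ l)) * pair_form k l vs)"
    unfolding pair_form_lincomb[symmetric] f_def[symmetric] by simp
  then have "wedge \<Omega> (elem_pos 1 (\<lambda>_. f)) (jlist std_list) =
     (\<Sum>k\<in>UNIV. \<Sum>l\<in>UNIV. cnj (x $ k) * x $ l * ?H $ k $ l)"
    by (simp add: wedge_sum_right wedge_scale_right codim1_matrix_def)
  also have "\<dots> = (\<Sum>k\<in>UNIV. cnj (x $ k) * (?H *v x) $ k)"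
    by (simp add: matrix_vector_mult_def sum_distrib_left mult.commute mult.left_commute)
  also have "\<dots> = 0" by (simp add: x)
  finally show False
    using sp unfolding strictly_positive_top_iff[OF frame_std ht] pos_number_def by simp
qed

text \<open>A kernel vector of A can be completed to a p-plane on which the pulled back form
  vanishes. The invertibility of the Jacobian of a transition map is obtained in this way from the
  forms themselves.\<close>

lemma transverse_pullback_det_nonzero:
  fixes \<Omega> :: "'m::finite form"
  assumes A: "cxlin A" and tr: "transverse_form p (\<lambda>vs. \<Omega> (map A vs))" and alt: "alt (2 * p) \<Omega>"
    and p: "1 \<le> p" "p \<le> CARD('m)"
  shows "det (matrix A) \<noteq> 0"
proof
  assume "det (matrix A) = 0"
  then have "\<not> invertible (matrix A)" by (simp add: invertible_det_nz)
  then obtain x where x: "matrix A *v x = 0" "x \<noteq> 0"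
    unfolding invertible_left_inverse matrix_left_invertible_ker by blast
  then have Ax: "A x = 0" using matrix_works[OF A] by simp
  have "vec.independent (set [x])" using x(2) by simp
  then obtain \<phi> e where fr: "frame \<phi> e" and e': "\<And>i. i < length [x] \<Longrightarrow> e i = [x] ! i"
    using indep_list_frame[of "[x]"] by (metis distinct_singleton)
  have e: "e 0 = x" using e'[of 0] by simp
  define ws where "ws = map e [0..<p]"
  have "set ws \<subseteq> e ` {..<CARD('m)}" using p by (auto simp: ws_def)
  then have "vec.independent (set ws)" by (rule vec.independent_mono[OF frame_basis(2)[OF fr]])
  moreover have "distinct ws" "length ws = p"
    using p by (auto simp: ws_def distinct_map intro: inj_on_subset[OF frame_basis(3)[OF fr]])
  ultimately have pos: "pos_number (\<Omega> (map A (jlist ws)))" by (intro transverse_imp_pos[OF tr])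
  have "ws = x # map e [1..<p]" using p e by (simp add: ws_def upt_conv_Cons)
  then have "\<Omega> (map A (jlist ws)) = \<Omega> (0 # map A ((\<i> *s x) # jlist (map e [1..<p])))" by (simp add: Ax)
  also have "\<dots> = 0" by (rule linear_0[OF alt_linear_head[OF alt]])
  finally show False using pos by (simp add: pos_number_def)
qed

text \<open>This is |det H|^(1/(m - 1)). The squared modulus, with the exponent halved, is used
  because det H times its conjugate is visibly smooth; taking a modulus also spares any discussion
  of the sign or reality of the determinant.\<close>

definition volume_density :: "'m::finite form \<Rightarrow> real" where
  "volume_density \<Omega> = ((norm (det (codim1_matrix \<Omega>)))\<^sup>2) powr (1 / (2 * (real CARD('m) - 1)))"

lemma volume_density_pos: "transverse_form (CARD('m) - 1) (\<Omega> :: 'm::finite form) \<Longrightarrow> volume_density \<Omega> > 0"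
  using transverse_det_codim1_nonzero[of \<Omega>] by (simp add: volume_density_def)

lemma volume_density_pullback:
  fixes A :: "complex^'m::finite \<Rightarrow> complex^'m"
  assumes A: "cxlin A" and tr: "transverse_form (CARD('m) - 1) \<Omega>"
    and tr': "transverse_form (CARD('m) - 1) (\<lambda>vs. \<Omega> (map A vs))" and m: "CARD('m) \<ge> 2"
  shows "volume_density (\<lambda>vs. \<Omega> (map A vs)) = volume_density \<Omega> * (norm (det (matrix A)))\<^sup>2"
proof -
  have \<Omega>: "htype (2 * (CARD('m) - 1)) 0 \<Omega>" using tr by (simp add: transverse_form_def pq_form_iff mult_2)
  define r where "r = (norm (det (matrix A)))\<^sup>2"
  define N N' where "N = norm (det (codim1_matrix \<Omega>))" and "N' = norm (det (codim1_matrix (\<lambda>vs. \<Omega> (map A vs))))"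
  have "det (matrix A) \<noteq> 0"
    by (rule transverse_pullback_det_nonzero[OF A tr' htype_alt[OF \<Omega>]]) (use m in auto)
  then have r: "r > 0" by (simp add: r_def)
  have N: "N > 0" "N' > 0" using transverse_det_codim1_nonzero tr tr' by (auto simp: N_def N'_def)
  obtain k where k: "CARD('m) = Suc k" using m by (cases "CARD('m)") auto
  have k0: "k > 0" using k m by simp
  have "r ^ CARD('m) * N = r * N'"
    unfolding r_def N_def N'_def by (rule det_codim1_matrix_pullback[OF A \<Omega>])
  \<comment> \<open>Cancelling one factor r leaves the power m - 1, which the root in
    \<open>volume_density\<close> undoes.\<close>
  then have N': "N' = N * r ^ k" using r by (simp add: k mult.commute)
  have "(N'\<^sup>2) powr (1 / (2 * real k)) = (N\<^sup>2 * (r powr (2 * real k))) powr (1 / (2 * real k))"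
    using r by (simp add: N' power_mult_distrib powr_realpow[symmetric] powr_powr[symmetric] mult.commute flip: powr_numeral)
  also have "\<dots> = (N\<^sup>2) powr (1 / (2 * real k)) * r"
    using r N k0 by (simp add: powr_mult powr_powr)
  finally show ?thesis by (simp add: volume_density_def N_def N'_def r_def k)
qed

text \<open>The density transforms by |det|^2 under transition maps, as the coefficient of a volume
  form must, so the local expressions agree and nothing has to be glued. Closedness is stated for
  all \<open>D_lin a b\<close> because \<partial> and its conjugate are both applied later.\<close>

lemma volume_form_exists:
  fixes X :: "('a, 'm::finite) cmfd"
  assumes X: "complex_manifold X" and \<Omega>: "transverse_smooth_form X (CARD('m) - 1) \<Omega>" and m: "CARD('m) \<ge> 2"
  obtains V where "smooth_form X (2 * CARD('m)) V" "everywhere X (strict_pos CARD('m)) V"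
    "\<And>a b c z. c \<in> cm_atlas X \<Longrightarrow> z \<in> chart_image c \<Longrightarrow> chart_deriv (D_lin a b) (V c) z = (\<lambda>vs. 0)"
proof -
  have sm: "smooth_form X (2 * (CARD('m) - 1)) \<Omega>"
    and tr: "\<And>c z. c \<in> cm_atlas X \<Longrightarrow> z \<in> chart_image c \<Longrightarrow> transverse_form (CARD('m) - 1) (\<Omega> c z)"
    using \<Omega> by (auto simp: transverse_smooth_form_def everywhere_def)
  define g where "g c z = complex_of_real (volume_density (\<Omega> c z))" for c z
  define V :: "('a, 'm) mform" where "V c z = (\<lambda>vs. g c z * elem_pos CARD('m) coord vs)" for c z
  have htE: "htype (2 * CARD('m)) 0 (elem_pos CARD('m) (coord :: nat \<Rightarrow> complex^'m \<Rightarrow> complex))"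
    by (rule htype_elem_pos) (rule covector_coord)
  have smg: "C_infinity_on (g c) (chart_image c)" if c: "c \<in> cm_atlas X" for c
  proof -
    note op = open_chart_image[OF X c]
    define h where "h z = det (codim1_matrix (\<Omega> c z)) * cnj (det (codim1_matrix (\<Omega> c z)))" for z
    have "C_infinity_on (\<lambda>z. codim1_matrix (\<Omega> c z) $ i $ j) (chart_image c)" for i j
    proof -
      have "C_infinity_on (\<lambda>z. wedge (\<Omega> c z) (pair_form i j) (jlist std_list)) (chart_image c)"
        by (rule C_infinity_on_wedge[OF op]) (rule smooth_form_C_infinity[OF sm c], rule C_infinity_on_const[OF op])
      then show ?thesis by (simp add: codim1_matrix_def)
    qed
    then have "C_infinity_on (\<lambda>z. det (codim1_matrix (\<Omega> c z))) (chart_image c)"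
      unfolding det_def by (intro C_infinity_on_sum C_infinity_on_mult C_infinity_on_prod C_infinity_on_const op)
    then have "C_infinity_on h (chart_image c)"
      unfolding h_def by (intro C_infinity_on_mult C_infinity_on_cnj op)
    have h: "h z = of_real ((norm (det (codim1_matrix (\<Omega> c z))))\<^sup>2)" for z
      by (simp add: h_def of_real_cmod_sq)
    have "h z \<notin> \<real>\<^sub>\<le>\<^sub>0" if "z \<in> chart_image c" for z
      using transverse_det_codim1_nonzero[OF tr[OF c that]] unfolding h complex_nonpos_Reals_iff
      by (simp del: of_real_power)
    with \<open>C_infinity_on h (chart_image c)\<close> have "C_infinity_on (\<lambda>z. h z powr of_real (1 / (2 * (real CARD('m) - 1)))) (chart_image c)"
      by (intro C_infinity_on_powr op)
    moreover have "h z powr of_real (1 / (2 * (real CARD('m) - 1))) = g c z" for z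
      unfolding h g_def volume_density_def by (rule powr_of_real) simp_all
    ultimately show ?thesis by simp
  qed
  have "smooth_form X (2 * CARD('m)) V"
    unfolding smooth_form_def
  proof (intro conjI ballI allI)
    show "everywhere X (alternating_form (2 * CARD('m))) V"
      unfolding everywhere_def alternating_iff V_def by (intro ballI alt_scale htype_alt[OF htE])
    show "C_infinity_on (\<lambda>z. V c z vs) (chart_image c)" if c: "c \<in> cm_atlas X" for c vs
      unfolding V_def by (intro C_infinity_on_mult C_infinity_on_const smg[OF c] open_chart_image[OF X c])
    fix c c' z vs assume c: "c \<in> cm_atlas X" "c' \<in> cm_atlas X" "z \<in> transition_dom c c'"
    define A where "A = frechet_derivative (transition c c') (at z)"
    define w where "w = transition c c' z"
    have A: "cxlin A" unfolding A_def by (rule transition_derivative[OF X c])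
    have zc: "z \<in> chart_image c" "w \<in> chart_image c'"
      using transition_dom_in_chart[OF c(3)] transition_in_chart[OF X c(1,3)] by (auto simp: w_def)
    have pb: "\<Omega> c z = (\<lambda>vs. \<Omega> c' w (map A vs))"
      unfolding A_def w_def by (rule ext) (rule smooth_form_transition[OF sm c])
    have den: "volume_density (\<Omega> c z) = volume_density (\<Omega> c' w) * (norm (det (matrix A)))\<^sup>2"
      unfolding pb by (rule volume_density_pullback[OF A tr[OF c(2) zc(2)] _ m]) (use tr[OF c(1) zc(1)] pb in simp)
    \<comment> \<open>A pulled back top form is a multiple of the standard one, and its value on the
      standard basis identifies the factor as |det A|^2, the same as for the density.\<close>
    have "(\<lambda>vs. elem_pos CARD('m) coord (map A vs)) =
       (\<lambda>vs. elem_pos CARD('m) coord (map A (jlist std_list)) * elem_pos CARD('m) coord vs)"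
      by (rule top_form_eq[OF frame_std htype_pullback_cxlin[OF A htE]])
    moreover have "elem_pos CARD('m) coord (map A (jlist (std_list :: (complex^'m) list))) = det (matrix A) * cnj (det (matrix A))"
    proof -
      have hol: "hol CARD('m) (top_of coord :: 'm form)" by (rule hol_wedge_list_map) (rule covector_coord)
      have "elem_pos CARD('m) coord (jlist (std_list :: (complex^'m) list)) = 1"
        using hol_wedge_conj_jlist[OF hol hol, of std_list] frame_top_eval[OF frame_std[where 'm='m]] by simp
      then show ?thesis
        using top_form_pullback[OF A htE] by (subst map_jlist) (simp_all add: cxlin_scale[OF A])
    qed
    ultimately have ev: "elem_pos CARD('m) coord (map A vs) = of_real ((norm (det (matrix A)))\<^sup>2) * elem_pos CARD('m) coord vs"
      by (metis (no_types, lifting) complex_norm_square)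
    then show "V c z vs = V c' (transition c c' z) (map (frechet_derivative (transition c c') (at z)) vs)"
      unfolding V_def w_def[symmetric] A_def[symmetric] g_def den ev by (simp only: of_real_mult mult.assoc)
  qed
  moreover have "everywhere X (strict_pos CARD('m)) V"
    unfolding everywhere_def V_def g_def
    by (intro ballI volume_strict_pos frame_imp_dual_basis[OF frame_std] volume_density_pos tr)
  moreover have "chart_deriv (D_lin a b) (V c) z = (\<lambda>vs. 0)" if c: "c \<in> cm_atlas X" "z \<in> chart_image c" for a b c z
  proof -
    have d: "g c differentiable (at z)" by (rule C_infinity_on_differentiable[OF smg[OF c(1)] c(2)])
    show ?thesis
      unfolding V_def chart_deriv_function_times_const[OF d, abs_def] one_form_wedge_volume[OF frame_std linear_D_lin[OF d]] ..
  qed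
  ultimately show ?thesis by (rule that)
qed


section \<open>Product manifolds\<close>

lemma second_countable_prod_topology:
  assumes "second_countable S" "second_countable T"
  shows "second_countable (prod_topology S T)"
proof -
  obtain \<A> where "countable \<A> \<and> (\<forall>V\<in>\<A>. openin S V) \<and>
    (\<forall>U x. openin S U \<and> x \<in> U \<longrightarrow> (\<exists>V\<in>\<A>. x \<in> V \<and> V \<subseteq> U))"
    using assms(1) unfolding second_countable_def ..
  then have A: "countable \<A>" "\<And>V. V \<in> \<A> \<Longrightarrow> openin S V"
    "\<And>U x. openin S U \<Longrightarrow> x \<in> U \<Longrightarrow> \<exists>V\<in>\<A>. x \<in> V \<and> V \<subseteq> U"
    by simp_all
  obtain \<B> where "countable \<B> \<and> (\<forall>V\<in>\<B>. openin T V) \<and>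
    (\<forall>U x. openin T U \<and> x \<in> U \<longrightarrow> (\<exists>V\<in>\<B>. x \<in> V \<and> V \<subseteq> U))"
    using assms(2) unfolding second_countable_def ..
  then have B: "countable \<B>" "\<And>V. V \<in> \<B> \<Longrightarrow> openin T V"
    "\<And>U x. openin T U \<Longrightarrow> x \<in> U \<Longrightarrow> \<exists>V\<in>\<B>. x \<in> V \<and> V \<subseteq> U"
    by simp_all
  define \<C> where "\<C> = (\<lambda>(U, V). U \<times> V) ` (\<A> \<times> \<B>)"
  have "countable \<C>" using A(1) B(1) by (simp add: \<C>_def)
  moreover have "\<forall>V\<in>\<C>. openin (prod_topology S T) V"
    using A(2) B(2) by (auto simp: \<C>_def openin_prod_Times_iff)
  moreover have "\<exists>V\<in>\<C>. x \<in> V \<and> V \<subseteq> U" if U: "openin (prod_topology S T) U" "x \<in> U" for U x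
  proof -
    obtain u v where x: "x = (u, v)" by fastforce
    have "\<forall>x y. (x, y) \<in> U \<longrightarrow> (\<exists>P Q. openin S P \<and> openin T Q \<and> x \<in> P \<and> y \<in> Q \<and> P \<times> Q \<subseteq> U)"
      using U(1) by (simp only: openin_prod_topology_alt)
    then obtain P Q where PQ: "openin S P" "openin T Q" "u \<in> P" "v \<in> Q" "P \<times> Q \<subseteq> U"
      using U(2) unfolding x by meson
    obtain P' Q' where "P' \<in> \<A>" "u \<in> P'" "P' \<subseteq> P" "Q' \<in> \<B>" "v \<in> Q'" "Q' \<subseteq> Q"
      using A(3)[OF PQ(1,3)] B(3)[OF PQ(2,4)] by metis
    then have "P' \<times> Q' \<in> \<C>" "x \<in> P' \<times> Q'" "P' \<times> Q' \<subseteq> U" using PQ(5) by (auto simp: x \<C>_def)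
    then show ?thesis by (rule_tac x = "P' \<times> Q'" in bexI) simp_all
  qed
  ultimately show ?thesis unfolding second_countable_def by blast
qed

section \<open>Charts of a product manifold\<close>

lemma pr1_join [simp]: "pr1 (join_vec u v) = u"
  and pr2_join [simp]: "pr2 (join_vec u v) = v"
  by (simp_all add: pr1_def pr2_def join_vec_def vec_eq_iff)

lemma join_pr [simp]: "join_vec (pr1 w) (pr2 w) = w"
  by (rule pr_eqI) simp_all

lemma join_eq_iff: "join_vec u v = w \<longleftrightarrow> u = pr1 w \<and> v = pr2 w"
  using join_pr by auto

lemma linear_join: "linear (\<lambda>p. join_vec (fst p) (snd p))"
  by (rule linearI; rule pr_eqI)
    (simp_all add: linear_add[OF cxlin_linear[OF cxlin_pr1]] linear_add[OF cxlin_linear[OF cxlin_pr2]]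
      linear_scale[OF cxlin_linear[OF cxlin_pr1]] linear_scale[OF cxlin_linear[OF cxlin_pr2]])

lemma bounded_linear_join: "bounded_linear (\<lambda>p. join_vec (fst p) (snd p))"
  using linear_join by (simp add: linear_conv_bounded_linear)

lemma bounded_linear_cxlin: "cxlin L \<Longrightarrow> bounded_linear L"
  by (simp add: cxlin_linear flip: linear_conv_bounded_linear)

lemma fst_prod_chart [simp]: "fst (prod_chart c c') = fst c \<times> fst c'"
  by (simp add: prod_chart_def)

lemma snd_prod_chart [simp]: "snd (prod_chart c c') (x, y) = join_vec (snd c x) (snd c' y)"
  by (simp add: prod_chart_def)

lemma snd_prod_chart': "snd (prod_chart c c') = (\<lambda>p. join_vec (fst p) (snd p)) \<circ> (\<lambda>(x, y). (snd c x, snd c' y))"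
  by (auto simp: prod_chart_def)

lemma chart_image_prod:
  "chart_image (prod_chart c c') = {w. pr1 w \<in> chart_image c \<and> pr2 w \<in> chart_image c'}"
  unfolding chart_image_def
proof (intro set_eqI iffI)
  fix w assume "w \<in> {w. pr1 w \<in> snd c ` fst c \<and> pr2 w \<in> snd c' ` fst c'}"
  then obtain x y where "x \<in> fst c" "y \<in> fst c'" "pr1 w = snd c x" "pr2 w = snd c' y" by auto
  then show "w \<in> snd (prod_chart c c') ` fst (prod_chart c c')"
    by (intro image_eqI[of _ _ "(x, y)"]) (simp_all add: eq_commute[of w] join_eq_iff)
qed auto

lemma transition_dom_prod:
  "transition_dom (prod_chart c c') (prod_chart d d') =
     {w. pr1 w \<in> transition_dom c d \<and> pr2 w \<in> transition_dom c' d'}"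
  unfolding transition_dom_def
proof (intro set_eqI iffI)
  fix w assume "w \<in> {w. pr1 w \<in> snd c ` (fst c \<inter> fst d) \<and> pr2 w \<in> snd c' ` (fst c' \<inter> fst d')}"
  then obtain x y where "x \<in> fst c \<inter> fst d" "y \<in> fst c' \<inter> fst d'" "pr1 w = snd c x" "pr2 w = snd c' y" by auto
  then show "w \<in> snd (prod_chart c c') ` (fst (prod_chart c c') \<inter> fst (prod_chart d d'))"
    by (intro image_eqI[of _ _ "(x, y)"]) (auto simp add: eq_commute[of w] join_eq_iff)
qed auto

lemma transition_prod:
  assumes X: "complex_manifold X" "c \<in> cm_atlas X" and Y: "complex_manifold Y" "c' \<in> cm_atlas Y"
    and w: "w \<in> transition_dom (prod_chart c c') (prod_chart d d')"
  shows "transition (prod_chart c c') (prod_chart d d') w =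
    join_vec (transition c d (pr1 w)) (transition c' d' (pr2 w))"
proof -
  obtain x y where xy: "x \<in> fst c" "y \<in> fst c'" and pw: "pr1 w = snd c x" "pr2 w = snd c' y"
    using w unfolding transition_dom_prod transition_dom_def by auto
  have w: "w = snd (prod_chart c c') (x, y)" by (simp add: eq_commute[of w] join_eq_iff pw)
  have "inj_on (snd (prod_chart c c')) (fst (prod_chart c c'))"
    using inj_on_chart[OF X] inj_on_chart[OF Y] by (auto simp: inj_on_def join_eq_iff)
  then have "inv_into (fst (prod_chart c c')) (snd (prod_chart c c')) w = (x, y)"
    unfolding w by (rule inv_into_f_f) (use xy in simp)
  then show ?thesis
    using transition_apply[OF X xy(1)] transition_apply[OF Y xy(2)] by (simp add: transition_def[of "prod_chart c c'"] pw)
qed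

text \<open>The product chart is the product of two homeomorphisms followed by the linear
  isomorphism that joins the coordinates, with inverse given by the two projections.\<close>

lemma homeomorphic_map_prod_chart:
  assumes X: "complex_manifold X" "c \<in> cm_atlas X" and Y: "complex_manifold Y" "c' \<in> cm_atlas Y"
  shows "homeomorphic_map (subtopology (prod_topology (cm_top X) (cm_top Y)) (fst c \<times> fst c'))
     (top_of_set (chart_image (prod_chart c c'))) (snd (prod_chart c c'))"
proof -
  let ?J = "\<lambda>p. join_vec (fst p) (snd p)"
  obtain f g where fg: "homeomorphic_maps (subtopology (cm_top X) (fst c)) (top_of_set (chart_image c)) (snd c) f"
    "homeomorphic_maps (subtopology (cm_top Y) (fst c')) (top_of_set (chart_image c')) (snd c') g"
    using chart_homeo[OF X] chart_homeo[OF Y] by (auto simp: homeomorphic_map_maps)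
  then have "homeomorphic_maps (prod_topology (subtopology (cm_top X) (fst c)) (subtopology (cm_top Y) (fst c')))
     (prod_topology (top_of_set (chart_image c)) (top_of_set (chart_image c')))
     (\<lambda>(x, y). (snd c x, snd c' y)) (\<lambda>(x, y). (f x, g y))"
    by (simp only: homeomorphic_maps_prod simp_thms)
  then have 1: "homeomorphic_map (subtopology (prod_topology (cm_top X) (cm_top Y)) (fst c \<times> fst c'))
     (top_of_set (chart_image c \<times> chart_image c')) (\<lambda>(x, y). (snd c x, snd c' y))"
    unfolding homeomorphic_map_maps subtopology_Times by auto
  have "homeomorphic_maps (top_of_set (chart_image c \<times> chart_image c')) (top_of_set (chart_image (prod_chart c c')))
     ?J (\<lambda>w. (pr1 w, pr2 w))"
    unfolding homeomorphic_maps_def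
  proof (intro conjI)
    have "continuous_on S ?J" for S :: "((complex^'b) \<times> (complex^'d)) set"
      by (rule linear_continuous_on[OF bounded_linear_join])
    then show "continuous_map (top_of_set (chart_image c \<times> chart_image c')) (top_of_set (chart_image (prod_chart c c'))) ?J"
      by (auto simp: continuous_map_subtopology_eu chart_image_prod)
    have "continuous_on S (\<lambda>w. (pr1 w :: complex^'b, pr2 w :: complex^'d))" for S
      by (intro continuous_on_Pair linear_continuous_on bounded_linear_cxlin cxlin_pr1 cxlin_pr2)
    then show "continuous_map (top_of_set (chart_image (prod_chart c c'))) (top_of_set (chart_image c \<times> chart_image c'))
       (\<lambda>w. (pr1 w, pr2 w))"
      by (auto simp: continuous_map_subtopology_eu chart_image_prod)
  qed auto
  then have 2: "homeomorphic_map (top_of_set (chart_image c \<times> chart_image c')) (top_of_set (chart_image (prod_chart c c'))) ?J"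
    unfolding homeomorphic_map_maps by blast
  show ?thesis
    unfolding snd_prod_chart' by (rule homeomorphic_map_compose[OF 1 2])
qed

lemma complex_manifold_prod:
  assumes X: "complex_manifold (X :: ('a, 'm::finite) cmfd)" and Y: "complex_manifold (Y :: ('b, 'n::finite) cmfd)"
  shows "complex_manifold (prod_cmfd X Y)"
  unfolding complex_manifold_def
proof (intro conjI ballI)
  show "Hausdorff_space (cm_top (prod_cmfd X Y))"
    using X Y by (simp add: prod_cmfd_def Hausdorff_space_prod_topology complex_manifold_def)
  show "second_countable (cm_top (prod_cmfd X Y))"
    using X Y by (simp add: prod_cmfd_def second_countable_prod_topology complex_manifold_def)
  have XU: "(\<Union>c\<in>cm_atlas X. fst c) = topspace (cm_top X)" and YU: "(\<Union>c\<in>cm_atlas Y. fst c) = topspace (cm_top Y)"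
    using X Y by (auto simp only: complex_manifold_def)
  show "(\<Union>c\<in>cm_atlas (prod_cmfd X Y). fst c) = topspace (cm_top (prod_cmfd X Y))"
  proof -
    have "(\<Union>c\<in>cm_atlas (prod_cmfd X Y). fst c) = (\<Union>c\<in>cm_atlas X. fst c) \<times> (\<Union>c\<in>cm_atlas Y. fst c)"
    proof (intro set_eqI iffI)
      fix p assume "p \<in> (\<Union>c\<in>cm_atlas (prod_cmfd X Y). fst c)"
      then obtain C where C: "C \<in> cm_atlas (prod_cmfd X Y)" "p \<in> fst C" by (rule UN_E)
      obtain c c' where "c \<in> cm_atlas X" "c' \<in> cm_atlas Y" "C = prod_chart c c'"
        using C(1) by (auto simp: prod_cmfd_def)
      moreover from this have "p \<in> fst c \<times> fst c'" using C(2) by simp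
      ultimately show "p \<in> (\<Union>c\<in>cm_atlas X. fst c) \<times> (\<Union>c\<in>cm_atlas Y. fst c)" by auto
    next
      fix p assume "p \<in> (\<Union>c\<in>cm_atlas X. fst c) \<times> (\<Union>c\<in>cm_atlas Y. fst c)"
      then obtain c c' where c: "c \<in> cm_atlas X" "c' \<in> cm_atlas Y" and p: "p \<in> fst (prod_chart c c')"
        unfolding fst_prod_chart by (metis UN_E mem_Times_iff)
      have "prod_chart c c' \<in> cm_atlas (prod_cmfd X Y)" using c unfolding prod_cmfd_def cmfd.select_convs by blast
      then show "p \<in> (\<Union>c\<in>cm_atlas (prod_cmfd X Y). fst c)" using p by (rule UN_I)
    qed
    then show ?thesis by (simp only: XU YU) (simp add: prod_cmfd_def)
  qed
next
  fix C assume "C \<in> cm_atlas (prod_cmfd X Y)"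
  then obtain c c' where C: "C = prod_chart c c'" "c \<in> cm_atlas X" "c' \<in> cm_atlas Y"
    by (auto simp: prod_cmfd_def)
  show "openin (cm_top (prod_cmfd X Y)) (fst C)"
    using openin_chart[OF X C(2)] openin_chart[OF Y C(3)] by (simp add: C prod_cmfd_def openin_prod_Times_iff)
  have "open (pr1 -` chart_image c :: (complex^('m+'n)) set)" "open (pr2 -` chart_image c' :: (complex^('m+'n)) set)"
    using open_chart_image[OF X C(2)] open_chart_image[OF Y C(3)]
    by (auto intro!: open_vimage linear_continuous_on bounded_linear_cxlin cxlin_pr1 cxlin_pr2)
  then have "open (pr1 -` chart_image c \<inter> pr2 -` chart_image c' :: (complex^('m+'n)) set)" by (rule open_Int)
  then show "open (chart_image C)"
    unfolding C chart_image_prod by (simp add: vimage_def Collect_conj_eq)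
  show "homeomorphic_map (subtopology (cm_top (prod_cmfd X Y)) (fst C)) (top_of_set (chart_image C)) (snd C)"
    using homeomorphic_map_prod_chart[OF X C(2) Y C(3)] by (simp add: C prod_cmfd_def)
next
  fix C D assume "C \<in> cm_atlas (prod_cmfd X Y)" "D \<in> cm_atlas (prod_cmfd X Y)"
  then obtain c c' d d' where C: "C = prod_chart c c'" "c \<in> cm_atlas X" "c' \<in> cm_atlas Y"
    and D: "D = prod_chart d d'" "d \<in> cm_atlas X" "d' \<in> cm_atlas Y"
    by (auto simp: prod_cmfd_def)
  show "holomorphic_map_on (transition C D) (transition_dom C D)"
    unfolding holomorphic_map_on_def
  proof
    fix w assume w: "w \<in> transition_dom C D"
    then have w12: "pr1 w \<in> transition_dom c d" "pr2 w \<in> transition_dom c' d'"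
      by (auto simp: C D transition_dom_prod)
    define D1 D2 where "D1 = frechet_derivative (transition c d) (at (pr1 w))"
      and "D2 = frechet_derivative (transition c' d') (at (pr2 w))"
    note d1 = transition_derivative[OF X C(2) D(2) w12(1), folded D1_def]
    note d2 = transition_derivative[OF Y C(3) D(3) w12(2), folded D2_def]
    define F where "F v = join_vec (transition c d (pr1 v)) (transition c' d' (pr2 v))" for v
    have p1: "((pr1 :: complex^('m+'n) \<Rightarrow> _) has_derivative pr1) (at w)"
      and p2: "((pr2 :: complex^('m+'n) \<Rightarrow> _) has_derivative pr2) (at w)"
      by (intro bounded_linear_imp_has_derivative bounded_linear_cxlin cxlin_pr1 cxlin_pr2)+
    have h1: "((\<lambda>v. (transition c d (pr1 v), transition c' d' (pr2 v))) has_derivative (\<lambda>v. (D1 (pr1 v), D2 (pr2 v)))) (at w)"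
      by (intro has_derivative_Pair has_derivative_compose[OF p1 d1(1)] has_derivative_compose[OF p2 d2(1)])
    have h2: "((\<lambda>p. join_vec (fst p) (snd p)) has_derivative (\<lambda>p. join_vec (fst p) (snd p)))
       (at (transition c d (pr1 w), transition c' d' (pr2 w)))"
      by (rule bounded_linear_imp_has_derivative[OF bounded_linear_join])
    have F: "(F has_derivative (\<lambda>v. join_vec (D1 (pr1 v)) (D2 (pr2 v)))) (at w)"
      using has_derivative_compose[OF h1 h2] by (simp add: F_def[abs_def])
    have "open (pr1 -` transition_dom c d :: (complex^('m+'n)) set)" "open (pr2 -` transition_dom c' d' :: (complex^('m+'n)) set)"
      using open_transition_dom[OF X C(2) D(2)] open_transition_dom[OF Y C(3) D(3)]
      by (auto intro!: open_vimage linear_continuous_on bounded_linear_cxlin cxlin_pr1 cxlin_pr2)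
    then have "open (pr1 -` transition_dom c d \<inter> pr2 -` transition_dom c' d' :: (complex^('m+'n)) set)" by (rule open_Int)
    then have op: "open (transition_dom C D)"
      unfolding C D transition_dom_prod by (simp add: vimage_def Collect_conj_eq)
    have "F v = transition C D v" if "v \<in> transition_dom C D" for v
      using transition_prod[OF X C(2) Y C(3)] that by (simp add: C D F_def)
    then have "(transition C D has_derivative (\<lambda>v. join_vec (D1 (pr1 v)) (D2 (pr2 v)))) (at w)"
      using has_derivative_cong_open[OF op w] F by blast
    moreover have "cxlin (\<lambda>v. join_vec (D1 (pr1 v)) (D2 (pr2 v)) :: complex^('m+'n))"
      unfolding cxlin_iff
      by (auto intro!: pr_eqI simp: cxlin_add[OF cxlin_pr1] cxlin_add[OF cxlin_pr2] cxlin_scale[OF cxlin_pr1]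
          cxlin_scale[OF cxlin_pr2] cxlin_add[OF d1(2)] cxlin_add[OF d2(2)] cxlin_scale[OF d1(2)] cxlin_scale[OF d2(2)])
    ultimately show "\<exists>D'. (transition C D has_derivative D') (at w) \<and> cxlin D'" by blast
  qed
qed

text \<open>A holomorphic map that is given by the linear map \<open>L\<close> in the charts \<open>C\<close> and \<open>dec C\<close>.\<close>

definition lin_proj :: "('c, 'k::finite) cmfd \<Rightarrow> ('a, 'm::finite) cmfd \<Rightarrow>
    (('c, 'k) chart \<Rightarrow> ('a, 'm) chart) \<Rightarrow> (complex^'k \<Rightarrow> complex^'m) \<Rightarrow> bool" where
  "lin_proj W X dec L \<longleftrightarrow> cxlin L \<and>
     (\<forall>C\<in>cm_atlas W. dec C \<in> cm_atlas X \<and> L ` chart_image C \<subseteq> chart_image (dec C)) \<and>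
     (\<forall>C\<in>cm_atlas W. \<forall>C'\<in>cm_atlas W. \<forall>z\<in>transition_dom C C'.
        L z \<in> transition_dom (dec C) (dec C') \<and> L (transition C C' z) = transition (dec C) (dec C') (L z))"

text \<open>The map is linear in the chosen charts, so its differential is \<open>L\<close> at every
  point; this is why no derivative appears.\<close>

definition pull :: "(('c, 'k::finite) chart \<Rightarrow> ('a, 'm::finite) chart) \<Rightarrow> (complex^'k \<Rightarrow> complex^'m) \<Rightarrow>
    ('a, 'm) mform \<Rightarrow> ('c, 'k) mform" where
  "pull dec L \<omega> = (\<lambda>C z vs. \<omega> (dec C) (L z) (map L vs))"

definition mwedge :: "('a, 'm::finite) mform \<Rightarrow> ('a, 'm) mform \<Rightarrow> ('a, 'm) mform" where
  "mwedge \<alpha> \<beta> = (\<lambda>C z. wedge (\<alpha> C z) (\<beta> C z))"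

text \<open>
  The factors of a product chart are not unique when its domain is empty; any choice will do.
\<close>

definition left_chart :: "('a, 'm::finite) cmfd \<Rightarrow> ('b, 'n::finite) cmfd \<Rightarrow> ('a \<times> 'b, 'm + 'n) chart \<Rightarrow> ('a, 'm) chart" where
  "left_chart X Y C = (SOME c. c \<in> cm_atlas X \<and> (\<exists>c'\<in>cm_atlas Y. C = prod_chart c c'))"

definition right_chart :: "('a, 'm::finite) cmfd \<Rightarrow> ('b, 'n::finite) cmfd \<Rightarrow> ('a \<times> 'b, 'm + 'n) chart \<Rightarrow> ('b, 'n) chart" where
  "right_chart X Y C = (SOME c'. c' \<in> cm_atlas Y \<and> (\<exists>c\<in>cm_atlas X. C = prod_chart c c'))"

lemma left_chart:
  assumes "C \<in> cm_atlas (prod_cmfd X Y)"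
  obtains c' where "left_chart X Y C \<in> cm_atlas X" "c' \<in> cm_atlas Y" "C = prod_chart (left_chart X Y C) c'"
proof -
  have "\<exists>c. c \<in> cm_atlas X \<and> (\<exists>c'\<in>cm_atlas Y. C = prod_chart c c')"
    using assms by (auto simp: prod_cmfd_def)
  from someI_ex[OF this, folded left_chart_def] that show ?thesis by blast
qed

lemma right_chart:
  assumes "C \<in> cm_atlas (prod_cmfd X Y)"
  obtains c where "right_chart X Y C \<in> cm_atlas Y" "c \<in> cm_atlas X" "C = prod_chart c (right_chart X Y C)"
proof -
  have "\<exists>c'. c' \<in> cm_atlas Y \<and> (\<exists>c\<in>cm_atlas X. C = prod_chart c c')"
    using assms by (auto simp: prod_cmfd_def)
  from someI_ex[OF this, folded right_chart_def] that show ?thesis by blast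
qed

lemma lin_proj_left:
  assumes X: "complex_manifold X" and Y: "complex_manifold Y"
  shows "lin_proj (prod_cmfd X Y) X (left_chart X Y) pr1"
  unfolding lin_proj_def
proof (intro conjI ballI cxlin_pr1)
  fix C assume "C \<in> cm_atlas (prod_cmfd X Y)"
  then obtain c' where C: "left_chart X Y C \<in> cm_atlas X" "c' \<in> cm_atlas Y" "C = prod_chart (left_chart X Y C) c'"
    by (rule left_chart)
  show "left_chart X Y C \<in> cm_atlas X" by fact
  show "pr1 ` chart_image C \<subseteq> chart_image (left_chart X Y C)"
    by (subst C(3)) (auto simp: chart_image_prod)
next
  fix C D z assume CD: "C \<in> cm_atlas (prod_cmfd X Y)" "D \<in> cm_atlas (prod_cmfd X Y)" and z: "z \<in> transition_dom C D"
  obtain c' where C: "left_chart X Y C \<in> cm_atlas X" "c' \<in> cm_atlas Y" "C = prod_chart (left_chart X Y C) c'"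
    using left_chart[OF CD(1)] .
  obtain d' where D: "left_chart X Y D \<in> cm_atlas X" "d' \<in> cm_atlas Y" "D = prod_chart (left_chart X Y D) d'"
    using left_chart[OF CD(2)] .
  have z': "z \<in> transition_dom (prod_chart (left_chart X Y C) c') (prod_chart (left_chart X Y D) d')"
    using z C(3) D(3) by metis
  then show "pr1 z \<in> transition_dom (left_chart X Y C) (left_chart X Y D)" by (simp add: transition_dom_prod)
  have "transition C D z = transition (prod_chart (left_chart X Y C) c') (prod_chart (left_chart X Y D) d') z"
    using C(3) D(3) by metis
  then show "pr1 (transition C D z) = transition (left_chart X Y C) (left_chart X Y D) (pr1 z)"
    using transition_prod[OF X C(1) Y C(2) z'] by simp
qed

lemma lin_proj_right:
  assumes X: "complex_manifold X" and Y: "complex_manifold Y"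
  shows "lin_proj (prod_cmfd X Y) Y (right_chart X Y) pr2"
  unfolding lin_proj_def
proof (intro conjI ballI cxlin_pr2)
  fix C assume "C \<in> cm_atlas (prod_cmfd X Y)"
  then obtain c where C: "right_chart X Y C \<in> cm_atlas Y" "c \<in> cm_atlas X" "C = prod_chart c (right_chart X Y C)"
    by (rule right_chart)
  show "right_chart X Y C \<in> cm_atlas Y" by fact
  show "pr2 ` chart_image C \<subseteq> chart_image (right_chart X Y C)"
    by (subst C(3)) (auto simp: chart_image_prod)
next
  fix C D z assume CD: "C \<in> cm_atlas (prod_cmfd X Y)" "D \<in> cm_atlas (prod_cmfd X Y)" and z: "z \<in> transition_dom C D"
  obtain c where C: "right_chart X Y C \<in> cm_atlas Y" "c \<in> cm_atlas X" "C = prod_chart c (right_chart X Y C)"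
    using right_chart[OF CD(1)] .
  obtain d where D: "right_chart X Y D \<in> cm_atlas Y" "d \<in> cm_atlas X" "D = prod_chart d (right_chart X Y D)"
    using right_chart[OF CD(2)] .
  have z': "z \<in> transition_dom (prod_chart c (right_chart X Y C)) (prod_chart d (right_chart X Y D))"
    using z C(3) D(3) by metis
  then show "pr2 z \<in> transition_dom (right_chart X Y C) (right_chart X Y D)" by (simp add: transition_dom_prod)
  have "transition C D z = transition (prod_chart c (right_chart X Y C)) (prod_chart d (right_chart X Y D)) z"
    using C(3) D(3) by metis
  then show "pr2 (transition C D z) = transition (right_chart X Y C) (right_chart X Y D) (pr2 z)"
    using transition_prod[OF X C(2) Y C(1) z'] by simp
qed

section \<open>Pullbacks, products and sums of smooth forms\<close>

lemma lin_proj_chart: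
  assumes "lin_proj W X dec L" "C \<in> cm_atlas W"
  shows "dec C \<in> cm_atlas X" "z \<in> chart_image C \<Longrightarrow> L z \<in> chart_image (dec C)"
  using assms unfolding lin_proj_def by auto

lemma lin_proj_cxlin: "lin_proj W X dec L \<Longrightarrow> cxlin L"
  by (simp add: lin_proj_def)

text \<open>Both sides differentiate the same map, since \<open>L\<close> intertwines the transition
  maps on an open set; uniqueness of the derivative gives the equality.\<close>

lemma lin_proj_derivative:
  assumes W: "complex_manifold W" and X: "complex_manifold X" and L: "lin_proj W X dec L"
    and C: "C \<in> cm_atlas W" "C' \<in> cm_atlas W" "z \<in> transition_dom C C'"
  shows "L (frechet_derivative (transition C C') (at z) v) =
    frechet_derivative (transition (dec C) (dec C')) (at (L z)) (L v)"
proof -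
  have bl: "(L has_derivative L) (at w)" for w
    by (intro bounded_linear_imp_has_derivative bounded_linear_cxlin lin_proj_cxlin[OF L])
  have Lz: "L z \<in> transition_dom (dec C) (dec C')" using L C unfolding lin_proj_def by blast
  have 1: "((\<lambda>y. L (transition C C' y)) has_derivative (\<lambda>v. L (frechet_derivative (transition C C') (at z) v))) (at z)"
    by (rule has_derivative_compose[OF transition_derivative(1)[OF W C] bl])
  have 2: "((\<lambda>y. transition (dec C) (dec C') (L y)) has_derivative
      (\<lambda>v. frechet_derivative (transition (dec C) (dec C')) (at (L z)) (L v))) (at z)"
    by (rule has_derivative_compose[OF bl transition_derivative(1)[OF X lin_proj_chart(1)[OF L C(1)] lin_proj_chart(1)[OF L C(2)] Lz]])
  have "L (transition C C' y) = transition (dec C) (dec C') (L y)" if "y \<in> transition_dom C C'" for y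
    using L C that unfolding lin_proj_def by blast
  then have "((\<lambda>y. transition (dec C) (dec C') (L y)) has_derivative (\<lambda>v. L (frechet_derivative (transition C C') (at z) v))) (at z)"
    by (rule has_derivative_cong_open[OF open_transition_dom[OF W C(1,2)] C(3), THEN iffD1, OF _ 1])
  from has_derivative_unique[OF this 2] show ?thesis by (rule fun_cong)
qed

lemma smooth_form_pull:
  assumes W: "complex_manifold W" and X: "complex_manifold X" and L: "lin_proj W X dec L"
    and sm: "smooth_form X k \<omega>"
  shows "smooth_form W k (pull dec L \<omega>)"
  unfolding smooth_form_def
proof (intro conjI ballI allI)
  show "everywhere W (alternating_form k) (pull dec L \<omega>)"
    unfolding everywhere_def alternating_iff pull_def
    by (intro ballI alt_pullback cxlin_linear lin_proj_cxlin[OF L] smooth_form_alt[OF sm] lin_proj_chart[OF L])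
  show "C_infinity_on (\<lambda>z. pull dec L \<omega> C z vs) (chart_image C)" if C: "C \<in> cm_atlas W" for C vs
    unfolding pull_def
    by (rule C_infinity_on_linear_compose[OF open_chart_image[OF W C] bounded_linear_cxlin[OF lin_proj_cxlin[OF L]] _
          smooth_form_C_infinity[OF sm lin_proj_chart(1)[OF L C]]])
      (use lin_proj_chart(2)[OF L C] in auto)
  fix C C' z vs assume C: "C \<in> cm_atlas W" "C' \<in> cm_atlas W" "z \<in> transition_dom C C'"
  have Lz: "L z \<in> transition_dom (dec C) (dec C')" "L (transition C C' z) = transition (dec C) (dec C') (L z)"
    using L C unfolding lin_proj_def by blast+
  show "pull dec L \<omega> C z vs = pull dec L \<omega> C' (transition C C' z) (map (frechet_derivative (transition C C') (at z)) vs)"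
    using smooth_form_transition[OF sm lin_proj_chart(1)[OF L C(1)] lin_proj_chart(1)[OF L C(2)] Lz(1), of "map L vs"]
    by (simp add: pull_def Lz(2) o_def lin_proj_derivative[OF W X L C])
qed

lemma smooth_form_mwedge:
  assumes W: "complex_manifold W" and a: "smooth_form W k \<alpha>" and b: "smooth_form W l \<beta>"
  shows "smooth_form W (k + l) (mwedge \<alpha> \<beta>)"
  unfolding smooth_form_def
proof (intro conjI ballI allI)
  show "everywhere W (alternating_form (k + l)) (mwedge \<alpha> \<beta>)"
    unfolding everywhere_def alternating_iff mwedge_def
    by (intro ballI alt_wedge smooth_form_alt[OF a] smooth_form_alt[OF b])
  show "C_infinity_on (\<lambda>z. mwedge \<alpha> \<beta> C z vs) (chart_image C)" if C: "C \<in> cm_atlas W" for C vs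
    unfolding mwedge_def
    by (intro C_infinity_on_wedge open_chart_image[OF W C] smooth_form_C_infinity[OF a C] smooth_form_C_infinity[OF b C])
  fix C C' z vs assume C: "C \<in> cm_atlas W" "C' \<in> cm_atlas W" "z \<in> transition_dom C C'"
  have "\<alpha> C z = (\<lambda>ws. \<alpha> C' (transition C C' z) (map (frechet_derivative (transition C C') (at z)) ws))"
    "\<beta> C z = (\<lambda>ws. \<beta> C' (transition C C' z) (map (frechet_derivative (transition C C') (at z)) ws))"
    by (rule ext, rule smooth_form_transition[OF a C], rule ext, rule smooth_form_transition[OF b C])
  then show "mwedge \<alpha> \<beta> C z vs = mwedge \<alpha> \<beta> C' (transition C C' z) (map (frechet_derivative (transition C C') (at z)) vs)"
    unfolding mwedge_def wedge_map by (simp only:)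
qed

lemma smooth_form_sum:
  assumes W: "complex_manifold W" and f: "\<And>i. i \<in> A \<Longrightarrow> smooth_form W k (f i)"
  shows "smooth_form W k (\<lambda>C z vs. \<Sum>i\<in>A. f i C z vs)"
  unfolding smooth_form_def
proof (intro conjI ballI allI)
  show "everywhere W (alternating_form k) (\<lambda>C z vs. \<Sum>i\<in>A. f i C z vs)"
    unfolding everywhere_def alternating_iff
    by (intro ballI alt_sum smooth_form_alt[OF f])
  show "C_infinity_on (\<lambda>z. \<Sum>i\<in>A. f i C z vs) (chart_image C)" if C: "C \<in> cm_atlas W" for C vs
    by (intro C_infinity_on_sum open_chart_image[OF W C] smooth_form_C_infinity[OF f C])
  fix C C' z vs assume C: "C \<in> cm_atlas W" "C' \<in> cm_atlas W" "z \<in> transition_dom C C'"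
  show "(\<Sum>i\<in>A. f i C z vs) = (\<Sum>i\<in>A. f i C' (transition C C' z) (map (frechet_derivative (transition C C') (at z)) vs))"
    by (intro sum.cong refl smooth_form_transition[OF f C])
qed


section \<open>Kaehler conditions under pullback, products and sums\<close>

text \<open>Killed by d, \<partial> and the conjugate of \<partial> at once. Each type of condition
  uses a different one of these operators, so this is the property a factor needs in order to pass
  through all of them.\<close>

definition all_closed :: "('a, 'm::finite) cmfd \<Rightarrow> ('a, 'm) mform \<Rightarrow> bool" where
  "all_closed X \<omega> \<longleftrightarrow> (\<forall>c\<in>cm_atlas X. \<forall>z\<in>chart_image c. \<forall>a b. chart_deriv (D_lin a b) (\<omega> c) z = (\<lambda>vs. 0))"

lemma ext_d_chart_deriv: "ext_d \<omega> c z = chart_deriv (D_lin 1 0) (\<omega> c) z"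
  by (simp add: ext_d_def ext_derivative_eq_chart_deriv D_full_eq)

lemma del_chart_deriv: "del \<omega> c z = chart_deriv (D_lin (1/2) (- \<i> / 2)) (\<omega> c) z"
  by (simp add: del_def ext_derivative_eq_chart_deriv D_hol_eq)

lemma delbar_chart_deriv: "delbar \<omega> c = chart_deriv (D_lin (1/2) (\<i> / 2)) (\<omega> c)"
  by (rule ext) (simp add: delbar_def ext_derivative_eq_chart_deriv D_antihol_eq)

text \<open>The operators \<open>D_lin a b\<close> form a two-dimensional space spanned by
  \<partial> and its conjugate, so vanishing has to be checked on these two only.\<close>

lemma chart_deriv_decomp:
  "chart_deriv (D_lin a b) \<alpha> z vs = (a + \<i> * b) * chart_deriv (D_lin (1/2) (- \<i> / 2)) \<alpha> z vs + (a - \<i> * b) * chart_deriv (D_lin (1/2) (\<i> / 2)) \<alpha> z vs"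
proof -
  have "D_lin a b f z v = (a + \<i> * b) * D_lin (1/2) (- \<i> / 2) f z v + (a - \<i> * b) * D_lin (1/2) (\<i> / 2) f z v" for f v
    by (simp add: D_lin_def field_simps)
  from this[of "\<lambda>y. \<alpha> y ws" for ws] show ?thesis
    unfolding chart_deriv_def sum_distrib_left sum.distrib[symmetric]
    by (intro sum.cong refl) (simp only: distrib_left mult.left_commute)
qed

lemma real_del_zero_imp_all_closed:
  assumes X: "complex_manifold X" and sm: "smooth_form X k \<omega>" and re: "everywhere X real_form \<omega>"
    and del: "form_eq X (del \<omega>) zero_mform"
  shows "all_closed X \<omega>"
  unfolding all_closed_def
proof (intro ballI allI)
  fix c z a b assume c: "c \<in> cm_atlas X" and z: "z \<in> chart_image c"
  have hol: "chart_deriv (D_lin (1/2) (- \<i> / 2)) (\<omega> c) z vs = 0" for vs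
    using del c z by (simp add: form_eq_def del_chart_deriv zero_mform_def fun_eq_iff)
  have conj: "D_lin (1/2) (\<i> / 2) (\<lambda>y. \<omega> c y vs) z v = cnj (D_lin (1/2) (- \<i> / 2) (\<lambda>y. \<omega> c y vs) z v)" for vs v
  proof -
    let ?f = "\<lambda>y. \<omega> c y vs"
    let ?D = "frechet_derivative ?f (at z)"
    have D: "(?f has_derivative ?D) (at z)"
      using smooth_form_diff[OF sm c z] by (simp add: diff_field_def frechet_derivative_works[symmetric])
    \<comment> \<open>Reality is known over the chart image only; openness of that image transfers
      it to the derivative.\<close>
    have eq: "cnj (?f y) = ?f y" if "y \<in> chart_image c" for y
      using re c that by (auto simp: everywhere_def real_form_def Reals_cnj_iff)
    have "(?f has_derivative (\<lambda>v. cnj (?D v))) (at z)"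
      by (rule has_derivative_cong_open[OF open_chart_image[OF X c] z eq, THEN iffD1, OF _ has_derivative_cnj[OF D]])
    then have "(\<lambda>v. cnj (?D v)) = ?D" using has_derivative_unique D by blast
    then have "cnj (?D v) = ?D v" for v by (rule fun_cong)
    then show ?thesis by (simp add: D_lin_def)
  qed
  have "chart_deriv (D_lin (1/2) (\<i> / 2)) (\<omega> c) z vs = cnj (chart_deriv (D_lin (1/2) (- \<i> / 2)) (\<omega> c) z vs)" for vs
    unfolding chart_deriv_def by (simp add: conj)
  then show "chart_deriv (D_lin a b) (\<omega> c) z = (\<lambda>vs. 0)"
    by (intro ext, subst chart_deriv_decomp) (simp only: hol complex_cnj_zero mult_zero_right add_0_right)
qed

lemma C_infinity_on_chart_deriv:
  assumes "complex_manifold X" "smooth_form X k \<omega>" "c \<in> cm_atlas X"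
  shows "C_infinity_on (\<lambda>z. chart_deriv (D_lin a b) (\<omega> c) z vs) (chart_image c)"
  unfolding chart_deriv_def using open_chart_image[OF assms(1,3)]
  by (intro C_infinity_on_sum C_infinity_on_mult C_infinity_on_const C_infinity_on_D_lin smooth_form_C_infinity[OF assms(2,3)])

lemma diff_field_chart_deriv:
  assumes "complex_manifold X" "smooth_form X k \<omega>" "c \<in> cm_atlas X" "z \<in> chart_image c"
  shows "diff_field (chart_deriv (D_lin a b) (\<omega> c)) z"
  unfolding diff_field_def using C_infinity_on_differentiable[OF C_infinity_on_chart_deriv[OF assms(1-3)] assms(4)] by blast

lemma chart_deriv_pull:
  assumes L: "lin_proj W X dec L" and sm: "smooth_form X k \<omega>" and C: "C \<in> cm_atlas W" "w \<in> chart_image C"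
  shows "chart_deriv (D_lin a b) (pull dec L \<omega> C) w = (\<lambda>vs. chart_deriv (D_lin a b) (\<omega> (dec C)) (L w) (map L vs))"
  unfolding pull_def
  by (rule ext, rule chart_deriv_pullback[OF lin_proj_cxlin[OF L] smooth_form_diff[OF sm]])
    (use lin_proj_chart[OF L C(1)] C(2) in auto)

text \<open>The formula for the first derivative holds on the whole open chart image and may
  therefore be differentiated again. The same device serves for products and sums.\<close>

lemma chart_deriv_twice_pull:
  assumes W: "complex_manifold W" and X: "complex_manifold X"
    and L: "lin_proj W X dec L" and sm: "smooth_form X k \<omega>" and C: "C \<in> cm_atlas W" "w \<in> chart_image C"
  shows "chart_deriv (D_lin a b) (chart_deriv (D_lin a' b') (pull dec L \<omega> C)) w =
    (\<lambda>vs. chart_deriv (D_lin a b) (chart_deriv (D_lin a' b') (\<omega> (dec C))) (L w) (map L vs))"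
proof -
  have "chart_deriv (D_lin a b) (chart_deriv (D_lin a' b') (pull dec L \<omega> C)) w =
     chart_deriv (D_lin a b) (\<lambda>y vs. chart_deriv (D_lin a' b') (\<omega> (dec C)) (L y) (map L vs)) w"
    by (rule chart_deriv_cong[OF open_chart_image[OF W C(1)] C(2)]) (simp add: chart_deriv_pull[OF L sm C(1)])
  also have "\<dots> = (\<lambda>vs. chart_deriv (D_lin a b) (chart_deriv (D_lin a' b') (\<omega> (dec C))) (L w) (map L vs))"
    by (rule ext, rule chart_deriv_pullback[OF lin_proj_cxlin[OF L] diff_field_chart_deriv[OF X sm]])
      (use lin_proj_chart[OF L C(1)] C(2) in auto)
  finally show ?thesis .
qed

lemma all_closed_pull:
  assumes "lin_proj W X dec L" "smooth_form X k \<omega>" "all_closed X \<omega>"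
  shows "all_closed W (pull dec L \<omega>)"
  using assms(3) unfolding all_closed_def
  by (auto simp: chart_deriv_pull[OF assms(1,2)] lin_proj_chart[OF assms(1)])

lemma everywhere_pull:
  assumes "lin_proj W X dec L" "everywhere X P \<omega>"
    "\<And>\<eta>. P \<eta> \<Longrightarrow> Q (\<lambda>vs. \<eta> (map L vs))"
  shows "everywhere W Q (pull dec L \<omega>)"
  using assms(2,3) lin_proj_chart[OF assms(1)] by (auto simp: everywhere_def pull_def)

lemma is_pq_component_pullback:
  assumes L: "cxlin L" and "is_pq_component p q \<Psi> \<Omega>"
  shows "is_pq_component p q (\<lambda>vs. \<Psi> (map L vs)) (\<lambda>vs. \<Omega> (map L vs))"
proof -
  obtain \<theta> where th: "\<And>r. r \<le> p + q \<Longrightarrow> pq_form r (p + q - r) (\<theta> r)"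
    "\<Psi> = (\<lambda>vs. \<Sum>r\<le>p + q. \<theta> r vs)" "\<Omega> = \<theta> p"
    using assms(2) unfolding is_pq_component_def by blast
  show ?thesis
    unfolding is_pq_component_def
    by (rule exI[of _ "\<lambda>r vs. \<theta> r (map L vs)"])
      (use th in \<open>auto simp: pq_form_iff intro: htype_pullback_cxlin[OF L]\<close>)
qed

lemma kahler_condition_pull:
  assumes W: "complex_manifold W" and X: "complex_manifold X" and L: "lin_proj W X dec L"
    and sm: "smooth_form X k \<Omega>" and K: "kahler_condition T X s \<Omega>"
  shows "kahler_condition T W s (pull dec L \<Omega>)"
proof (cases T)
  case Type_K
  then show ?thesis using K
    by (auto simp: form_eq_def ext_d_chart_deriv chart_deriv_pull[OF L sm] lin_proj_chart[OF L] zero_mform_def)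
next
  case Type_WK
  then obtain \<alpha> where a: "smooth_form X (2 * s - 1) \<alpha>" "form_eq X (del \<Omega>) (del (delbar \<alpha>))"
    using K by auto
  have "form_eq W (del (pull dec L \<Omega>)) (del (delbar (pull dec L \<alpha>)))"
    using a(2) by (auto simp: form_eq_def del_chart_deriv delbar_chart_deriv chart_deriv_pull[OF L sm] chart_deriv_twice_pull[OF W X L a(1)] lin_proj_chart[OF L])
  then show ?thesis using smooth_form_pull[OF W X L a(1)] Type_WK by auto
next
  case Type_S
  then obtain \<Psi> where p: "smooth_form X (2 * s) \<Psi>" "everywhere X real_form \<Psi>" "form_eq X (ext_d \<Psi>) zero_mform"
    "\<And>c z. c \<in> cm_atlas X \<Longrightarrow> z \<in> chart_image c \<Longrightarrow> is_pq_component s s (\<Psi> c z) (\<Omega> c z)"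
    using K by auto
  have "everywhere W real_form (pull dec L \<Psi>)"
    by (rule everywhere_pull[OF L p(2)]) (simp add: real_form_def)
  moreover have "form_eq W (ext_d (pull dec L \<Psi>)) zero_mform"
    using p(3) by (auto simp: form_eq_def ext_d_chart_deriv chart_deriv_pull[OF L p(1)] lin_proj_chart[OF L] zero_mform_def)
  moreover have "is_pq_component s s (pull dec L \<Psi> C z) (pull dec L \<Omega> C z)"
    if "C \<in> cm_atlas W" "z \<in> chart_image C" for C z
    unfolding pull_def using that
    by (intro is_pq_component_pullback lin_proj_cxlin[OF L] p(4) lin_proj_chart[OF L])
  ultimately show ?thesis using smooth_form_pull[OF W X L p(1)] Type_S by auto
next
  case Type_PL
  then show ?thesis using K
    by (auto simp: form_eq_def del_chart_deriv delbar_chart_deriv chart_deriv_twice_pull[OF W X L sm] lin_proj_chart[OF L] zero_mform_def)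
qed

text \<open>\<open>form_eq\<close> compares values over chart images only; these are open, so
  derivatives agree there too. It is used to exchange the factors of a product.\<close>

lemma kahler_condition_cong:
  assumes W: "complex_manifold W" and eq: "form_eq W \<omega> \<eta>" and K: "kahler_condition T W s \<omega>"
  shows "kahler_condition T W s \<eta>"
proof -
  have 1: "chart_deriv (D_lin a b) (\<eta> C) z = chart_deriv (D_lin a b) (\<omega> C) z" if "C \<in> cm_atlas W" "z \<in> chart_image C" for a b C z
    by (rule chart_deriv_cong[OF open_chart_image[OF W that(1)] that(2)]) (use eq that(1) in \<open>simp add: form_eq_def\<close>)
  have 2: "chart_deriv (D_lin a b) (chart_deriv (D_lin a' b') (\<eta> C)) z = chart_deriv (D_lin a b) (chart_deriv (D_lin a' b') (\<omega> C)) z"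
    if "C \<in> cm_atlas W" "z \<in> chart_image C" for a b a' b' C z
    by (rule chart_deriv_cong[OF open_chart_image[OF W that(1)] that(2)]) (simp add: 1 that(1))
  show ?thesis
  proof (cases T)
    case Type_K
    then show ?thesis using K by (simp add: form_eq_def ext_d_chart_deriv 1)
  next
    case Type_WK
    then show ?thesis using K by (simp add: form_eq_def del_chart_deriv 1)
  next
    case Type_S
    then show ?thesis using K eq by (simp add: form_eq_def)
  next
    case Type_PL
    then show ?thesis using K by (simp add: form_eq_def del_chart_deriv delbar_chart_deriv 2)
  qed
qed

lemma chart_deriv_mwedge_closed:
  assumes a: "smooth_form W (2 * k) \<alpha>" and cl: "all_closed W \<alpha>" and b: "smooth_form W l \<beta>"
    and C: "C \<in> cm_atlas W" "z \<in> chart_image C"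
  shows "chart_deriv (D_lin x y) (mwedge \<alpha> \<beta> C) z = wedge (\<alpha> C z) (chart_deriv (D_lin x y) (\<beta> C) z)"
proof
  fix vs
  have tw: "twist (\<alpha> C z) = \<alpha> C z" by (rule homog_even_twist[OF alt_homog[OF smooth_form_alt[OF a C]]])
  have "chart_deriv (D_lin x y) (\<alpha> C) z = (\<lambda>vs. 0)" using cl C unfolding all_closed_def by blast
  then show "chart_deriv (D_lin x y) (mwedge \<alpha> \<beta> C) z vs = wedge (\<alpha> C z) (chart_deriv (D_lin x y) (\<beta> C) z) vs"
    unfolding mwedge_def chart_deriv_wedge[OF smooth_form_diff[OF a C] smooth_form_diff[OF b C]] by (simp add: tw)
qed

lemma chart_deriv_twice_mwedge_closed:
  assumes W: "complex_manifold W" and a: "smooth_form W (2 * k) \<alpha>" and cl: "all_closed W \<alpha>" and b: "smooth_form W l \<beta>"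
    and C: "C \<in> cm_atlas W" "z \<in> chart_image C"
  shows "chart_deriv (D_lin x y) (chart_deriv (D_lin x' y') (mwedge \<alpha> \<beta> C)) z = wedge (\<alpha> C z) (chart_deriv (D_lin x y) (chart_deriv (D_lin x' y') (\<beta> C)) z)"
proof -
  have tw: "twist (\<alpha> C z) = \<alpha> C z" by (rule homog_even_twist[OF alt_homog[OF smooth_form_alt[OF a C]]])
  have 0: "chart_deriv (D_lin x y) (\<alpha> C) z = (\<lambda>vs. 0)" using cl C unfolding all_closed_def by blast
  have "chart_deriv (D_lin x y) (chart_deriv (D_lin x' y') (mwedge \<alpha> \<beta> C)) z =
     chart_deriv (D_lin x y) (\<lambda>z. wedge (\<alpha> C z) (chart_deriv (D_lin x' y') (\<beta> C) z)) z"
    by (rule chart_deriv_cong[OF open_chart_image[OF W C(1)] C(2)]) (simp add: chart_deriv_mwedge_closed[OF a cl b C(1)])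
  also have "\<dots> = wedge (\<alpha> C z) (chart_deriv (D_lin x y) (chart_deriv (D_lin x' y') (\<beta> C)) z)"
    by (rule ext, subst chart_deriv_wedge[OF smooth_form_diff[OF a C] diff_field_chart_deriv[OF W b C]]) (simp add: tw 0)
  finally show ?thesis .
qed

text \<open>Multiplication by a form of bidegree (a, a) shifts every component by a in both degrees.
  The components of the product with index below a or above a + 2 b are filled with zero.\<close>

lemma is_pq_component_wedge:
  assumes A: "htype (2 * a) 0 A" and "is_pq_component b b \<Psi> \<Omega>"
  shows "is_pq_component (a + b) (a + b) (wedge A \<Psi>) (wedge A \<Omega>)"
proof -
  obtain \<theta> where th: "\<And>r. r \<le> b + b \<Longrightarrow> pq_form r (b + b - r) (\<theta> r)"
    and P: "\<Psi> = (\<lambda>vs. \<Sum>r\<le>b + b. \<theta> r vs)" and O: "\<Omega> = \<theta> b"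
    using assms(2) unfolding is_pq_component_def by blast
  define \<theta>' where "\<theta>' r = (if a \<le> r \<and> r \<le> a + (b + b) then wedge A (\<theta> (r - a)) else (\<lambda>vs. 0))" for r
  have "pq_form r ((a + b) + (a + b) - r) (\<theta>' r)" if r: "r \<le> (a + b) + (a + b)" for r
  proof (cases "a \<le> r \<and> r \<le> a + (b + b)")
    case False
    then show ?thesis unfolding \<theta>'_def by (auto simp: pq_form_iff intro: htype_zero)
  next
    case True
    then have "htype (b + b) (int (r - a) - int (b + b - (r - a))) (\<theta> (r - a))"
      using th[of "r - a"] by (auto simp: pq_form_iff)
    note h = htype_wedge[OF A this]
    have e1: "2 * a + (b + b) = r + ((a + b) + (a + b) - r)" using r by simp
    have e2: "0 + (int (r - a) - int (b + b - (r - a))) = int r - int ((a + b) + (a + b) - r)"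
      using True by (simp add: of_nat_diff)
    show ?thesis using True h[unfolded e1 e2] by (simp add: pq_form_iff \<theta>'_def del: of_nat_add of_nat_diff)
  qed
  moreover have "wedge A \<Psi> = (\<lambda>vs. \<Sum>r\<le>(a + b) + (a + b). \<theta>' r vs)"
  proof
    fix vs
    have "(\<Sum>r\<le>(a + b) + (a + b). \<theta>' r vs) = (\<Sum>r\<in>{a..a + (b + b)}. wedge A (\<theta> (r - a)) vs)"
      by (rule sum.mono_neutral_cong_right) (auto simp: \<theta>'_def)
    also have "\<dots> = (\<Sum>r\<le>b + b. wedge A (\<theta> r) vs)"
      by (rule sum.reindex_bij_witness[of _ "\<lambda>r. r + a" "\<lambda>r. r - a"]) auto
    finally show "wedge A \<Psi> vs = (\<Sum>r\<le>(a + b) + (a + b). \<theta>' r vs)" by (simp add: P wedge_sum_right)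
  qed
  moreover have "wedge A \<Omega> = \<theta>' (a + b)" by (simp add: \<theta>'_def O)
  ultimately show ?thesis unfolding is_pq_component_def by blast
qed

lemma real_form_wedge: "real_form \<alpha> \<Longrightarrow> real_form \<beta> \<Longrightarrow> real_form (wedge \<alpha> \<beta>)"
  by (simp add: real_form_iff conj_form_wedge)

text \<open>
  If one factor is killed by \<open>\<partial>\<close> and its conjugate, exterior multiplication by it commutes with all
  the differential operators involved.
\<close>

lemma kahler_condition_mwedge_closed:
  assumes W: "complex_manifold W" and a: "smooth_form W (2 * a) \<alpha>" and cl: "all_closed W \<alpha>"
    and re: "everywhere W real_form \<alpha>" and ty: "everywhere W (htype (2 * a) 0) \<alpha>"
    and b: "smooth_form W (2 * b) \<beta>" and b1: "1 \<le> b" and K: "kahler_condition T W b \<beta>"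
  shows "kahler_condition T W (a + b) (mwedge \<alpha> \<beta>)"
proof (cases T)
  case Type_K
  then show ?thesis using K
    by (simp add: form_eq_def ext_d_chart_deriv chart_deriv_mwedge_closed[OF a cl b] zero_mform_def)
next
  case Type_WK
  then obtain \<eta> where e: "smooth_form W (2 * b - 1) \<eta>" "form_eq W (del \<beta>) (del (delbar \<eta>))"
    using K by auto
  \<comment> \<open>The closed factor passes through both operators, so \<alpha> \<and> \<eta> is
    the potential for the product.\<close>
  have "form_eq W (del (mwedge \<alpha> \<beta>)) (del (delbar (mwedge \<alpha> \<eta>)))"
    using e(2) by (simp add: form_eq_def del_chart_deriv delbar_chart_deriv chart_deriv_mwedge_closed[OF a cl b] chart_deriv_twice_mwedge_closed[OF W a cl e(1)])
  moreover have "smooth_form W (2 * (a + b) - 1) (mwedge \<alpha> \<eta>)"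
  proof -
    \<comment> \<open>Here b \<ge> 1 matters: the subtraction is truncated, and for b = 0 the
      degrees would not add up in general.\<close>
    have "2 * a + (2 * b - 1) = 2 * (a + b) - 1" using b1 by simp
    then show ?thesis using smooth_form_mwedge[OF W a e(1)] by simp
  qed
  ultimately show ?thesis using Type_WK by auto
next
  case Type_S
  then obtain \<Psi> where p: "smooth_form W (2 * b) \<Psi>" "everywhere W real_form \<Psi>" "form_eq W (ext_d \<Psi>) zero_mform"
    "\<And>c z. c \<in> cm_atlas W \<Longrightarrow> z \<in> chart_image c \<Longrightarrow> is_pq_component b b (\<Psi> c z) (\<beta> c z)"
    using K by auto
  have "smooth_form W (2 * (a + b)) (mwedge \<alpha> \<Psi>)"
    using smooth_form_mwedge[OF W a p(1)] by (simp add: algebra_simps)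
  moreover have "everywhere W real_form (mwedge \<alpha> \<Psi>)"
    using re p(2) by (simp add: everywhere_def mwedge_def real_form_wedge)
  moreover have "form_eq W (ext_d (mwedge \<alpha> \<Psi>)) zero_mform"
    using p(3) by (simp add: form_eq_def ext_d_chart_deriv chart_deriv_mwedge_closed[OF a cl p(1)] zero_mform_def)
  moreover have "is_pq_component (a + b) (a + b) (mwedge \<alpha> \<Psi> c z) (mwedge \<alpha> \<beta> c z)"
    if "c \<in> cm_atlas W" "z \<in> chart_image c" for c z
    unfolding mwedge_def using that ty p(4)[OF that] by (intro is_pq_component_wedge) (simp_all add: everywhere_def)
  ultimately show ?thesis using Type_S by auto
next
  case Type_PL
  then show ?thesis using K
    by (simp add: form_eq_def del_chart_deriv delbar_chart_deriv chart_deriv_twice_mwedge_closed[OF W a cl b] zero_mform_def)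
qed

lemma is_pq_component_sum:
  assumes "finite A" "\<And>i. i \<in> A \<Longrightarrow> is_pq_component p q (\<Psi> i) (\<Omega> i)"
  shows "is_pq_component p q (\<lambda>vs. \<Sum>i\<in>A. \<Psi> i vs) (\<lambda>vs. \<Sum>i\<in>A. \<Omega> i vs)"
proof -
  have "\<forall>i\<in>A. \<exists>\<theta>. (\<forall>r\<le>p + q. pq_form r (p + q - r) (\<theta> r)) \<and>
          \<Psi> i = (\<lambda>vs. \<Sum>r\<le>p + q. \<theta> r vs) \<and> \<Omega> i = \<theta> p"
    using assms(2) unfolding is_pq_component_def by blast
  from bchoice[OF this] obtain \<theta> where th: "\<And>i r. i \<in> A \<Longrightarrow> r \<le> p + q \<Longrightarrow> pq_form r (p + q - r) (\<theta> i r)"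
    and P: "\<And>i. i \<in> A \<Longrightarrow> \<Psi> i = (\<lambda>vs. \<Sum>r\<le>p + q. \<theta> i r vs)" and O: "\<And>i. i \<in> A \<Longrightarrow> \<Omega> i = \<theta> i p"
    by blast
  have "\<forall>r\<le>p + q. pq_form r (p + q - r) (\<lambda>vs. \<Sum>i\<in>A. \<theta> i r vs)"
    using th unfolding pq_form_iff by (auto intro: htype_sum)
  moreover have "(\<lambda>vs. \<Sum>i\<in>A. \<Psi> i vs) = (\<lambda>vs. \<Sum>r\<le>p + q. \<Sum>i\<in>A. \<theta> i r vs)"
    by (rule ext, subst sum.swap) (simp add: P)
  moreover have "(\<lambda>vs. \<Sum>i\<in>A. \<Omega> i vs) = (\<lambda>vs. \<Sum>i\<in>A. \<theta> i p vs)"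
    by (simp add: O)
  ultimately show ?thesis unfolding is_pq_component_def
    by (intro exI[of _ "\<lambda>r vs. \<Sum>i\<in>A. \<theta> i r vs"]) blast
qed

lemma chart_deriv_form_sum:
  assumes f: "\<And>i. i \<in> A \<Longrightarrow> smooth_form W k (f i)" and C: "C \<in> cm_atlas W" "z \<in> chart_image C"
  shows "chart_deriv (D_lin a b) (\<lambda>z vs. \<Sum>i\<in>A. f i C z vs) z = (\<lambda>vs. \<Sum>i\<in>A. chart_deriv (D_lin a b) (f i C) z vs)"
  by (rule ext, rule chart_deriv_sum) (rule smooth_form_diff[OF f C])

lemma chart_deriv_twice_form_sum:
  assumes W: "complex_manifold W" and f: "\<And>i. i \<in> A \<Longrightarrow> smooth_form W k (f i)"
    and C: "C \<in> cm_atlas W" "z \<in> chart_image C"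
  shows "chart_deriv (D_lin a b) (chart_deriv (D_lin a' b') (\<lambda>z vs. \<Sum>i\<in>A. f i C z vs)) z =
     (\<lambda>vs. \<Sum>i\<in>A. chart_deriv (D_lin a b) (chart_deriv (D_lin a' b') (f i C)) z vs)"
proof -
  have "chart_deriv (D_lin a b) (chart_deriv (D_lin a' b') (\<lambda>z vs. \<Sum>i\<in>A. f i C z vs)) z =
     chart_deriv (D_lin a b) (\<lambda>z vs. \<Sum>i\<in>A. chart_deriv (D_lin a' b') (f i C) z vs) z"
    by (rule chart_deriv_cong[OF open_chart_image[OF W C(1)] C(2)]) (simp add: chart_deriv_form_sum[OF f C(1)])
  also have "\<dots> = (\<lambda>vs. \<Sum>i\<in>A. chart_deriv (D_lin a b) (chart_deriv (D_lin a' b') (f i C)) z vs)"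
    by (rule ext, rule chart_deriv_sum) (rule diff_field_chart_deriv[OF W f C])
  finally show ?thesis .
qed

lemma kahler_condition_sum:
  assumes W: "complex_manifold W" and fin: "finite A"
    and f: "\<And>i. i \<in> A \<Longrightarrow> smooth_form W k (f i)" and K: "\<And>i. i \<in> A \<Longrightarrow> kahler_condition T W s (f i)"
  shows "kahler_condition T W s (\<lambda>C z vs. \<Sum>i\<in>A. f i C z vs)"
proof (cases T)
  case Type_K
  then show ?thesis using K
    by (simp add: form_eq_def ext_d_chart_deriv chart_deriv_form_sum[OF f] zero_mform_def)
next
  case Type_WK
  then have "\<forall>i\<in>A. \<exists>\<alpha>. smooth_form W (2 * s - 1) \<alpha> \<and> form_eq W (del (f i)) (del (delbar \<alpha>))"
    using K by auto
  from bchoice[OF this] obtain \<alpha> where a: "\<And>i. i \<in> A \<Longrightarrow> smooth_form W (2 * s - 1) (\<alpha> i)"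
    "\<And>i. i \<in> A \<Longrightarrow> form_eq W (del (f i)) (del (delbar (\<alpha> i)))" by blast
  have "form_eq W (del (\<lambda>C z vs. \<Sum>i\<in>A. f i C z vs)) (del (delbar (\<lambda>C z vs. \<Sum>i\<in>A. \<alpha> i C z vs)))"
    using a(2) by (simp add: form_eq_def del_chart_deriv delbar_chart_deriv chart_deriv_form_sum[OF f] chart_deriv_twice_form_sum[OF W a(1)])
  moreover have "smooth_form W (2 * s - 1) (\<lambda>C z vs. \<Sum>i\<in>A. \<alpha> i C z vs)"
    by (rule smooth_form_sum[OF W a(1)])
  ultimately show ?thesis using Type_WK by auto
next
  case Type_S
  then have "\<forall>i\<in>A. \<exists>\<Psi>. smooth_form W (2 * s) \<Psi> \<and> everywhere W real_form \<Psi> \<and> form_eq W (ext_d \<Psi>) zero_mform \<and>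
     (\<forall>c\<in>cm_atlas W. \<forall>z\<in>chart_image c. is_pq_component s s (\<Psi> c z) (f i c z))"
    using K by auto
  from bchoice[OF this] obtain \<Psi> where p: "\<And>i. i \<in> A \<Longrightarrow> smooth_form W (2 * s) (\<Psi> i)"
    "\<And>i. i \<in> A \<Longrightarrow> everywhere W real_form (\<Psi> i)" "\<And>i. i \<in> A \<Longrightarrow> form_eq W (ext_d (\<Psi> i)) zero_mform"
    "\<And>i c z. i \<in> A \<Longrightarrow> c \<in> cm_atlas W \<Longrightarrow> z \<in> chart_image c \<Longrightarrow> is_pq_component s s (\<Psi> i c z) (f i c z)"
    by blast
  have "everywhere W real_form (\<lambda>C z vs. \<Sum>i\<in>A. \<Psi> i C z vs)"
    using p(2) by (auto simp: everywhere_def real_form_def)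
  moreover have "form_eq W (ext_d (\<lambda>C z vs. \<Sum>i\<in>A. \<Psi> i C z vs)) zero_mform"
    using p(3) by (simp add: form_eq_def ext_d_chart_deriv chart_deriv_form_sum[OF p(1)] zero_mform_def)
  moreover have "is_pq_component s s (\<lambda>vs. \<Sum>i\<in>A. \<Psi> i c z vs) (\<lambda>vs. \<Sum>i\<in>A. f i c z vs)"
    if "c \<in> cm_atlas W" "z \<in> chart_image c" for c z
    by (intro is_pq_component_sum fin p(4) that)
  ultimately show ?thesis using smooth_form_sum[OF W p(1)] Type_S
    by (auto intro!: exI[of _ "\<lambda>C z vs. \<Sum>i\<in>A. \<Psi> i C z vs"])
next
  case Type_PL
  then show ?thesis using K
    by (simp add: form_eq_def del_chart_deriv delbar_chart_deriv chart_deriv_twice_form_sum[OF W f] zero_mform_def)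
qed


section \<open>Products of generalized Kaehler manifolds\<close>

lemma kahler_product_closed_left:
  assumes X: "complex_manifold X" and Y: "complex_manifold Y"
    and a: "smooth_form X (2 * a) \<alpha>" "everywhere X (pos_sum a) \<alpha>" "all_closed X \<alpha>"
    and b: "smooth_form Y (2 * b) \<beta>" "kahler_condition T Y b \<beta>" "1 \<le> b"
  shows "kahler_condition T (prod_cmfd X Y) (a + b)
    (mwedge (pull (left_chart X Y) pr1 \<alpha>) (pull (right_chart X Y) pr2 \<beta>))"
proof (rule kahler_condition_mwedge_closed)
  note W = complex_manifold_prod[OF X Y] and L = lin_proj_left[OF X Y] and R = lin_proj_right[OF X Y]
  show "complex_manifold (prod_cmfd X Y)" by (rule W)
  show "smooth_form (prod_cmfd X Y) (2 * a) (pull (left_chart X Y) pr1 \<alpha>)" by (rule smooth_form_pull[OF W X L a(1)])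
  show "smooth_form (prod_cmfd X Y) (2 * b) (pull (right_chart X Y) pr2 \<beta>)" by (rule smooth_form_pull[OF W Y R b(1)])
  show "all_closed (prod_cmfd X Y) (pull (left_chart X Y) pr1 \<alpha>)" by (rule all_closed_pull[OF L a(1,3)])
  show "everywhere (prod_cmfd X Y) real_form (pull (left_chart X Y) pr1 \<alpha>)"
    by (rule everywhere_pull[OF L a(2)]) (intro pos_sum_real pos_sum_pullback cxlin_pr1)
  show "everywhere (prod_cmfd X Y) (htype (2 * a) 0) (pull (left_chart X Y) pr1 \<alpha>)"
    by (rule everywhere_pull[OF L a(2)]) (intro pos_sum_htype pos_sum_pullback cxlin_pr1)
  show "kahler_condition T (prod_cmfd X Y) b (pull (right_chart X Y) pr2 \<beta>)"
    by (rule kahler_condition_pull[OF W Y R b(1,2)])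
qed (rule b(3))

text \<open>\<open>kahler_condition_mwedge_closed\<close> expects the closed factor first. Both
  factors have even degree, so they commute on the chart images, and
  \<open>kahler_condition_cong\<close> moves the condition to the required order.\<close>

lemma kahler_product_closed_right:
  assumes X: "complex_manifold X" and Y: "complex_manifold Y"
    and a: "smooth_form X (2 * a) \<alpha>" "kahler_condition T X a \<alpha>" "1 \<le> a"
    and b: "smooth_form Y (2 * b) \<beta>" "everywhere Y (pos_sum b) \<beta>" "all_closed Y \<beta>"
  shows "kahler_condition T (prod_cmfd X Y) (a + b)
    (mwedge (pull (left_chart X Y) pr1 \<alpha>) (pull (right_chart X Y) pr2 \<beta>))"
proof (rule kahler_condition_cong)
  note W = complex_manifold_prod[OF X Y] and L = lin_proj_left[OF X Y] and R = lin_proj_right[OF X Y]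
  let ?A = "pull (left_chart X Y) pr1 \<alpha>" and ?B = "pull (right_chart X Y) pr2 \<beta>"
  show "complex_manifold (prod_cmfd X Y)" by (rule W)
  have smA: "smooth_form (prod_cmfd X Y) (2 * a) ?A" by (rule smooth_form_pull[OF W X L a(1)])
  have smB: "smooth_form (prod_cmfd X Y) (2 * b) ?B" by (rule smooth_form_pull[OF W Y R b(1)])
  have "kahler_condition T (prod_cmfd X Y) (b + a) (mwedge ?B ?A)"
  proof (rule kahler_condition_mwedge_closed[OF W smB _ _ _ smA a(3)])
    show "all_closed (prod_cmfd X Y) ?B" by (rule all_closed_pull[OF R b(1,3)])
    show "everywhere (prod_cmfd X Y) real_form ?B"
      by (rule everywhere_pull[OF R b(2)]) (intro pos_sum_real pos_sum_pullback cxlin_pr2)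
    show "everywhere (prod_cmfd X Y) (htype (2 * b) 0) ?B"
      by (rule everywhere_pull[OF R b(2)]) (intro pos_sum_htype pos_sum_pullback cxlin_pr2)
    show "kahler_condition T (prod_cmfd X Y) a ?A"
      by (rule kahler_condition_pull[OF W X L a(1,2)])
  qed
  then show "kahler_condition T (prod_cmfd X Y) (a + b) (mwedge ?B ?A)" by (simp add: add.commute)
  have "mwedge ?B ?A C z vs = mwedge ?A ?B C z vs" if C: "C \<in> cm_atlas (prod_cmfd X Y)" "z \<in> chart_image C" for C z vs
    using wedge_commute[OF alt_homog[OF smooth_form_alt[OF smB C]] alt_homog[OF smooth_form_alt[OF smA C]], of vs]
    by (simp add: mwedge_def)
  then show "form_eq (prod_cmfd X Y) (mwedge ?B ?A) (mwedge ?A ?B)"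
    unfolding form_eq_def by blast
qed

text \<open>The forms are reindexed by codimension, with the volume form at b = 0, so that the sum
  has uniform terms up to its ends. From 1 \<le> p < m follow m \<ge> 2, which the exponent 1/(m -
  1) needs, and the presence of \<Omega> (m - 1) among the given forms.\<close>

lemma extend_by_volume_form:
  fixes X :: "('a, 'm::finite) cmfd"
  assumes X: "complex_manifold X" and p: "p < CARD('m)" "1 \<le> p"
    and \<Omega>: "\<And>s. p \<le> s \<Longrightarrow> s < CARD('m) \<Longrightarrow> kahler_form T X s (\<Omega> s) \<and> everywhere X (positive_form s) (\<Omega> s)"
  obtains A where "\<And>b. b \<le> CARD('m) - p \<Longrightarrow> smooth_form X (2 * (CARD('m) - b)) (A b)"
    "\<And>b. b \<le> CARD('m) - p \<Longrightarrow> everywhere X (strict_pos (CARD('m) - b)) (A b)"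
    "all_closed X (A 0)" "\<And>b. 1 \<le> b \<Longrightarrow> A b = \<Omega> (CARD('m) - b)"
proof -
  have tr: "transverse_smooth_form X s (\<Omega> s)" if "p \<le> s" "s < CARD('m)" for s
    using \<Omega>[OF that] by (simp add: kahler_form_def)
  have m: "CARD('m) \<ge> 2" "p \<le> CARD('m) - 1" "CARD('m) - 1 < CARD('m)" using p by auto
  obtain V where V: "smooth_form X (2 * CARD('m)) V" "everywhere X (strict_pos CARD('m)) V"
    "\<And>a b c z. c \<in> cm_atlas X \<Longrightarrow> z \<in> chart_image c \<Longrightarrow> chart_deriv (D_lin a b) (V c) z = (\<lambda>vs. 0)"
    using volume_form_exists[OF X tr[OF m(2,3)] m(1)] by blast
  define A where "A b = (if b = 0 then V else \<Omega> (CARD('m) - b))" for b :: nat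
  have "smooth_form X (2 * (CARD('m) - b)) (A b)" "everywhere X (strict_pos (CARD('m) - b)) (A b)"
    if b: "b \<le> CARD('m) - p" for b
  proof (atomize (full), cases "b = 0")
    case True
    then show "smooth_form X (2 * (CARD('m) - b)) (A b) \<and> everywhere X (strict_pos (CARD('m) - b)) (A b)"
      using V by (simp add: A_def)
  next
    case False
    then have s: "p \<le> CARD('m) - b" "CARD('m) - b < CARD('m)" using b p by auto
    have "everywhere X (strict_pos (CARD('m) - b)) (\<Omega> (CARD('m) - b))"
      using tr[OF s] \<Omega>[OF s] transverse_positive_imp_strict_pos
      unfolding everywhere_def transverse_smooth_form_def by blast
    then show "smooth_form X (2 * (CARD('m) - b)) (A b) \<and> everywhere X (strict_pos (CARD('m) - b)) (A b)"
      using tr[OF s] False by (simp add: A_def transverse_smooth_form_def)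
  qed
  moreover have "all_closed X (A 0)" unfolding all_closed_def A_def using V(3) by simp
  ultimately show ?thesis by (rule that) (simp_all add: A_def)
qed

theorem theorem5p4:
  fixes T :: kahler_type
    and X :: "('a, 'm::finite) cmfd" and Y :: "('b, 'n::finite) cmfd"
    and m n p q :: nat
    and \<Omega> :: "nat \<Rightarrow> ('a, 'm) mform" and \<Phi> :: "nat \<Rightarrow> ('b, 'n) mform"
  assumes "m = CARD('m)" and "n = CARD('n)"
    and "complex_manifold X" and "complex_manifold Y"
    and "1 \<le> p" and "p \<le> m - 1" and "1 \<le> q" and "q \<le> n - 1"
    and "\<And>s. p \<le> s \<Longrightarrow> s < m \<Longrightarrow> generalized_kahler T X s"
    and "\<And>s. q \<le> s \<Longrightarrow> s < n \<Longrightarrow> generalized_kahler T Y s"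
    and "\<And>s. p \<le> s \<Longrightarrow> s < m \<Longrightarrow> kahler_form T X s (\<Omega> s) \<and> everywhere X (positive_form s) (\<Omega> s)"
    and "\<And>s. q \<le> s \<Longrightarrow> s < n \<Longrightarrow> kahler_form T Y s (\<Phi> s) \<and> everywhere Y (positive_form s) (\<Phi> s)"
    and "m - p \<le> n - q \<Longrightarrow>
           \<forall>a. 1 \<le> a \<and> a < m - p \<longrightarrow>
             form_eq X (del (\<Omega> (p + a))) zero_mform \<or>
             (\<forall>r\<in>{n - a..n - 1}. form_eq Y (del (\<Phi> r)) zero_mform)"
    and "m - p > n - q \<Longrightarrow>
           \<forall>a. 1 \<le> a \<and> a < n - q \<longrightarrow>
             form_eq Y (del (\<Phi> (q + a))) zero_mform \<or>
             (\<forall>r\<in>{m - a..m - 1}. form_eq X (del (\<Omega> r)) zero_mform)"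
  shows "\<forall>s. m + n - min (m - p) (n - q) \<le> s \<and> s < m + n \<longrightarrow>
           generalized_kahler T (prod_cmfd X Y) s \<and>
           (\<exists>\<Theta>. kahler_form T (prod_cmfd X Y) s \<Theta> \<and>
                everywhere (prod_cmfd X Y) (positive_form s) \<Theta>)"
proof (intro allI impI)
  note m = assms(1) and n = assms(2) and X = assms(3) and Y = assms(4) and \<Omega> = assms(11) and \<Phi> = assms(12)
  let ?W = "prod_cmfd X Y"
  note W = complex_manifold_prod[OF X Y]
  fix s assume s: "m + n - min (m - p) (n - q) \<le> s \<and> s < m + n"
  \<comment> \<open>The codimension of an s-plane. It is at most m - p and n - q, so
    \<open>A\<close> and \<open>B\<close> supply forms for every codimension from 0 to l.\<close>
  define l where "l = m + n - s"
  have pm: "p < m" "q < n" using assms(5-8) by auto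
  have l: "1 \<le> l" "l \<le> m - p" "l \<le> n - q" and sl: "s = m + n - l"
    using s pm unfolding l_def by auto
  obtain A where smA: "\<And>b. b \<le> m - p \<Longrightarrow> smooth_form X (2 * (m - b)) (A b)"
    and posA: "\<And>b. b \<le> m - p \<Longrightarrow> everywhere X (strict_pos (m - b)) (A b)"
    and clA: "all_closed X (A 0)" and A: "\<And>b. 1 \<le> b \<Longrightarrow> A b = \<Omega> (m - b)"
    using extend_by_volume_form[OF X, of p T \<Omega>] pm(1) assms(5) \<Omega> unfolding m by blast
  obtain B where smB: "\<And>b. b \<le> n - q \<Longrightarrow> smooth_form Y (2 * (n - b)) (B b)"
    and posB: "\<And>b. b \<le> n - q \<Longrightarrow> everywhere Y (strict_pos (n - b)) (B b)"
    and clB: "all_closed Y (B 0)" and B: "\<And>b. 1 \<le> b \<Longrightarrow> B b = \<Phi> (n - b)"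
    using extend_by_volume_form[OF Y, of q T \<Phi>] pm(2) assms(7) \<Phi> unfolding n by blast
  have psA: "everywhere X (pos_sum (m - b)) (A b)" if "b \<le> m - p" for b
    using posA[OF that] by (simp add: everywhere_def strict_pos_def)
  have psB: "everywhere Y (pos_sum (n - b)) (B b)" if "b \<le> n - q" for b
    using posB[OF that] by (simp add: everywhere_def strict_pos_def)
  have KA: "kahler_condition T X (m - b) (A b)" if "1 \<le> b" "b \<le> m - p" for b
    using \<Omega>[of "m - b"] that pm by (simp add: A kahler_form_def)
  have KB: "kahler_condition T Y (n - b) (B b)" if "1 \<le> b" "b \<le> n - q" for b
    using \<Phi>[of "n - b"] that pm by (simp add: B kahler_form_def)
  have clA': "all_closed X (A b)" if "1 \<le> b" "b \<le> m - p" "form_eq X (del (\<Omega> (m - b))) zero_mform" for b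
    by (rule real_del_zero_imp_all_closed[OF X smA[OF that(2)]])
      (use psA[OF that(2)] pos_sum_real that A in \<open>auto simp: everywhere_def\<close>)
  have clB': "all_closed Y (B b)" if "1 \<le> b" "b \<le> n - q" "form_eq Y (del (\<Phi> (n - b))) zero_mform" for b
    by (rule real_del_zero_imp_all_closed[OF Y smB[OF that(2)]])
      (use psB[OF that(2)] pos_sum_real that B in \<open>auto simp: everywhere_def\<close>)
  have closed: "all_closed X (A b) \<or> all_closed Y (B (l - b))" if b: "1 \<le> b" "b < l" for b
  proof -
    have bl: "b \<le> m - p" "1 \<le> l - b" "l - b \<le> n - q" using b l by auto
    show ?thesis
    proof (cases "m - p \<le> n - q")
      case True
      \<comment> \<open>The instance a = m - p - b of hypothesis (i): p + a is m - b, and r = n - (l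
        - b) is at least n - a because l \<le> m - p.\<close>
      have "1 \<le> m - p - b \<and> m - p - b < m - p" using b l by auto
      with assms(13)[OF True] have "form_eq X (del (\<Omega> (p + (m - p - b)))) zero_mform \<or>
          (\<forall>r\<in>{n - (m - p - b)..n - 1}. form_eq Y (del (\<Phi> r)) zero_mform)"
        by blast
      moreover have "p + (m - p - b) = m - b" "n - (l - b) \<in> {n - (m - p - b)..n - 1}"
        using b l pm by auto
      ultimately have "form_eq X (del (\<Omega> (m - b))) zero_mform \<or> form_eq Y (del (\<Phi> (n - (l - b)))) zero_mform"
        by metis
      then show ?thesis using clA'[OF b(1)] clB'[of "l - b"] bl by blast
    next
      case False
      \<comment> \<open>The instance a = n - q - (l - b) of hypothesis (ii): q + a is n - (l - b),
        and r = m - b is at least m - a because l \<le> n - q.\<close>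
      have "1 \<le> n - q - (l - b) \<and> n - q - (l - b) < n - q" "m - p > n - q" using b l False by auto
      with assms(14) have "form_eq Y (del (\<Phi> (q + (n - q - (l - b))))) zero_mform \<or>
          (\<forall>r\<in>{m - (n - q - (l - b))..m - 1}. form_eq X (del (\<Omega> r)) zero_mform)"
        by blast
      moreover have "q + (n - q - (l - b)) = n - (l - b)" "m - b \<in> {m - (n - q - (l - b))..m - 1}"
        using b l pm by auto
      ultimately have "form_eq X (del (\<Omega> (m - b))) zero_mform \<or> form_eq Y (del (\<Phi> (n - (l - b)))) zero_mform"
        by metis
      then show ?thesis using clA'[OF b(1)] clB'[of "l - b"] bl by blast
    qed
  qed
  define F where "F b = mwedge (pull (left_chart X Y) pr1 (A b)) (pull (right_chart X Y) pr2 (B (l - b)))" for b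
  define \<Theta> where "\<Theta> = (\<lambda>C z vs. \<Sum>b\<le>l. F b C z vs)"
  have deg: "(m - b) + (n - (l - b)) = s" if "b \<le> l" for b using that l pm sl by auto
  have smF: "smooth_form ?W (2 * s) (F b)" if "b \<le> l" for b
  proof -
    have "smooth_form ?W (2 * (m - b) + 2 * (n - (l - b))) (F b)"
      unfolding F_def using that l
      by (intro smooth_form_mwedge W smooth_form_pull[OF W X lin_proj_left[OF X Y]]
          smooth_form_pull[OF W Y lin_proj_right[OF X Y]] smA smB) auto
    moreover have "2 * (m - b) + 2 * (n - (l - b)) = 2 * s" using deg[OF that] by simp
    ultimately show ?thesis by simp
  qed
  have KF: "kahler_condition T ?W s (F b)" if b: "b \<le> l" for b
  proof -
    have bl: "b \<le> m - p" "l - b \<le> n - q" and ge: "1 \<le> m - b" "1 \<le> n - (l - b)" using b l pm assms(5,7) by auto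
    have left: ?thesis if "all_closed X (A b)" "1 \<le> l - b"
      using kahler_product_closed_left[OF X Y smA[OF bl(1)] psA[OF bl(1)] that(1) smB[OF bl(2)] KB[OF that(2) bl(2)] ge(2)]
      by (simp add: F_def deg[OF b])
    have right: ?thesis if "all_closed Y (B (l - b))" "1 \<le> b"
      using kahler_product_closed_right[OF X Y smA[OF bl(1)] KA[OF that(2) bl(1)] ge(1) smB[OF bl(2)] psB[OF bl(2)] that(1)]
      by (simp add: F_def deg[OF b])
    \<comment> \<open>At b = 0 the closed factor is the volume form of X, at b = l that of Y. As l
      \<ge> 1, the other factor is then one of the given forms and carries the condition of type
      T.\<close>
    consider "b = 0" | "b = l" | "1 \<le> b" "b < l" using b l(1) by linarith
    then show ?thesis
    proof cases
      case 1
      then show ?thesis using left clA l(1) by simp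
    next
      case 2
      then show ?thesis using right clB l(1) by simp
    next
      case 3
      then show ?thesis using closed[OF 3] left right by auto
    qed
  qed
  have point: "transverse_form s (\<Theta> C z) \<and> positive_form s (\<Theta> C z)"
    if C: "C \<in> cm_atlas ?W" "z \<in> chart_image C" for C z
  proof -
    define A' where "A' b = A b (left_chart X Y C) (pr1 z)" for b
    define B' where "B' b = B b (right_chart X Y C) (pr2 z)" for b
    have "strict_pos (CARD('m) - b) (A' b)" if "b \<le> l" for b
      using posA[of b] that l lin_proj_chart[OF lin_proj_left[OF X Y] C(1)] C(2) by (auto simp: everywhere_def A'_def m)
    moreover have "strict_pos (CARD('n) - b) (B' b)" if "b \<le> l" for b
      using posB[of b] that l lin_proj_chart[OF lin_proj_right[OF X Y] C(1)] C(2) by (auto simp: everywhere_def B'_def n)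
    moreover have "l \<le> CARD('m)" "l \<le> CARD('n)" using l m n by auto
    moreover have "\<Theta> C z = (\<lambda>vs. \<Sum>b\<le>l. wedge (\<lambda>vs. A' b (map pr1 vs)) (\<lambda>vs. B' (l - b) (map pr2 vs)) vs)"
      by (simp add: \<Theta>_def F_def mwedge_def pull_def A'_def B'_def)
    ultimately show ?thesis
      using product_form_transverse[of l A' B'] by (simp add: sl m n)
  qed
  have "kahler_form T ?W s \<Theta>"
    unfolding kahler_form_def transverse_smooth_form_def
  proof (intro conjI)
    show "smooth_form ?W (2 * s) \<Theta>" unfolding \<Theta>_def by (rule smooth_form_sum[OF W smF]) simp
    show "everywhere ?W (transverse_form s) \<Theta>" using point by (simp add: everywhere_def)
    show "kahler_condition T ?W s \<Theta>" unfolding \<Theta>_def by (rule kahler_condition_sum[OF W _ smF KF]) simp_all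
  qed
  moreover have "everywhere ?W (positive_form s) \<Theta>" using point by (simp add: everywhere_def)
  moreover have "1 \<le> s" "s \<le> CARD('m + 'n) - 1" using l pm assms(5,7) sl by (auto simp: m n)
  ultimately show "generalized_kahler T ?W s \<and>
           (\<exists>\<Theta>. kahler_form T ?W s \<Theta> \<and> everywhere ?W (positive_form s) \<Theta>)"
    unfolding generalized_kahler_def using W by blast
qed

end
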